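(* For any constant $\alpha>0$, there exists a fully explicit (deterministic) algorithm which, for every vector $x\in\mathbb{R}^n$ in the strict turnstile model, finds the $\ell_1$ $\epsilon$-heavy hitters of $x$ (returning a list of $\mathcal{O}(1/\epsilon)$ coordinates containing all $i$ with $|x_i|\geq\epsilon\|x\|_1$), using space $\mathcal{O}((1/\epsilon)^{1+\alpha}(\log(\frac{1}{\epsilon})\log n)^{2+2/\alpha})$. The update time is $\mathcal{O}(\mathrm{poly}(\log n))$ and the query time is $\mathcal{O}(n\cdot\mathrm{poly}(\log n))$.
   Context: Strict turnstile model: a vector $x\in\mathbb{R}^n$, initially $0$, receives updates $(i,\Delta)$ which change $x_i$ to $x_i+\Delta$; insertions and deletions are allowed but $x_i\geq 0$ for all $i$ at all times. Space is measured in machine words.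
   Formalization: Containment of all heavy hitters is claimed only for x ≠ 0 (for x = 0 every coordinate qualifies, so no list of O(1/ε) entries suffices), and the bounds are for n ≥ 2 and 0 < ε ≤ 1/2, since the stated space bound vanishes for n = 1 and as ε → 1. *)

theory Defs
  imports "HOL-Analysis.Analysis"
begin

section \<open>The machine\<close>

text \<open>
  A deterministic unit-cost RAM. One memory bank holds integer words (natural numbers below
  the bound \<open>B\<close>, also used as addresses), the other one holds words containing one real number
  each, since the stream updates and the coordinates of \<open>x\<close> are real. Reals influence control flow
  only through comparisons (there is no rounding from reals to integers), and the only
  constants available in programs are natural numbers.
\<close>

datatype iexp =
    INum nat
  | ICell iexp
  | IAdd iexp iexp
  | ISub iexp iexp
  | IMul iexp iexp
  | IDiv iexp iexp
  | IMod iexp iexp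

datatype rexp =
    ROfInt iexp
  | RCell iexp
  | RAdd rexp rexp
  | RSub rexp rexp
  | RMul rexp rexp
  | RDiv rexp rexp

datatype bexp =
    ILess iexp iexp
  | RLess rexp rexp
  | BNot bexp
  | BAnd bexp bexp

datatype com =
    Skip
  | IAssign iexp iexp
  | RAssign iexp rexp
  | Emit iexp
  | Seq com com
  | Cond bexp com com
  | While bexp com

record state =
  imem :: "nat \<Rightarrow> nat"
  rmem :: "nat \<Rightarrow> real"
  out :: "nat list"

primrec ival :: "state \<Rightarrow> iexp \<Rightarrow> nat" where
  "ival s (INum k) = k"
| "ival s (ICell a) = imem s (ival s a)"
| "ival s (IAdd a b) = ival s a + ival s b"
| "ival s (ISub a b) = ival s a - ival s b"
| "ival s (IMul a b) = ival s a * ival s b"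
| "ival s (IDiv a b) = ival s a div ival s b"
| "ival s (IMod a b) = ival s a mod ival s b"

primrec rval :: "state \<Rightarrow> rexp \<Rightarrow> real" where
  "rval s (ROfInt a) = real (ival s a)"
| "rval s (RCell a) = rmem s (ival s a)"
| "rval s (RAdd a b) = rval s a + rval s b"
| "rval s (RSub a b) = rval s a - rval s b"
| "rval s (RMul a b) = rval s a * rval s b"
| "rval s (RDiv a b) = rval s a / rval s b"

primrec bval :: "state \<Rightarrow> bexp \<Rightarrow> bool" where
  "bval s (ILess a b) \<longleftrightarrow> ival s a < ival s b"
| "bval s (RLess a b) \<longleftrightarrow> rval s a < rval s b"
| "bval s (BNot b) \<longleftrightarrow> \<not> bval s b"
| "bval s (BAnd b c) \<longleftrightarrow> bval s b \<and> bval s c"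

text \<open>
  Legality of an evaluation when each bank has \<open>m\<close> cells: every address is below \<open>m\<close> and every
  integer that occurs, intermediate results included, is below \<open>B\<close>.
\<close>

primrec iok :: "nat \<Rightarrow> nat \<Rightarrow> state \<Rightarrow> iexp \<Rightarrow> bool" where
  "iok m B s (INum k) \<longleftrightarrow> k < B"
| "iok m B s (ICell a) \<longleftrightarrow> iok m B s a \<and> ival s a < m \<and> imem s (ival s a) < B"
| "iok m B s (IAdd a b) \<longleftrightarrow> iok m B s a \<and> iok m B s b \<and> ival s a + ival s b < B"
| "iok m B s (ISub a b) \<longleftrightarrow> iok m B s a \<and> iok m B s b"
| "iok m B s (IMul a b) \<longleftrightarrow> iok m B s a \<and> iok m B s b \<and> ival s a * ival s b < B"
| "iok m B s (IDiv a b) \<longleftrightarrow> iok m B s a \<and> iok m B s b"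
| "iok m B s (IMod a b) \<longleftrightarrow> iok m B s a \<and> iok m B s b"

primrec rok :: "nat \<Rightarrow> nat \<Rightarrow> state \<Rightarrow> rexp \<Rightarrow> bool" where
  "rok m B s (ROfInt a) \<longleftrightarrow> iok m B s a"
| "rok m B s (RCell a) \<longleftrightarrow> iok m B s a \<and> ival s a < m"
| "rok m B s (RAdd a b) \<longleftrightarrow> rok m B s a \<and> rok m B s b"
| "rok m B s (RSub a b) \<longleftrightarrow> rok m B s a \<and> rok m B s b"
| "rok m B s (RMul a b) \<longleftrightarrow> rok m B s a \<and> rok m B s b"
| "rok m B s (RDiv a b) \<longleftrightarrow> rok m B s a \<and> rok m B s b"

primrec bok :: "nat \<Rightarrow> nat \<Rightarrow> state \<Rightarrow> bexp \<Rightarrow> bool" where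
  "bok m B s (ILess a b) \<longleftrightarrow> iok m B s a \<and> iok m B s b"
| "bok m B s (RLess a b) \<longleftrightarrow> rok m B s a \<and> rok m B s b"
| "bok m B s (BNot b) \<longleftrightarrow> bok m B s b"
| "bok m B s (BAnd b c) \<longleftrightarrow> bok m B s b \<and> bok m B s c"

text \<open>
  \<open>exec m B c s t s'\<close>: started in \<open>s\<close>, the program \<open>c\<close> halts in \<open>s'\<close> after \<open>t\<close> steps without any
  illegal evaluation (an illegal evaluation leaves the machine stuck). An assignment, output or
  test costs one step; as the expressions of a fixed program have bounded size, counting
  individual operations would change \<open>t\<close> by at most a constant factor.
\<close>

inductive exec :: "nat \<Rightarrow> nat \<Rightarrow> com \<Rightarrow> state \<Rightarrow> nat \<Rightarrow> state \<Rightarrow> bool"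
  for m B :: nat where
  exec_Skip: "exec m B Skip s 1 s"
| exec_IAssign:
    "iok m B s a \<Longrightarrow> ival s a < m \<Longrightarrow> iok m B s e \<Longrightarrow>
     exec m B (IAssign a e) s 1 (s\<lparr>imem := (imem s)(ival s a := ival s e)\<rparr>)"
| exec_RAssign:
    "iok m B s a \<Longrightarrow> ival s a < m \<Longrightarrow> rok m B s e \<Longrightarrow>
     exec m B (RAssign a e) s 1 (s\<lparr>rmem := (rmem s)(ival s a := rval s e)\<rparr>)"
| exec_Emit:
    "iok m B s e \<Longrightarrow> exec m B (Emit e) s 1 (s\<lparr>out := out s @ [ival s e]\<rparr>)"
| exec_Seq:
    "exec m B c1 s t1 s' \<Longrightarrow> exec m B c2 s' t2 s'' \<Longrightarrow> exec m B (Seq c1 c2) s (t1 + t2) s''"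
| exec_CondTrue:
    "bok m B s b \<Longrightarrow> bval s b \<Longrightarrow> exec m B c1 s t s' \<Longrightarrow> exec m B (Cond b c1 c2) s (t + 1) s'"
| exec_CondFalse:
    "bok m B s b \<Longrightarrow> \<not> bval s b \<Longrightarrow> exec m B c2 s t s' \<Longrightarrow> exec m B (Cond b c1 c2) s (t + 1) s'"
| exec_WhileTrue:
    "bok m B s b \<Longrightarrow> bval s b \<Longrightarrow> exec m B c s t1 s' \<Longrightarrow> exec m B (While b c) s' t2 s'' \<Longrightarrow>
     exec m B (While b c) s (t1 + t2 + 1) s''"
| exec_WhileFalse:
    "bok m B s b \<Longrightarrow> \<not> bval s b \<Longrightarrow> exec m B (While b c) s 1 s"

lemma exec_deterministic:
  "exec m B c s t s' \<Longrightarrow> exec m B c s u s'' \<Longrightarrow> u = t \<and> s'' = s'"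
proof (induction arbitrary: u s'' rule: exec.induct)
  case (exec_Skip s)
  from exec_Skip.prems show ?case by cases simp
next
  case (exec_IAssign s a e)
  from exec_IAssign.prems show ?case by cases simp
next
  case (exec_RAssign s a e)
  from exec_RAssign.prems show ?case by cases simp
next
  case (exec_Emit s e)
  from exec_Emit.prems show ?case by cases simp
next
  case (exec_Seq c1 s t1 s1 c2 t2 s2)
  note IH = exec_Seq.IH
  from exec_Seq.prems show ?case
  proof cases
    case (exec_Seq v1 r v2)
    with IH(1)[of v1 r] IH(2)[of v2 s''] show ?thesis by simp
  qed
next
  case (exec_CondTrue s b c1 t s1 c2)
  from exec_CondTrue.prems show ?case
    by cases (use exec_CondTrue.hyps in \<open>auto dest: exec_CondTrue.IH\<close>)
next
  case (exec_CondFalse s b c2 t s1 c1)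
  from exec_CondFalse.prems show ?case
    by cases (use exec_CondFalse.hyps in \<open>auto dest: exec_CondFalse.IH\<close>)
next
  case (exec_WhileTrue s b c t1 s1 t2 s2)
  note IH = exec_WhileTrue.IH
  from exec_WhileTrue.prems show ?case
  proof cases
    case (exec_WhileTrue v1 r v2)
    with IH(1)[of v1 r] IH(2)[of v2 s''] show ?thesis by simp
  next
    case exec_WhileFalse
    with \<open>bval s b\<close> show ?thesis by simp
  qed
next
  case (exec_WhileFalse s b c)
  from exec_WhileFalse.prems show ?case
    by cases (use exec_WhileFalse.hyps in auto)
qed


section \<open>Streams\<close>

text \<open>An update \<open>(i, \<Delta>)\<close> is a pair; coordinates are numbered \<open>0, \<dots>, n - 1\<close>.\<close>

type_synonym stream = "(nat \<times> real) list"

definition stream_vec :: "stream \<Rightarrow> nat \<Rightarrow> real" where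
  "stream_vec \<sigma> i = (\<Sum>(j, \<Delta>)\<leftarrow>\<sigma>. if j = i then \<Delta> else 0)"

definition strict_turnstile :: "nat \<Rightarrow> stream \<Rightarrow> bool" where
  "strict_turnstile n \<sigma> \<longleftrightarrow>
     (\<forall>(i, \<Delta>) \<in> set \<sigma>. i < n) \<and>
     (\<forall>k \<le> length \<sigma>. \<forall>i < n. stream_vec (take k \<sigma>) i \<ge> 0)"

definition l1_norm :: "nat \<Rightarrow> (nat \<Rightarrow> real) \<Rightarrow> real" where
  "l1_norm n x = (\<Sum>i<n. \<bar>x i\<bar>)"

definition heavy_hitters :: "nat \<Rightarrow> real \<Rightarrow> (nat \<Rightarrow> real) \<Rightarrow> nat set" where
  "heavy_hitters n \<epsilon> x = {i. i < n \<and> \<bar>x i\<bar> \<ge> \<epsilon> * l1_norm n x}"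


section \<open>Running a streaming algorithm\<close>

text \<open>
  There is no preprocessing phase: apart from the parameters, the memory is initially zero.
  All data the algorithm relies on is thus computed by its update and query programs,
  within their time bounds.
\<close>

definition initial_state :: "nat \<Rightarrow> real \<Rightarrow> real \<Rightarrow> state" where
  "initial_state n \<epsilon> \<alpha> =
     \<lparr>imem = (\<lambda>_. 0)(0 := n), rmem = (\<lambda>_. 0)(0 := \<epsilon>, 1 := \<alpha>), out = []\<rparr>"

definition load_update :: "nat \<Rightarrow> real \<Rightarrow> state \<Rightarrow> state" where
  "load_update i \<Delta> s = s\<lparr>imem := (imem s)(1 := i), rmem := (rmem s)(2 := \<Delta>), out := []\<rparr>"

text \<open>
  \<open>processed m B T upd s0 \<sigma> s\<close>: running \<open>upd\<close> once for each update of \<open>\<sigma>\<close>, each time for at most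
  \<open>T\<close> steps, leads from \<open>s0\<close> to \<open>s\<close>. Programs cannot read \<open>out\<close>; clearing it between
  runs only separates the outputs.
\<close>

inductive processed :: "nat \<Rightarrow> nat \<Rightarrow> real \<Rightarrow> com \<Rightarrow> state \<Rightarrow> stream \<Rightarrow> state \<Rightarrow> bool"
  for m B :: nat and T :: real and upd :: com and s0 :: state where
  processed_Nil: "processed m B T upd s0 [] s0"
| processed_snoc:
    "processed m B T upd s0 \<sigma> s \<Longrightarrow> exec m B upd (load_update i \<Delta> s) t s' \<Longrightarrow> real t \<le> T \<Longrightarrow>
     processed m B T upd s0 (\<sigma> @ [(i, \<Delta>)]) s'"

definition query_result :: "nat \<Rightarrow> nat \<Rightarrow> real \<Rightarrow> com \<Rightarrow> state \<Rightarrow> nat list \<Rightarrow> bool" where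
  "query_result m B T qry s xs \<longleftrightarrow>
     (\<exists>t s'. exec m B qry (s\<lparr>out := []\<rparr>) t s' \<and> real t \<le> T \<and> out s' = xs)"

end

theory Submission
  imports Defs "HOL-Computational_Algebra.Computational_Algebra" "HOL-Library.Log_Nat"
    "HOL-Real_Asymp.Real_Asymp"
begin

text \<open>
  The algorithm is a Count-Min sketch whose hash functions come from an unbalanced expander. Coordinate \<open>i\<close>
  is the polynomial \<open>f\<^sub>i\<close> whose coefficients are the bits of \<open>i\<close>; for a prime \<open>q\<close> and every \<open>y = 1, \<dots>, q - 1\<close>
  it is hashed to the bucket \<open>(y, f\<^sub>i(y), (\<theta> f\<^sub>i)(y), \<dots>, (\<theta>\<^sup>r\<^sup>-\<^sup>1 f\<^sub>i)(y))\<close> over the field with \<open>q\<close> elements, where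
  \<open>\<theta> = X d/dX\<close> (a multiplicity code, as in the expanders of Kalev and Ta-Shma).
  All \<open>i\<close> whose buckets all weigh at least \<open>\<epsilon> \<parallel>x\<parallel>\<^sub>1\<close> are reported. Since \<open>x \<ge> 0\<close>, no heavy hitter is lost;
  the buckets of the reported set \<open>F\<close> number at most \<open>(q - 1) / \<epsilon>\<close>, so it suffices that \<open>F\<close> has at least
  \<open>|F| (q - 1) / 2\<close> buckets.

  For this expansion take a nonzero polynomial \<open>Q(X, Y\<^sub>1, \<dots>, Y\<^sub>r)\<close> of low degree that vanishes on all buckets
  of \<open>F\<close>. Then \<open>Q(X, f, \<theta> f, \<dots>) = 0\<close> for all \<open>f\<close> in \<open>F\<close>. If \<open>Y\<^sub>v\<close> is the last variable of \<open>Q\<close>, then at a point where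
  \<open>\<partial>Q/\<partial>Y\<^sub>v \<noteq> 0\<close> this differential equation determines \<open>f\<close>, so such buckets are private to \<open>f\<close>; those \<open>f\<close> that
  also solve \<open>\<partial>Q/\<partial>Y\<^sub>v = 0\<close> are treated by induction on the degree.

  With suitable \<open>r\<close> and \<open>q\<close> the number of buckets is
  \<open>O((1/\<epsilon>)\<^sup>1\<^sup>+\<^sup>\<beta> (log (1/\<epsilon>) log n)\<^sup>2\<^sup>+\<^sup>1\<^sup>/\<^sup>\<beta>)\<close>
  for any fixed rational \<open>\<beta> > 0\<close>,
  and every \<open>\<beta>\<close> in \<open>[\<alpha>/2, \<alpha>]\<close> is good enough. So the machine never handles powers with exponent \<open>\<alpha>\<close>: all
  parameters come from integer arithmetic, fast enough to be recomputed in every run.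
\<close>

section \<open>Primes in linear gaps\<close>

definition primorial :: "nat \<Rightarrow> nat" where
  "primorial n = \<Prod>{p. prime p \<and> p \<le> n}"

lemma prod_primes_dvd:
  fixes N :: nat
  assumes "finite A" "\<And>p. p \<in> A \<Longrightarrow> prime p \<and> p dvd N"
  shows "\<Prod>A dvd N"
proof (cases "A = {}")
  case False
  have "Lcm A = normalize (\<Prod>A)"
    using assms False by (intro Lcm_coprime) (auto intro: primes_coprime)
  then show ?thesis using assms(2) by (metis Lcm_least normalize_dvd_iff)
qed simp

lemma choose_odd_middle_le: "(2 * m + 1) choose m \<le> 4 ^ m"
proof -
  have "((2 * m + 1) choose m) + ((2 * m + 1) choose (m + 1)) = (\<Sum>k\<in>{m, m + 1}. (2 * m + 1) choose k)"
    by simp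
  also have "\<dots> \<le> (\<Sum>k\<le>2 * m + 1. (2 * m + 1) choose k)"
    by (intro sum_mono2) auto
  also have "\<dots> = 2 * 4 ^ m"
    unfolding choose_row_sum by (simp add: power_mult)
  finally show ?thesis
    using binomial_symmetric[of m "2 * m + 1"] by simp
qed

lemma prod_primes_upper_half_le: "\<Prod>{p. prime p \<and> m + 1 < p \<and> p \<le> 2 * m + 1} \<le> 4 ^ m"
proof -
  have "p dvd (2 * m + 1) choose m" if p: "prime p" "m + 1 < p" "p \<le> 2 * m + 1" for p
  proof -
    have "fact m * fact (m + 1) * ((2 * m + 1) choose m) = (fact (2 * m + 1) :: nat)"
      using binomial_fact_lemma[of m "2 * m + 1"] by simp
    moreover have "p dvd (fact (2 * m + 1) :: nat)" "\<not> p dvd fact m" "\<not> p dvd fact (m + 1)"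
      using p by (simp_all add: prime_dvd_fact_iff del: fact_Suc)
    ultimately show ?thesis using p by (metis prime_dvd_mult_iff)
  qed
  then have "\<Prod>{p. prime p \<and> m + 1 < p \<and> p \<le> 2 * m + 1} dvd (2 * m + 1) choose m"
    by (intro prod_primes_dvd) (auto intro: finite_subset[of _ "{..2 * m + 1}"])
  then have "\<Prod>{p. prime p \<and> m + 1 < p \<and> p \<le> 2 * m + 1} \<le> (2 * m + 1) choose m"
    by (rule dvd_imp_le) simp
  then show ?thesis using choose_odd_middle_le by (rule order_trans)
qed

lemma primorial_odd_le: "primorial (2 * m + 1) \<le> primorial (m + 1) * 4 ^ m"
proof -
  let ?A = "{p::nat. prime p \<and> p \<le> m + 1}" and ?B = "{p::nat. prime p \<and> m + 1 < p \<and> p \<le> 2 * m + 1}"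
  have "{p::nat. prime p \<and> p \<le> 2 * m + 1} = ?A \<union> ?B" by (auto simp: prime_gt_0_nat)
  moreover have "finite ?A" "finite ?B"
    by (rule finite_subset[of _ "{..2 * m + 1}"]; force)+
  ultimately have "primorial (2 * m + 1) = primorial (m + 1) * \<Prod>?B"
    unfolding primorial_def by (simp only:) (rule prod.union_disjoint, auto)
  then show ?thesis using prod_primes_upper_half_le by simp
qed

lemma primorial_le: "primorial n \<le> 4 ^ n"
proof (induction n rule: less_induct)
  case (less n)
  consider "n < 2" | "n = 2" | "n > 2" "odd n" | "n > 2" "even n" by linarith
  then show ?case
  proof cases
    case 1
    then have "{p. prime p \<and> p \<le> n} = {}" by (auto dest: prime_gt_1_nat)
    then show ?thesis unfolding primorial_def by (simp only: prod.empty) simp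
  next
    case 2
    then have "{p. prime p \<and> p \<le> n} = {2}" by (auto dest: prime_ge_2_nat)
    then show ?thesis using 2 by (simp add: primorial_def)
  next
    case 3
    then obtain m where m: "n = 2 * m + 1" "m \<ge> 1" by (auto elim!: oddE)
    have "primorial n \<le> primorial (m + 1) * 4 ^ m" unfolding m(1) by (rule primorial_odd_le)
    also have "\<dots> \<le> 4 ^ (m + 1) * 4 ^ m" using less.IH[of "m + 1"] m by (intro mult_le_mono1) auto
    also have "\<dots> = 4 ^ n" by (simp add: m(1) mult_2 flip: power_add)
    finally show ?thesis .
  next
    case 4
    then have "\<not> prime n" using primes_dvd_imp_eq two_is_prime_nat by blast
    then have "prime p \<and> p \<le> n \<longleftrightarrow> prime p \<and> p \<le> n - 1" for p
      by (cases "p = n") auto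
    then have "primorial n = primorial (n - 1)" unfolding primorial_def by simp
    also have "\<dots> \<le> 4 ^ (n - 1)" using less.IH 4 by simp
    also have "\<dots> \<le> 4 ^ n" by (rule power_increasing) auto
    finally show ?thesis .
  qed
qed

lemma leibniz_triangle:
  assumes "1 \<le> k" "k < n"
  shows "1 / real (k * (n choose k)) =
    1 / real (k * ((n - 1) choose k)) - 1 / real ((k + 1) * (n choose (k + 1)))"
proof -
  have "(k + 1) * (n choose (k + 1)) = (n - k) * (n choose k)"
    using binomial_absorb_comp[of n k] times_binomial_minus1_eq[of "k + 1" n] assms by simp
  moreover have "n * ((n - 1) choose k) = (n - k) * (n choose k)"
    using binomial_absorb_comp[of n k] assms by simp
  then have "1 / real (k * ((n - 1) choose k)) = real n / (real k * real ((n - k) * (n choose k)))"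
    using assms by (simp add: field_simps flip: of_nat_mult)
  moreover have "real (n - k) = real n - real k" "real (n - k) > 0" using assms by auto
  moreover have "real (n choose k) > 0" using assms by simp
  ultimately show ?thesis using assms by (simp add: divide_simps del: of_nat_diff)
qed

lemma common_multiple_div_leibniz_Ints:
  assumes "\<And>m. 1 \<le> m \<Longrightarrow> m \<le> n \<Longrightarrow> m dvd W" "1 \<le> k" "k \<le> n"
  shows "real W / real (k * (n choose k)) \<in> \<int>"
  using assms
proof (induction "n - k" arbitrary: k n)
  case 0
  then have "n dvd W" "k = n" by auto
  then show ?case by auto
next
  case (Suc j)
  have "real W / real (k * ((n - 1) choose k)) \<in> \<int>"
    using Suc.prems Suc.hyps(2) by (intro Suc.hyps(1)) auto
  moreover have "real W / real ((k + 1) * (n choose (k + 1))) \<in> \<int>"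
    using Suc.prems Suc.hyps(2) by (intro Suc.hyps(1)) auto
  moreover have "real W / real (k * (n choose k)) =
      real W / real (k * ((n - 1) choose k)) - real W / real ((k + 1) * (n choose (k + 1)))"
    using arg_cong[OF leibniz_triangle[of k n], of "(*) (real W)"] Suc.prems Suc.hyps(2)
    by (simp only: right_diff_distrib times_divide_eq_right mult_1_right)
  ultimately show ?case by (simp only: Ints_diff)
qed

lemma Lcm_interval_pos: "Lcm {1..n::nat} > 0"
  by (induction n) (auto simp: atLeastAtMostSuc_conv lcm_pos_nat)

lemma two_power_le_Lcm_interval: "2 ^ n \<le> Lcm {1..Suc n}"
proof -
  let ?W = "Lcm {1..Suc n}"
  have "Suc n * (n choose k) \<le> ?W" if "k \<le> n" for k
  proof -
    let ?x = "real ?W / real (Suc n * (n choose k))"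
    have pos: "real (Suc n * (n choose k)) > 0" using that by (simp del: mult_Suc)
    have "real ?W / real (Suc k * (Suc n choose Suc k)) \<in> \<int>"
      using that by (intro common_multiple_div_leibniz_Ints dvd_Lcm) auto
    then have "?x \<in> \<int>" by (simp only: Suc_times_binomial_eq mult.commute)
    moreover have "?x > 0" using Lcm_interval_pos[of "Suc n"] pos by (intro divide_pos_pos) simp_all
    ultimately have "1 \<le> ?x" by (auto elim!: Ints_cases)
    then show ?thesis by (simp only: pos_le_divide_eq[OF pos] mult_1 of_nat_le_iff)
  qed
  then have "(\<Sum>k\<le>n. Suc n * (n choose k)) \<le> (\<Sum>k\<le>n. ?W)" by (intro sum_mono) auto
  then have "Suc n * 2 ^ n \<le> Suc n * ?W"
    by (simp add: choose_row_sum flip: sum_distrib_left del: mult_Suc)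
  then show ?thesis by (simp del: mult_Suc)
qed

lemma prime_power_multiplicity_Lcm_interval_le:
  fixes p n :: nat
  assumes "prime p" "n \<ge> 1"
  shows "p ^ multiplicity p (Lcm {1..n}) \<le> n"
  using assms(2)
proof (induction n rule: dec_induct)
  case base
  then show ?case using assms by simp
next
  case (step n)
  have "multiplicity p (Lcm {1..Suc n}) = max (multiplicity p (Suc n)) (multiplicity p (Lcm {1..n}))"
    using Lcm_interval_pos[of n] assms by (simp add: atLeastAtMostSuc_conv multiplicity_lcm)
  moreover have "p ^ multiplicity p (Suc n) \<le> Suc n"
    by (rule dvd_imp_le[OF multiplicity_dvd]) simp
  ultimately show ?case using step.IH by (simp add: max_def)
qed

lemma Lcm_interval_eq_prod:
  fixes n :: nat
  assumes "n \<ge> 1"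
  shows "Lcm {1..n} = (\<Prod>p | prime p \<and> p \<le> n. p ^ multiplicity p (Lcm {1..n}))"
proof -
  let ?W = "Lcm {1..n}"
  have "p \<le> n" if "p \<in> prime_factors ?W" for p
  proof -
    have p: "prime p" "multiplicity p ?W \<ge> 1"
      using that by (auto simp: prime_factors_multiplicity Suc_le_eq)
    then have "p ^ 1 \<le> p ^ multiplicity p ?W"
      by (intro power_increasing) (auto simp: prime_gt_0_nat Suc_le_eq)
    also have "\<dots> \<le> n" using p(1) assms by (rule prime_power_multiplicity_Lcm_interval_le)
    finally show ?thesis by simp
  qed
  then have sub: "prime_factors ?W \<subseteq> {p. prime p \<and> p \<le> n}"
    using in_prime_factors_imp_prime by blast
  have "?W = (\<Prod>p\<in>prime_factors ?W. p ^ multiplicity p ?W)"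
    using Lcm_interval_pos by (rule prime_factorization_nat)
  also have "\<dots> = (\<Prod>p | prime p \<and> p \<le> n. p ^ multiplicity p ?W)"
    by (rule prod.mono_neutral_left[OF _ sub])
      (auto simp: prime_factors_multiplicity intro: finite_subset[of _ "{..n}"])
  finally show ?thesis .
qed

lemma prime_power_multiplicity_Lcm_interval_le_prime:
  fixes p n :: nat
  assumes "prime p" "n < p\<^sup>2"
  shows "p ^ multiplicity p (Lcm {1..n}) \<le> p"
proof (cases "n = 0")
  case False
  then have "p ^ multiplicity p (Lcm {1..n}) < p ^ 2"
    using prime_power_multiplicity_Lcm_interval_le[OF assms(1), of n] assms(2) by simp
  then have "multiplicity p (Lcm {1..n}) < 2"
    using prime_gt_1_nat[OF assms(1)] by (simp only: power_strict_increasing_iff)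
  then have "p ^ multiplicity p (Lcm {1..n}) \<le> p ^ 1"
    using prime_gt_0_nat[OF assms(1)] by (intro power_increasing) auto
  then show ?thesis by simp
qed (use assms prime_gt_0_nat in \<open>auto simp: Suc_le_eq\<close>)

lemma Lcm_interval_le:
  assumes "n \<ge> 1"
  shows "Lcm {1..n} \<le> n ^ floor_sqrt n * primorial n"
proof -
  define P where "P = {p. prime p \<and> p \<le> n}"
  define small where "small = {p. prime p \<and> p\<^sup>2 \<le> n}"
  have finP: "finite P" unfolding P_def by (rule finite_subset[of _ "{..n}"]) auto
  have sub: "small \<subseteq> P"
    unfolding small_def P_def using power2_nat_le_imp_le by blast
  have "card small \<le> card {1..floor_sqrt n}"
    by (rule card_mono) (auto simp: small_def le_floor_sqrt_iff Suc_le_eq prime_gt_0_nat)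
  then have card_small: "card small \<le> floor_sqrt n" by simp
  have factor_le: "p ^ multiplicity p (Lcm {1..n}) \<le> (if p \<in> small then n else 1) * p" if "p \<in> P" for p
  proof (cases "p \<in> small")
    case True
    have "p ^ multiplicity p (Lcm {1..n}) \<le> n * 1"
      using prime_power_multiplicity_Lcm_interval_le[of p n] assms that by (simp add: P_def)
    also have "\<dots> \<le> n * p"
      using that prime_gt_0_nat[of p] by (intro mult_le_mono2) (auto simp: P_def)
    finally show ?thesis using True by simp
  next
    case False
    then show ?thesis
      using prime_power_multiplicity_Lcm_interval_le_prime[of p n] that by (auto simp: P_def small_def)
  qed
  have "Lcm {1..n} = (\<Prod>p\<in>P. p ^ multiplicity p (Lcm {1..n}))"
    unfolding P_def using assms by (rule Lcm_interval_eq_prod)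
  also have "\<dots> \<le> (\<Prod>p\<in>P. (if p \<in> small then n else 1) * p)"
    using factor_le by (intro prod_mono) auto
  also have "\<dots> = n ^ card small * primorial n"
    using finP sub by (simp add: prod.distrib prod.If_cases primorial_def P_def[symmetric] Int_absorb1)
  also have "\<dots> \<le> n ^ floor_sqrt n * primorial n"
    using card_small assms by (intro mult_le_mono1 power_increasing) auto
  finally show ?thesis .
qed

lemma no_primes_imp_two_power_le:
  assumes "x \<le> n" "1 \<le> n" "\<nexists>p. prime p \<and> x < p \<and> p \<le> n"
  shows "2 ^ (n - 1) \<le> n ^ floor_sqrt n * 4 ^ x"
proof -
  have "prime p \<and> p \<le> n \<longleftrightarrow> prime p \<and> p \<le> x" for p
    using assms(1,3) by (meson le_trans not_le)
  then have "primorial n \<le> 4 ^ x"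
    using primorial_le[of x] by (simp add: primorial_def)
  moreover have "2 ^ (n - 1) \<le> Lcm {1..n}"
    using two_power_le_Lcm_interval[of "n - 1"] assms(2) by simp
  ultimately show ?thesis
    using Lcm_interval_le[OF assms(2)] by (meson mult_le_mono2 order_trans)
qed

lemma eventually_exists_prime_between:
  "eventually (\<lambda>x. \<exists>p. prime p \<and> x < p \<and> p \<le> 4 * x) sequentially"
proof -
  have "ln 4 = 2 * ln (2 :: real)" using ln_realpow[of "2 :: real" 2] by simp
  then have powr_less: "(4 * y) powr sqrt (4 * y) * 4 powr y < 2 powr (4 * y - 1)"
    if "y > 0" "sqrt (4 * y) * ln (4 * y) < (2 * y - 1) * ln 2" for y :: real
    using that by (simp add: powr_def exp_add[symmetric] algebra_simps)
  have "eventually (\<lambda>x. sqrt (4 * real x) * ln (4 * real x) < (2 * real x - 1) * ln 2) sequentially"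
    by real_asymp
  then show ?thesis using eventually_ge_at_top[of 1]
  proof eventually_elim
    case (elim x)
    have "real (floor_sqrt (4 * x)) \<le> sqrt (4 * real x)"
      using of_nat_mono[OF floor_sqrt_power2_le[of "4 * x"], where 'a = real]
      by (intro real_le_rsqrt) simp
    then have "(4 * real x) powr real (floor_sqrt (4 * x)) * 4 powr real x
        \<le> (4 * real x) powr sqrt (4 * real x) * 4 powr real x"
      using elim by (intro mult_right_mono powr_mono) auto
    then have "real ((4 * x) ^ floor_sqrt (4 * x) * 4 ^ x) \<le> (4 * real x) powr sqrt (4 * real x) * 4 powr real x"
      using elim by (simp add: powr_realpow)
    also have "\<dots> < 2 powr (4 * real x - 1)"
      using elim by (intro powr_less) auto
    also have "\<dots> = real (2 ^ (4 * x - 1))"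
      using elim by (simp add: powr_realpow[symmetric])
    finally have "\<not> 2 ^ (4 * x - 1) \<le> (4 * x) ^ floor_sqrt (4 * x) * 4 ^ x"
      by (simp only: of_nat_less_iff not_le)
    then show ?case using no_primes_imp_two_power_le[of x "4 * x"] elim by auto
  qed
qed

lemma exists_prime_linear_gap:
  "\<exists>C\<ge>1. \<forall>x\<ge>1. \<exists>p. prime p \<and> x < p \<and> p \<le> C * (x :: nat)"
proof -
  obtain x0 where x0: "\<And>x. x \<ge> x0 \<Longrightarrow> \<exists>p. prime p \<and> x < p \<and> p \<le> 4 * (x :: nat)"
    using eventually_exists_prime_between by (auto simp: eventually_sequentially)
  obtain P where P: "prime P" "P > x0" using bigger_prime by blast
  have "\<exists>p. prime p \<and> x < p \<and> p \<le> (P + 4) * x" if "x \<ge> 1" for x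
  proof (cases "x \<ge> x0")
    case True
    then obtain p where "prime p" "x < p" "p \<le> 4 * x" using x0 by blast
    then show ?thesis by (auto simp: algebra_simps intro!: exI[of _ p])
  next
    case False
    have "P * 1 \<le> (P + 4) * x" using that by (intro mult_mono) auto
    then show ?thesis using P False by (intro exI[of _ P]) auto
  qed
  then show ?thesis by (intro exI[of _ "P + 4"]) auto
qed

section \<open>Polynomials modulo a prime element\<close>

lemma const_poly_dvd_imp_dvd_poly: "[:c:] dvd h \<Longrightarrow> c dvd poly h (y :: 'a::comm_ring_1)"
  by auto

lemma prime_const_not_dvd_linear_power:
  fixes p :: "'a::idom"
  assumes "prime_elem p"
  shows "\<not> [:p:] dvd [:- y, 1:] ^ k"
proof
  assume "[:p:] dvd [:- y, 1:] ^ k"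
  then have "[:p:] dvd [:- y, 1:]"
    using assms prime_elem_const_poly_iff prime_elem_dvd_power by blast
  then have "p dvd coeff [:- y, 1:] 1" unfolding const_poly_dvd_iff by blast
  then show False using assms by (simp add: prime_elem_def)
qed

lemma root_mod_primeE:
  fixes h :: "'a::idom poly"
  assumes "\<not> [:p:] dvd h" "p dvd poly h y"
  obtains s c where "h = [:- y, 1:] * s + [:p:] * [:c:]" "\<not> [:p:] dvd s" "degree h = Suc (degree s)"
proof -
  define s where "s = synthetic_div h y"
  obtain c where "poly h y = p * c" using assms(2) by blast
  then have "[:poly h y:] = [:p:] * [:c:]" by simp
  then have h: "h = [:- y, 1:] * s + [:p:] * [:c:]"
    unfolding s_def by (metis synthetic_div_correct')
  then have nd: "\<not> [:p:] dvd s"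
    using assms(1) by (metis dvd_add dvd_mult dvd_triv_left)
  then have "degree h \<noteq> 0" unfolding s_def by (metis dvd_0_right synthetic_div_eq_0_iff)
  then have "degree h = Suc (degree s)" unfolding s_def degree_synthetic_div by simp
  then show ?thesis using that h nd by blast
qed

lemma card_roots_mod_prime_le:
  fixes h :: "'a::idom poly"
  assumes "prime_elem p" "\<not> [:p:] dvd h"
    and incong: "\<And>y z. y \<in> S \<Longrightarrow> z \<in> S \<Longrightarrow> p dvd y - z \<Longrightarrow> y = z"
  shows "finite {y \<in> S. p dvd poly h y} \<and> card {y \<in> S. p dvd poly h y} \<le> degree h"
  using assms(2)
proof (induction "degree h" arbitrary: h rule: less_induct)
  case (less h)
  let ?R = "\<lambda>h. {y \<in> S. p dvd poly h y}"
  show ?case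
  proof (cases "?R h = {}")
    case True
    then show ?thesis by (simp only: finite.emptyI card.empty) simp
  next
    case False
    then obtain y where y: "y \<in> S" "p dvd poly h y" by auto
    obtain s c where s: "h = [:- y, 1:] * s + [:p:] * [:c:]" "\<not> [:p:] dvd s" "degree h = Suc (degree s)"
      using less.prems y(2) by (rule root_mod_primeE)
    have sub: "?R h \<subseteq> insert y (?R s)"
    proof
      fix z assume z: "z \<in> ?R h"
      have "poly h z = (z - y) * poly s z + p * c"
        by (subst s(1)) (simp add: algebra_simps)
      then have "p dvd (z - y) * poly s z" using z by (simp add: dvd_add_left_iff)
      then have "p dvd z - y \<or> p dvd poly s z"
        using assms(1) by (simp add: prime_elem_dvd_mult_iff)
      then show "z \<in> insert y (?R s)" using incong[of z y] z y by auto
    qed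
    have IH: "finite (?R s)" "card (?R s) \<le> degree s" using less.hyps[of s] s(2,3) by auto
    have "card (?R h) \<le> card (insert y (?R s))" using sub IH(1) by (intro card_mono) auto
    also have "\<dots> \<le> Suc (card (?R s))" using IH(1) by (simp add: card_insert_if)
    finally show ?thesis
      using IH s(3) finite_subset[OF sub] by simp
  qed
qed

lemma card_nonroots_mod_prime_ge:
  fixes h :: "'a::idom poly"
  assumes "prime_elem p" "\<not> [:p:] dvd h" "finite S"
    and "\<And>y z. y \<in> S \<Longrightarrow> z \<in> S \<Longrightarrow> p dvd y - z \<Longrightarrow> y = z"
  shows "card S - degree h \<le> card {y \<in> S. \<not> p dvd poly h y}"
proof -
  have "card S = card {y \<in> S. p dvd poly h y} + card {y \<in> S. \<not> p dvd poly h y}"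
    using assms(3) by (subst card_Un_disjoint[symmetric]) (auto intro!: arg_cong[where f = card])
  moreover have "card {y \<in> S. p dvd poly h y} \<le> degree h"
    using card_roots_mod_prime_le[OF assms(1,2,4)] by blast
  ultimately show ?thesis by linarith
qed

lemma root_order_mod_primeE:
  fixes h :: "'a::idom poly"
  assumes "\<not> [:p:] dvd h"
  obtains e u w where "h = [:- y, 1:] ^ e * u + [:p:] * w" "\<not> p dvd poly u y" "e \<le> degree h"
  using assms
proof (induction "degree h" arbitrary: h thesis rule: less_induct)
  case (less h)
  show ?case
  proof (cases "p dvd poly h y")
    case False
    show ?thesis by (rule less.prems(1)[of 0 h 0]) (use False in auto)
  next
    case True
    with less.prems(2) obtain s c where
      s: "h = [:- y, 1:] * s + [:p:] * [:c:]" "\<not> [:p:] dvd s" "degree h = Suc (degree s)"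
      by (rule root_mod_primeE)
    then obtain e u w where
      euw: "s = [:- y, 1:] ^ e * u + [:p:] * w" "\<not> p dvd poly u y" "e \<le> degree s"
      using less.hyps[of s] by auto
    show ?thesis
    proof (rule less.prems(1))
      show "h = [:- y, 1:] ^ Suc e * u + [:p:] * ([:- y, 1:] * w + [:c:])"
        by (subst s(1), subst euw(1)) (simp only: power_Suc ring_distribs mult_ac add_ac)
    qed (use euw s in auto)
  qed
qed

definition euler_op :: "'a::idom poly \<Rightarrow> 'a poly" where
  "euler_op p = [:0, 1:] * pderiv p"

lemma coeff_euler_op_pow: "coeff ((euler_op ^^ v) p) j = of_nat j ^ v * coeff p j"
  by (induction v) (auto simp: euler_op_def coeff_pCons coeff_pderiv split: nat.splits)

lemma euler_op_pow_add: "(euler_op ^^ v) (p + p') = (euler_op ^^ v) p + (euler_op ^^ v) p'"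
  by (rule poly_eqI) (simp add: coeff_euler_op_pow ring_distribs)

lemma euler_op_pow_diff: "(euler_op ^^ v) (p - p') = (euler_op ^^ v) p - (euler_op ^^ v) p'"
  by (rule poly_eqI) (simp add: coeff_euler_op_pow ring_distribs)

lemma euler_op_pow_const_mult: "(euler_op ^^ v) ([:c:] * p) = [:c:] * (euler_op ^^ v) p"
  by (rule poly_eqI) (simp add: coeff_euler_op_pow mult_ac)

lemma degree_euler_op_pow_le: "degree ((euler_op ^^ v) p) \<le> degree p"
  by (rule degree_le) (simp add: coeff_euler_op_pow coeff_eq_0)

lemma euler_op_pow_linear_power_mult:
  fixes u :: "'a::idom poly"
  assumes "v \<le> e"
  shows "\<exists>u'. (euler_op ^^ v) ([:- y, 1:] ^ e * u) = [:- y, 1:] ^ (e - v) * u' \<and>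
     poly u' y = (\<Prod>l<v. of_nat (e - l)) * y ^ v * poly u y"
  using assms
proof (induction v)
  case 0
  then show ?case by (intro exI[of _ u]) simp
next
  case (Suc v)
  let ?X = "[:- y, 1:]"
  obtain u' where u': "(euler_op ^^ v) (?X ^ e * u) = ?X ^ (e - v) * u'"
     "poly u' y = (\<Prod>l<v. of_nat (e - l)) * y ^ v * poly u y" using Suc by auto
  obtain k where k: "e - v = Suc k" using Suc.prems by (cases "e - v") auto
  define u'' where "u'' = [:0, 1:] * ([:of_nat (Suc k):] * u' + ?X * pderiv u')"
  have "pderiv (?X ^ Suc k * u') = ?X ^ k * ([:of_nat (Suc k):] * u' + ?X * pderiv u')"
    unfolding pderiv_mult pderiv_power_Suc by (simp add: pderiv_pCons algebra_simps)
  then have "euler_op (?X ^ Suc k * u') = ?X ^ k * u''"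
    unfolding euler_op_def u''_def by (simp only: mult_ac)
  moreover have "e - Suc v = k" using k by simp
  moreover have "poly u'' y = (\<Prod>l<Suc v. of_nat (e - l)) * y ^ Suc v * poly u y"
    unfolding u''_def using u'(2) k by (simp del: of_nat_diff of_nat_Suc add: mult_ac)
  ultimately show ?case using u'(1) k by (intro exI[of _ u'']) simp
qed

section \<open>Taylor expansion modulo an ideal\<close>

definition cong_ideal :: "'a::comm_ring_1 \<Rightarrow> 'a \<Rightarrow> 'a \<Rightarrow> 'a \<Rightarrow> bool" where
  "cong_ideal a b x y \<longleftrightarrow> (\<exists>u w. x - y = a * u + b * w)"

lemma cong_idealI: "x - y = a * u + b * w \<Longrightarrow> cong_ideal a b x y"
  unfolding cong_ideal_def by blast

lemma cong_idealE:
  assumes "cong_ideal a b x y" obtains u w where "x - y = a * u + b * w"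
  using assms unfolding cong_ideal_def by blast

lemma cong_ideal_refl: "cong_ideal a b x x"
  by (rule cong_idealI[of _ _ _ 0 _ 0]) simp

lemma cong_ideal_dvd_diff: "a dvd x - y \<Longrightarrow> cong_ideal a b x y"
  unfolding cong_ideal_def dvd_def by (metis add_0_right mult_zero_right)

lemma cong_ideal_trans:
  assumes "cong_ideal a b x y" "cong_ideal a b y z"
  shows "cong_ideal a b x z"
proof -
  obtain u w u' w' where "x - y = a * u + b * w" "y - z = a * u' + b * w'"
    using assms by (auto elim!: cong_idealE)
  then have "x - z = a * (u + u') + b * (w + w')" by (simp add: algebra_simps)
  then show ?thesis by (rule cong_idealI)
qed

lemma cong_ideal_add:
  assumes "cong_ideal a b x y" "cong_ideal a b x' y'"
  shows "cong_ideal a b (x + x') (y + y')"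
proof -
  obtain u w u' w' where "x - y = a * u + b * w" "x' - y' = a * u' + b * w'"
    using assms by (auto elim!: cong_idealE)
  then have "(x + x') - (y + y') = a * (u + u') + b * (w + w')" by (simp add: algebra_simps)
  then show ?thesis by (rule cong_idealI)
qed

lemma cong_ideal_mult:
  assumes "cong_ideal a b x y" "cong_ideal a b x' y'"
  shows "cong_ideal a b (x * x') (y * y')"
proof -
  obtain u w u' w' where uw: "x - y = a * u + b * w" "x' - y' = a * u' + b * w'"
    using assms by (auto elim!: cong_idealE)
  have "x * x' - y * y' = (x - y) * x' + y * (x' - y')" by (simp add: algebra_simps)
  also have "\<dots> = a * (u * x' + y * u') + b * (w * x' + y * w')" unfolding uw by (simp add: algebra_simps)
  finally show ?thesis by (rule cong_idealI)
qed

lemma cong_ideal_power: "cong_ideal a b x y \<Longrightarrow> cong_ideal a b (x ^ n) (y ^ n)"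
  by (induction n) (auto intro: cong_ideal_refl cong_ideal_mult)

lemma cong_ideal_sum:
  "(\<And>i. i \<in> A \<Longrightarrow> cong_ideal a b (f i) (g i)) \<Longrightarrow> cong_ideal a b (sum f A) (sum g A)"
  by (induction A rule: infinite_finite_induct) (auto intro: cong_ideal_refl cong_ideal_add)

lemma cong_ideal_prod:
  "(\<And>i. i \<in> A \<Longrightarrow> cong_ideal a b (f i) (g i)) \<Longrightarrow> cong_ideal a b (prod f A) (prod g A)"
  by (induction A rule: infinite_finite_induct) (auto intro: cong_ideal_refl cong_ideal_mult)

lemma cong_ideal_taylor_power:
  assumes "cong_ideal a b (\<delta> * \<delta>) 0"
  shows "cong_ideal a b ((w + \<delta>) ^ n) (w ^ n + \<delta> * (of_nat n * w ^ (n - 1)))"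
proof (induction n)
  case 0
  then show ?case by (simp add: cong_ideal_refl)
next
  case (Suc n)
  let ?t = "w ^ Suc n + \<delta> * (of_nat (Suc n) * w ^ (Suc n - 1))" and ?d = "of_nat n * w ^ (n - 1)"
  have "cong_ideal a b ((w + \<delta>) ^ Suc n) ((w + \<delta>) * (w ^ n + \<delta> * ?d))"
    using cong_ideal_mult[OF cong_ideal_refl Suc] by simp
  also have "(w + \<delta>) * (w ^ n + \<delta> * ?d) = ?t + (\<delta> * \<delta>) * ?d"
    by (cases n) (simp_all add: algebra_simps)
  finally have "cong_ideal a b ((w + \<delta>) ^ Suc n) (?t + (\<delta> * \<delta>) * ?d)" .
  moreover have "cong_ideal a b (?t + (\<delta> * \<delta>) * ?d) (?t + 0 * ?d)"
    by (intro cong_ideal_add cong_ideal_mult assms cong_ideal_refl)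
  ultimately show ?case using cong_ideal_trans by fastforce
qed

text \<open>
  A polynomial in the variables \<open>I\<close> with exponent vectors in the finite set \<open>E\<close> is given by its
  coefficient function on \<open>E\<close>.
\<close>

definition mv_monom :: "'v set \<Rightarrow> ('v \<Rightarrow> nat) \<Rightarrow> ('v \<Rightarrow> 'a::comm_ring_1) \<Rightarrow> 'a" where
  "mv_monom I e z = (\<Prod>i\<in>I. z i ^ e i)"

definition mv_monom_deriv :: "'v set \<Rightarrow> 'v \<Rightarrow> ('v \<Rightarrow> nat) \<Rightarrow> ('v \<Rightarrow> 'a::comm_ring_1) \<Rightarrow> 'a" where
  "mv_monom_deriv I v e z = of_nat (e v) * z v ^ (e v - 1) * mv_monom (I - {v}) e z"

definition mv_eval ::
  "('v \<Rightarrow> nat) set \<Rightarrow> 'v set \<Rightarrow> (('v \<Rightarrow> nat) \<Rightarrow> int) \<Rightarrow> ('v \<Rightarrow> 'a::comm_ring_1) \<Rightarrow> 'a" where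
  "mv_eval E I c z = (\<Sum>e\<in>E. of_int (c e) * mv_monom I e z)"

definition mv_deriv ::
  "('v \<Rightarrow> nat) set \<Rightarrow> 'v \<Rightarrow> (('v \<Rightarrow> nat) \<Rightarrow> int) \<Rightarrow> ('v \<Rightarrow> nat) \<Rightarrow> int" where
  "mv_deriv E v c e =
    (if e(v := Suc (e v)) \<in> E then int (Suc (e v)) * c (e(v := Suc (e v))) else 0)"

lemma mv_monom_remove:
  "finite I \<Longrightarrow> v \<in> I \<Longrightarrow> mv_monom I e z = z v ^ e v * mv_monom (I - {v}) e z"
  unfolding mv_monom_def by (rule prod.remove)

lemma poly_mv_eval: "poly (mv_eval E I c z) y = mv_eval E I c (\<lambda>i. poly (z i) y)"
  by (simp add: mv_eval_def mv_monom_def poly_sum poly_prod)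

lemma mv_eval_diff: "mv_eval E I (\<lambda>e. c e - c' e) z = mv_eval E I c z - mv_eval E I c' z"
  by (simp add: mv_eval_def left_diff_distrib sum_subtractf)

lemma mv_eval_dvd_diff:
  assumes "\<And>i. i \<in> I \<Longrightarrow> a dvd z i - w i"
  shows "a dvd mv_eval E I c z - mv_eval E I c w"
proof -
  have "cong_ideal a 0 (mv_eval E I c z) (mv_eval E I c w)"
    unfolding mv_eval_def mv_monom_def using assms
    by (intro cong_ideal_sum cong_ideal_mult cong_ideal_prod cong_ideal_power cong_ideal_refl cong_ideal_dvd_diff)
  then show ?thesis by (auto elim: cong_idealE)
qed

lemma mv_eval_mv_deriv:
  assumes "finite E" "finite I" "v \<in> I"
    and lower: "\<And>e. e \<in> E \<Longrightarrow> e(v := e v - 1) \<in> E"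
  shows "mv_eval E I (mv_deriv E v c) z = (\<Sum>e\<in>E. of_int (c e) * mv_monom_deriv I v e z)"
proof -
  have "(\<Sum>e\<in>E. of_int (c e) * mv_monom_deriv I v e z)
    = (\<Sum>e\<in>{e\<in>E. e v \<noteq> 0}. of_int (c e) * mv_monom_deriv I v e z)"
    by (rule sum.mono_neutral_right) (auto simp: assms(1) mv_monom_deriv_def)
  also have "\<dots> = (\<Sum>e\<in>{e\<in>E. e(v := Suc (e v)) \<in> E}. of_int (mv_deriv E v c e) * mv_monom I e z)"
  proof (rule sum.reindex_bij_witness[of _ "\<lambda>e. e(v := Suc (e v))" "\<lambda>e. e(v := e v - 1)"])
    fix e assume e: "e \<in> {e\<in>E. e v \<noteq> 0}"
    then have "(e(v := e v - 1))(v := Suc ((e(v := e v - 1)) v)) = e" by auto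
    then have "mv_deriv E v c (e(v := e v - 1)) = int (e v) * c e"
      using e unfolding mv_deriv_def by simp
    moreover have "mv_monom I (e(v := e v - 1)) z = z v ^ (e v - 1) * mv_monom (I - {v}) e z"
      using assms(2,3) by (auto simp: mv_monom_remove) (auto simp: mv_monom_def intro!: prod.cong)
    ultimately show "of_int (mv_deriv E v c (e(v := e v - 1))) * mv_monom I (e(v := e v - 1)) z =
      of_int (c e) * mv_monom_deriv I v e z"
      by (simp add: mv_monom_deriv_def mult_ac)
  qed (use lower in auto)
  also have "\<dots> = mv_eval E I (mv_deriv E v c) z"
    unfolding mv_eval_def by (rule sum.mono_neutral_left) (auto simp: assms(1) mv_deriv_def)
  finally show ?thesis ..
qed

lemma mv_monom_taylor:
  assumes "finite I" "v \<in> I" "z v = w v + \<delta>" "cong_ideal a b (\<delta> * \<delta>) 0"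
    and "\<And>i. i \<in> I \<Longrightarrow> i \<noteq> v \<Longrightarrow> e i \<noteq> 0 \<Longrightarrow> cong_ideal a b (z i) (w i)"
  shows "cong_ideal a b (mv_monom I e z) (mv_monom I e w + \<delta> * mv_monom_deriv I v e w)"
proof -
  have "cong_ideal a b (mv_monom (I - {v}) e z) (mv_monom (I - {v}) e w)"
    unfolding mv_monom_def
  proof (rule cong_ideal_prod)
    show "cong_ideal a b (z i ^ e i) (w i ^ e i)" if "i \<in> I - {v}" for i
      using assms(5)[of i] that by (cases "e i = 0") (auto simp: cong_ideal_refl intro: cong_ideal_power)
  qed
  then have "cong_ideal a b (z v ^ e v * mv_monom (I - {v}) e z)
      ((w v ^ e v + \<delta> * (of_nat (e v) * w v ^ (e v - 1))) * mv_monom (I - {v}) e w)"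
    unfolding assms(3) using assms(4) by (intro cong_ideal_mult cong_ideal_taylor_power)
  then show ?thesis
    using assms(1,2) by (simp only: mv_monom_remove mv_monom_deriv_def ring_distribs mult_ac)
qed

lemma mv_eval_taylor:
  assumes "finite E" "finite I" "v \<in> I"
    and lower: "\<And>e. e \<in> E \<Longrightarrow> e(v := e v - 1) \<in> E"
    and \<delta>: "z v = w v + \<delta>" "cong_ideal a b (\<delta> * \<delta>) 0"
    and others: "\<And>e i. e \<in> E \<Longrightarrow> i \<in> I \<Longrightarrow> i \<noteq> v \<Longrightarrow> e i \<noteq> 0 \<Longrightarrow>
      cong_ideal a b (z i) (w i) \<or> a dvd of_int (c e)"
  shows "cong_ideal a b (mv_eval E I c z)
    (mv_eval E I c w + \<delta> * mv_eval E I (mv_deriv E v c) w)"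
proof -
  have "cong_ideal a b (of_int (c e) * mv_monom I e z)
      (of_int (c e) * (mv_monom I e w + \<delta> * mv_monom_deriv I v e w))" if e: "e \<in> E" for e
  proof (cases "a dvd of_int (c e)")
    case True
    then show ?thesis by (intro cong_ideal_dvd_diff) (auto intro: dvd_mult2 simp flip: right_diff_distrib)
  next
    case False
    then show ?thesis
      using others[OF e] by (intro cong_ideal_mult cong_ideal_refl mv_monom_taylor assms(2,3) \<delta>) blast
  qed
  then have "cong_ideal a b (mv_eval E I c z)
      (\<Sum>e\<in>E. of_int (c e) * (mv_monom I e w + \<delta> * mv_monom_deriv I v e w))"
    unfolding mv_eval_def by (rule cong_ideal_sum)
  also have "(\<Sum>e\<in>E. of_int (c e) * (mv_monom I e w + \<delta> * mv_monom_deriv I v e w))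
     = mv_eval E I c w + \<delta> * (\<Sum>e\<in>E. of_int (c e) * mv_monom_deriv I v e w)"
    unfolding mv_eval_def by (simp only: ring_distribs sum.distrib sum_distrib_left mult_ac)
  also have "(\<Sum>e\<in>E. of_int (c e) * mv_monom_deriv I v e w) = mv_eval E I (mv_deriv E v c) w"
    using assms(1-3) lower by (rule mv_eval_mv_deriv[symmetric])
  finally show ?thesis .
qed

section \<open>Expansion of multiplicity codes\<close>

lemma exists_mv_poly_vanishing_mod:
  fixes q :: int and G :: "('v \<Rightarrow> int) set"
  assumes "finite E" "finite G" "card G < card E" "q > 1"
  shows "\<exists>c. (\<exists>e\<in>E. \<not> q dvd c e) \<and> (\<forall>p\<in>G. q dvd mv_eval E I c p)"
proof -
  let ?S = "E \<rightarrow>\<^sub>E {0..<q}" and ?T = "G \<rightarrow>\<^sub>E {0..<q}"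
  define \<Phi> where "\<Phi> c = restrict (\<lambda>p. mv_eval E I c p mod q) G" for c
  have "card ?T < card ?S"
    using assms by (simp add: card_PiE power_strict_increasing)
  moreover have "\<Phi> ` ?S \<subseteq> ?T" using assms(4) by (auto simp: \<Phi>_def)
  moreover have "finite ?T" using assms(2) by (intro finite_PiE) auto
  ultimately have "\<not> inj_on \<Phi> ?S" using card_inj_on_le[of \<Phi> ?S ?T] by linarith
  then obtain c1 c2 where c: "c1 \<in> ?S" "c2 \<in> ?S" "c1 \<noteq> c2" "\<Phi> c1 = \<Phi> c2" by (auto simp: inj_on_def)
  then obtain e where e: "e \<in> E" "c1 e \<noteq> c2 e" by (meson PiE_ext)
  have "\<not> q dvd c1 e - c2 e"
  proof
    assume "q dvd c1 e - c2 e"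
    then have "c1 e mod q = c2 e mod q" by (simp add: mod_eq_dvd_iff)
    then show False using c(1,2) e by (auto simp: PiE_iff)
  qed
  moreover have "q dvd mv_eval E I (\<lambda>e. c1 e - c2 e) p" if "p \<in> G" for p
    using fun_cong[OF c(4), of p] that by (simp add: \<Phi>_def mv_eval_diff mod_eq_dvd_iff)
  ultimately show ?thesis using e(1) by (intro exI[of _ "\<lambda>e. c1 e - c2 e"]) blast
qed

text \<open>
  Variable \<open>0\<close> stands for \<open>X\<close>, variable \<open>v + 1\<close> for the \<open>v\<close>-th Euler derivative of the unknown polynomial.
\<close>

definition exp_box :: "nat \<Rightarrow> nat \<Rightarrow> nat \<Rightarrow> (nat \<Rightarrow> nat) set" where
  "exp_box a d r = (\<Pi>\<^sub>E i\<in>{..r}. {..<if i = 0 then a else d})"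

lemma finite_exp_box: "finite (exp_box a d r)"
  unfolding exp_box_def by (intro finite_PiE) auto

lemma card_exp_box: "card (exp_box a d r) = a * d ^ r"
proof -
  have "card (exp_box a d r) = (\<Prod>i\<le>r. if i = 0 then a else d)"
    unfolding exp_box_def by (subst card_PiE) (auto intro!: prod.cong)
  also have "\<dots> = a * d ^ r" by (subst prod.atMost_shift) simp
  finally show ?thesis .
qed

lemma exp_box_less:
  assumes "e \<in> exp_box a d r"
  shows "e 0 < a" "1 \<le> i \<Longrightarrow> i \<le> r \<Longrightarrow> e i < d"
proof -
  have "e i < (if i = 0 then a else d)" if "i \<le> r" for i
    using assms that by (auto simp: exp_box_def PiE_iff simp del: if_split)
  from this[of 0] this[of i] show "e 0 < a" "1 \<le> i \<Longrightarrow> i \<le> r \<Longrightarrow> e i < d" by auto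
qed

lemma exp_box_lower:
  assumes "e \<in> exp_box a d r" "v \<le> r"
  shows "e(v := e v - 1) \<in> exp_box a d r"
proof -
  have "e(v := e v - 1) \<in> extensional {..r}"
    using assms by (auto simp: exp_box_def PiE_iff extensional_def)
  moreover have "(e(v := e v - 1)) i < (if i = 0 then a else d)" if "i \<le> r" for i
    using exp_box_less(1)[OF assms(1)] exp_box_less(2)[OF assms(1), of i] that
    by (cases "i = 0") (auto simp: less_imp_diff_less)
  ultimately show ?thesis by (simp add: exp_box_def PiE_iff)
qed

definition euler_jet :: "int poly \<Rightarrow> nat \<Rightarrow> int poly" where
  "euler_jet f j = (if j = 0 then [:0, 1:] else (euler_op ^^ (j - 1)) f)"

definition code_point :: "nat \<Rightarrow> nat \<Rightarrow> int poly \<Rightarrow> int \<Rightarrow> nat \<Rightarrow> int" where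
  "code_point q r f y = restrict (\<lambda>j. poly (euler_jet f j) y mod int q) {..r}"

definition code_points :: "nat \<Rightarrow> nat \<Rightarrow> int poly set \<Rightarrow> (nat \<Rightarrow> int) set" where
  "code_points q r F = (\<Union>f\<in>F. code_point q r f ` {1..<int q})"

lemma euler_jet_diff: "1 \<le> j \<Longrightarrow> euler_jet f j - euler_jet g j = (euler_op ^^ (j - 1)) (f - g)"
  by (simp add: euler_jet_def euler_op_pow_diff)

lemma finite_code_points: "finite F \<Longrightarrow> finite (code_points q r F)"
  by (simp add: code_points_def)

lemma code_point_eqD:
  assumes "code_point q r f y = code_point q r g z" "j \<le> r"
  shows "int q dvd poly (euler_jet f j) y - poly (euler_jet g j) z"
  using fun_cong[OF assms(1), of j] assms(2) by (simp add: code_point_def mod_eq_dvd_iff)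

lemma code_point_inj:
  assumes "code_point q r f y = code_point q r g z" "y \<in> {1..<int q}" "z \<in> {1..<int q}"
  shows "y = z"
  using fun_cong[OF assms(1), of 0] assms(2,3) by (simp add: code_point_def euler_jet_def)

lemma dvd_mv_eval_code_point_iff:
  "int q dvd mv_eval E {..r} c (code_point q r f y) \<longleftrightarrow> int q dvd poly (mv_eval E {..r} c (euler_jet f)) y"
proof -
  have "int q dvd mv_eval E {..r} c (\<lambda>j. poly (euler_jet f j) y) - mv_eval E {..r} c (code_point q r f y)"
    by (rule mv_eval_dvd_diff) (simp add: code_point_def dvd_minus_mod)
  then show ?thesis unfolding poly_mv_eval by (meson dvd_diff_right_iff dvd_diff_left_iff)
qed

lemma degree_mv_eval_euler_jet_le:
  assumes "degree f \<le> D"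
  shows "degree (mv_eval (exp_box a d r) {..r} c (euler_jet f)) \<le> (a - 1) + r * ((d - 1) * D)"
  unfolding mv_eval_def
proof (rule degree_sum_le[OF finite_exp_box])
  fix e assume e: "e \<in> exp_box a d r"
  have factor: "degree (euler_jet f i ^ e i) \<le> (if i = 0 then a - 1 else (d - 1) * D)" if "i \<le> r" for i
  proof (cases "i = 0")
    case True
    then show ?thesis
      using exp_box_less(1)[OF e] degree_power_le[of "euler_jet f 0" "e 0"] by (simp add: euler_jet_def)
  next
    case False
    have "degree (euler_jet f i ^ e i) \<le> degree (euler_jet f i) * e i" by (rule degree_power_le)
    also have "\<dots> \<le> D * (d - 1)"
      using False that exp_box_less(2)[OF e, of i] order_trans[OF degree_euler_op_pow_le assms]
      by (intro mult_mono) (auto simp: euler_jet_def)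
    finally show ?thesis using False by (simp add: mult.commute)
  qed
  have "degree (of_int (c e) * mv_monom {..r} e (euler_jet f)) \<le> degree (mv_monom {..r} e (euler_jet f))"
    using degree_smult_le[of "c e"] by (simp add: of_int_poly)
  also have "\<dots> \<le> (\<Sum>i\<le>r. degree (euler_jet f i ^ e i))"
    unfolding mv_monom_def using degree_prod_sum_le[of "{..r}" "\<lambda>i. euler_jet f i ^ e i"] by (simp add: o_def)
  also have "\<dots> \<le> (\<Sum>i\<le>r. if i = 0 then a - 1 else (d - 1) * D)"
    using factor by (intro sum_mono) auto
  also have "\<dots> = (a - 1) + r * ((d - 1) * D)" by (subst sum.atMost_shift) simp
  finally show "degree (of_int (c e) * mv_monom {..r} e (euler_jet f)) \<le> (a - 1) + r * ((d - 1) * D)" .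
qed

lemma euler_op_pow_root_orderE:
  assumes "prime q" "\<not> int q dvd y" "\<not> int q dvd poly u y" "e < q" "j \<le> e"
  obtains u' w' where
    "(euler_op ^^ j) ([:- y, 1:] ^ e * u + [:int q:] * w) = [:- y, 1:] ^ (e - j) * u' + [:int q:] * w'"
    "\<not> int q dvd poly u' y"
proof -
  have q: "prime (int q)" using assms(1) by simp
  obtain u' where u': "(euler_op ^^ j) ([:- y, 1:] ^ e * u) = [:- y, 1:] ^ (e - j) * u'"
    "poly u' y = (\<Prod>l<j. int (e - l)) * y ^ j * poly u y"
    using euler_op_pow_linear_power_mult[OF assms(5)] by blast
  have "\<not> int q dvd (\<Prod>l<j. int (e - l))"
  proof
    assume "int q dvd (\<Prod>l<j. int (e - l))"
    then obtain l where "l < j" "int q dvd int (e - l)"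
      using q by (auto simp: prime_dvd_prod_iff simp del: of_nat_diff)
    then show False using assms(4,5) by (auto dest!: dvd_imp_le simp del: of_nat_diff)
  qed
  then have "\<not> int q dvd poly u' y"
    using q assms(2,3) unfolding u'(2) by (metis prime_dvd_mult_iff prime_dvd_power)
  then show ?thesis
    using u'(1) by (intro that) (simp_all only: euler_op_pow_add euler_op_pow_const_mult)
qed

lemma root_order_ge:
  assumes "prime q" "\<not> int q dvd y" "\<not> int q dvd poly u y" "e < q"
    and "\<And>j. j < v \<Longrightarrow> int q dvd poly ((euler_op ^^ j) ([:- y, 1:] ^ e * u + [:int q:] * w)) y"
  shows "v \<le> e"
proof (rule ccontr)
  assume "\<not> v \<le> e"
  obtain u' w' where
    "(euler_op ^^ e) ([:- y, 1:] ^ e * u + [:int q:] * w) = [:- y, 1:] ^ (e - e) * u' + [:int q:] * w'"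
    "\<not> int q dvd poly u' y"
    using euler_op_pow_root_orderE[OF assms(1-4) order_refl] .
  then show False using assms(5)[of e] \<open>\<not> v \<le> e\<close> by (simp add: dvd_add_left_iff)
qed

lemma cong_ideal_square_zero:
  assumes "t \<ge> 1"
  shows "cong_ideal a (b ^ Suc t) ((b ^ t * u + a * w) * (b ^ t * u + a * w)) 0"
proof -
  obtain k where "t = Suc k" using assms by (cases t) auto
  then have "(b ^ t * u + a * w) * (b ^ t * u + a * w) - 0 =
      a * (w * (b ^ t * u + a * w) + b ^ t * u * w) + b ^ Suc t * (b ^ k * u * u)"
    by (simp add: algebra_simps)
  then show ?thesis by (rule cong_idealI)
qed

lemma cong_ideal_first_order_coeff_dvd:
  fixes p y :: "'a::idom" and A B D :: "'a poly"
  assumes p: "prime_elem p" and u: "\<not> p dvd poly u y"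
    and AB: "[:p:] dvd A" "[:p:] dvd B"
    and cong: "cong_ideal [:p:] ([:- y, 1:] ^ Suc t) A (B + ([:- y, 1:] ^ t * u + [:p:] * w) * D)"
  shows "p dvd poly D y"
proof -
  let ?X = "[:- y, 1:]"
  obtain U W where UW: "A - (B + (?X ^ t * u + [:p:] * w) * D) = [:p:] * U + ?X ^ Suc t * W"
    using cong by (rule cong_idealE)
  obtain A' B' where "A = [:p:] * A'" "B = [:p:] * B'" using AB by (elim dvdE)
  then have "?X ^ t * (u * D + ?X * W) = [:p:] * (A' - B' - U - w * D)"
    using UW by (simp add: algebra_simps del: mult_pCons_left mult_pCons_right)
  then have "[:p:] dvd ?X ^ t * (u * D + ?X * W)" by (metis dvd_triv_left)
  then have "[:p:] dvd u * D + ?X * W"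
    using p prime_elem_const_poly_iff prime_elem_dvd_multD prime_const_not_dvd_linear_power by blast
  then have "p dvd poly (u * D + ?X * W) y" by (rule const_poly_dvd_imp_dvd_poly)
  then show ?thesis using p u by (simp add: prime_elem_dvd_mult_iff)
qed

locale multiplicity_code =
  fixes q r a d D :: nat and P :: "int poly set"
  assumes prime_q: "prime q" and D_less: "D < q" and d_le: "d \<le> q"
    and finite_P: "finite P"
    and degree_le: "f \<in> P \<Longrightarrow> degree f \<le> D"
    and incongruent: "f \<in> P \<Longrightarrow> g \<in> P \<Longrightarrow> [:int q:] dvd f - g \<Longrightarrow> f = g"
begin

abbreviation E :: "(nat \<Rightarrow> nat) set" where
  "E \<equiv> exp_box a d r"

abbreviation subst_jet :: "((nat \<Rightarrow> nat) \<Rightarrow> int) \<Rightarrow> int poly \<Rightarrow> int poly" where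
  "subst_jet c f \<equiv> mv_eval E {..r} c (euler_jet f)"

abbreviation solves :: "int poly \<Rightarrow> ((nat \<Rightarrow> nat) \<Rightarrow> int) \<Rightarrow> bool" where
  "solves f c \<equiv> [:int q:] dvd subst_jet c f"

definition max_degree :: nat where
  "max_degree = (a - 1) + r * ((d - 1) * D)"

definition nonvanishing_points :: "((nat \<Rightarrow> nat) \<Rightarrow> int) \<Rightarrow> int poly \<Rightarrow> int set" where
  "nonvanishing_points c f = {y \<in> {1..<int q}. \<not> int q dvd poly (subst_jet c f) y}"

lemma prime_elem_q: "prime_elem (int q)"
  using prime_q by simp

lemma finite_nonvanishing_points: "finite (nonvanishing_points c f)"
  unfolding nonvanishing_points_def by (rule finite_subset[of _ "{1..<int q}"]) auto

lemma card_nonvanishing_points_ge: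
  assumes "f \<in> P" "\<not> solves f c"
  shows "q - 1 - max_degree \<le> card (nonvanishing_points c f)"
proof -
  have "card {1..<int q} - degree (subst_jet c f) \<le> card (nonvanishing_points c f)"
    unfolding nonvanishing_points_def
  proof (rule card_nonroots_mod_prime_ge[OF prime_elem_q assms(2)])
    show "y = z" if "y \<in> {1..<int q}" "z \<in> {1..<int q}" "int q dvd y - z" for y z
      using that by (simp add: mod_eq_dvd_iff[symmetric])
  qed simp
  moreover have "degree (subst_jet c f) \<le> max_degree"
    unfolding max_degree_def by (rule degree_mv_eval_euler_jet_le[OF degree_le[OF assms(1)]])
  ultimately show ?thesis by (simp add: nat_diff_distrib)
qed

lemma euler_jet_diff_root_order:
  assumes fg: "f \<in> P" "g \<in> P" "f \<noteq> g" and y: "\<not> int q dvd y"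
    and point: "\<And>j. j \<le> v \<Longrightarrow> int q dvd poly (euler_jet f j) y - poly (euler_jet g j) y"
  obtains e where "v \<le> e" "\<And>j. 1 \<le> j \<Longrightarrow> j \<le> v \<Longrightarrow>
    \<exists>u w. euler_jet f j - euler_jet g j = [:- y, 1:] ^ (e - (j - 1)) * u + [:int q:] * w \<and>
      \<not> int q dvd poly u y"
proof -
  have "\<not> [:int q:] dvd f - g" using incongruent fg by blast
  then obtain e u w where h: "f - g = [:- y, 1:] ^ e * u + [:int q:] * w"
    and u: "\<not> int q dvd poly u y" and "e \<le> degree (f - g)" by (rule root_order_mod_primeE)
  moreover have "degree (f - g) \<le> D" using fg degree_le by (intro degree_diff_le)
  ultimately have e: "e < q" using D_less by linarith
  have ve: "v \<le> e"
  proof (rule root_order_ge[OF prime_q y u e])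
    show "int q dvd poly ((euler_op ^^ j) ([:- y, 1:] ^ e * u + [:int q:] * w)) y" if "j < v" for j
      using point[of "Suc j"] euler_jet_diff[of "Suc j" f g] that
      unfolding h[symmetric] by (simp flip: poly_diff)
  qed
  have "\<exists>u w. euler_jet f j - euler_jet g j = [:- y, 1:] ^ (e - (j - 1)) * u + [:int q:] * w \<and>
      \<not> int q dvd poly u y" if "1 \<le> j" "j \<le> v" for j
  proof -
    have "j - 1 \<le> e" using that ve by simp
    from euler_op_pow_root_orderE[OF prime_q y u e this, of w, folded h euler_jet_diff[OF that(1)]]
    show ?thesis by blast
  qed
  then show ?thesis using that[OF ve] by blast
qed

text \<open>
  Let \<open>e\<close> be the order of \<open>f - g\<close> at \<open>y\<close>. The first \<open>v\<close> Euler derivatives of \<open>f - g\<close> vanish at \<open>y\<close> to the exact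
  orders \<open>e, e - 1, \<dots>, e - v + 1\<close>, so modulo \<open>(X - y) ^ (e - v + 2)\<close> the first-order Taylor expansion
  around the point of \<open>g\<close> has only the term of variable \<open>v\<close>, which does not vanish.
\<close>

lemma solution_determined_by_point:
  assumes fg: "f \<in> P" "g \<in> P" and v: "1 \<le> v" "v \<le> r" and y: "\<not> int q dvd y"
    and last: "\<And>e i. e \<in> E \<Longrightarrow> v < i \<Longrightarrow> i \<le> r \<Longrightarrow> e i \<noteq> 0 \<Longrightarrow> int q dvd c e"
    and solves: "solves f c" "solves g c"
    and point: "\<And>j. j \<le> v \<Longrightarrow> int q dvd poly (euler_jet f j) y - poly (euler_jet g j) y"
    and nonzero: "\<not> int q dvd poly (subst_jet (mv_deriv E v c) g) y"
  shows "f = g"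
proof (rule ccontr)
  let ?X = "[:- y, 1:]"
  assume "f \<noteq> g"
  then obtain e where "v \<le> e" and jet_order: "\<And>j. 1 \<le> j \<Longrightarrow> j \<le> v \<Longrightarrow>
      \<exists>u w. euler_jet f j - euler_jet g j = ?X ^ (e - (j - 1)) * u + [:int q:] * w \<and> \<not> int q dvd poly u y"
    using euler_jet_diff_root_order[OF fg _ y point] by blast
  define t where "t = e - (v - 1)"
  have t: "t \<ge> 1" using \<open>v \<le> e\<close> v by (simp add: t_def)
  obtain u w where \<delta>: "euler_jet f v - euler_jet g v = ?X ^ t * u + [:int q:] * w"
    and u: "\<not> int q dvd poly u y" using jet_order[OF v(1)] unfolding t_def by blast
  have "cong_ideal [:int q:] (?X ^ Suc t) (euler_jet f i) (euler_jet g i)" if i: "i < v" for i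
  proof (cases "i = 0")
    case False
    then have "1 \<le> i" "i \<le> v" using i by auto
    then obtain u1 w1 where uw1: "euler_jet f i - euler_jet g i = ?X ^ (e - (i - 1)) * u1 + [:int q:] * w1"
      using jet_order by blast
    have "Suc t \<le> e - (i - 1)" using i \<open>v \<le> e\<close> False unfolding t_def by linarith
    then obtain k where k: "e - (i - 1) = Suc t + k" using le_Suc_ex by blast
    have "euler_jet f i - euler_jet g i = [:int q:] * w1 + ?X ^ Suc t * (?X ^ k * u1)"
      unfolding uw1 k by (simp only: power_add mult_ac add_ac)
    then show ?thesis by (rule cong_idealI)
  qed (simp add: euler_jet_def cong_ideal_refl)
  then have others: "cong_ideal [:int q:] (?X ^ Suc t) (euler_jet f i) (euler_jet g i) \<or> [:int q:] dvd of_int (c e')"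
    if "e' \<in> E" "i \<in> {..r}" "i \<noteq> v" "e' i \<noteq> 0" for e' i
    using last[of e' i] that by (cases "i < v") (auto simp: of_int_poly)
  have "cong_ideal [:int q:] (?X ^ Suc t) (subst_jet c f)
      (subst_jet c g + (?X ^ t * u + [:int q:] * w) * subst_jet (mv_deriv E v c) g)"
  proof (rule mv_eval_taylor[OF finite_exp_box finite_atMost])
    show "euler_jet f v = euler_jet g v + (?X ^ t * u + [:int q:] * w)"
      using \<delta> by (metis add.commute diff_add_cancel)
  qed (use v others exp_box_lower cong_ideal_square_zero[OF t] in blast)+
  then have "int q dvd poly (subst_jet (mv_deriv E v c) g) y"
    by (rule cong_ideal_first_order_coeff_dvd[OF prime_elem_q u solves])
  then show False using nonzero by blast
qed

definition occurring_vars :: "((nat \<Rightarrow> nat) \<Rightarrow> int) \<Rightarrow> nat set" where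
  "occurring_vars c = {i \<in> {1..r}. \<exists>e\<in>E. \<not> int q dvd c e \<and> e i \<noteq> 0}"

lemma solves_without_vars_imp_dvd:
  assumes "occurring_vars c = {}" "solves f c" "e0 \<in> E"
  shows "int q dvd c e0"
proof (rule ccontr)
  assume nd: "\<not> int q dvd c e0"
  have zero: "e j = 0" if "e \<in> E" "\<not> int q dvd c e" "1 \<le> j" "j \<le> r" for e j
    using assms(1) that unfolding occurring_vars_def by auto
  have monom: "mv_monom {..r} e (euler_jet f) = monom 1 (e 0)" if "e \<in> E" "\<not> int q dvd c e" for e
  proof -
    have "mv_monom ({..r} - {0}) e (euler_jet f) = 1"
      unfolding mv_monom_def by (rule prod.neutral) (use zero[OF that] in auto)
    then show ?thesis by (simp add: mv_monom_remove[of _ 0] euler_jet_def monom_altdef)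
  qed
  have "int q dvd c e * coeff (mv_monom {..r} e (euler_jet f)) (e0 0)" if e: "e \<in> E - {e0}" for e
  proof (cases "int q dvd c e")
    case False
    have "e 0 \<noteq> e0 0"
    proof
      assume "e 0 = e0 0"
      then have "e j = e0 j" if "j \<in> {..r}" for j
        using zero[of e j] zero[of e0 j] False e assms(3) nd that by (cases "j = 0") auto
      then have "e = e0" using e assms(3) unfolding exp_box_def by (intro PiE_ext) auto
      then show False using e by simp
    qed
    then show ?thesis using monom[of e] False e by simp
  qed simp
  then have "int q dvd (\<Sum>e\<in>E - {e0}. c e * coeff (mv_monom {..r} e (euler_jet f)) (e0 0))"
    by (rule dvd_sum)
  moreover have "int q dvd coeff (subst_jet c f) (e0 0)"
    using assms(2) by (simp add: const_poly_dvd_iff)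
  moreover have "coeff (subst_jet c f) (e0 0) =
      c e0 + (\<Sum>e\<in>E - {e0}. c e * coeff (mv_monom {..r} e (euler_jet f)) (e0 0))"
    using assms(3) monom[OF assms(3) nd]
    by (simp add: mv_eval_def coeff_sum of_int_poly sum.remove[OF finite_exp_box assms(3)])
  ultimately show False using nd by (simp add: dvd_add_left_iff)
qed

lemma mv_deriv_nonzero:
  assumes "v \<in> occurring_vars c"
  shows "\<exists>e\<in>E. \<not> int q dvd mv_deriv E v c e"
proof -
  obtain e where e: "e \<in> E" "\<not> int q dvd c e" "e v \<noteq> 0" and v: "1 \<le> v" "v \<le> r"
    using assms by (auto simp: occurring_vars_def)
  have "e v < q" using exp_box_less(2)[OF e(1) v] d_le by simp
  then have "\<not> int q dvd int (e v)" using e(3) by (auto dest: dvd_imp_le)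
  have "(e(v := e v - 1))(v := Suc ((e(v := e v - 1)) v)) = e" using e(3) by auto
  then have "mv_deriv E v c (e(v := e v - 1)) = int (e v) * c e"
    using e by (simp add: mv_deriv_def)
  then have "\<not> int q dvd mv_deriv E v c (e(v := e v - 1))"
    using prime_q e(2) \<open>\<not> int q dvd int (e v)\<close> by (simp add: prime_dvd_mult_iff)
  moreover have "e(v := e v - 1) \<in> E" using e(1) v(2) by (rule exp_box_lower)
  ultimately show ?thesis by blast
qed

lemma total_degree_mv_deriv_less:
  assumes "\<And>e. e \<in> E \<Longrightarrow> \<not> int q dvd c e \<Longrightarrow> (\<Sum>i=1..r. e i) \<le> N"
    and "1 \<le> v" "v \<le> r" "\<not> int q dvd mv_deriv E v c e"
  shows "(\<Sum>i=1..r. e i) < N"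
proof -
  have "e(v := Suc (e v)) \<in> E" "\<not> int q dvd c (e(v := Suc (e v)))"
    using assms(4) by (auto simp: mv_deriv_def split: if_splits)
  then have "(\<Sum>i=1..r. (e(v := Suc (e v))) i) \<le> N" by (rule assms(1))
  moreover have "(\<Sum>i=1..r. (e(v := Suc (e v))) i) = Suc (\<Sum>i=1..r. e i)"
    using assms(2,3) by (simp add: sum.remove[of _ v])
  ultimately show ?thesis by simp
qed

lemma card_private_points_ge:
  assumes F: "F \<subseteq> P" "\<And>f. f \<in> F \<Longrightarrow> solves f c \<and> \<not> solves f (mv_deriv E v c)"
    and v: "v \<in> occurring_vars c" "\<And>i. i \<in> occurring_vars c \<Longrightarrow> i \<le> v"
  shows "card F * (q - 1 - max_degree)
    \<le> card (\<Union>f\<in>F. code_point q r f ` nonvanishing_points (mv_deriv E v c) f)"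
proof -
  let ?Y = "nonvanishing_points (mv_deriv E v c)" and ?pt = "\<lambda>(f, y). code_point q r f y"
  have v1: "1 \<le> v" "v \<le> r" using v(1) by (auto simp: occurring_vars_def)
  have last: "int q dvd c e" if "e \<in> E" "v < i" "i \<le> r" "e i \<noteq> 0" for e i
    using v(2)[of i] that v1 by (force simp: occurring_vars_def)
  have finF: "finite F" using F(1) finite_P by (rule finite_subset)
  have "inj_on ?pt (Sigma F ?Y)"
  proof (rule inj_onI, clarify)
    fix f y g z assume fg: "f \<in> F" "y \<in> ?Y f" "g \<in> F" "z \<in> ?Y g"
      and eq: "code_point q r f y = code_point q r g z"
    have yz: "y = z" using code_point_inj[OF eq] fg by (auto simp: nonvanishing_points_def)
    have "f = g"
    proof (rule solution_determined_by_point[where c = c, OF _ _ v1 _ last])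
      show "int q dvd poly (euler_jet f j) z - poly (euler_jet g j) z" if "j \<le> v" for j
        using code_point_eqD[OF eq, of j] that v1 yz by simp
      show "\<not> int q dvd z" using fg(4) by (auto simp: nonvanishing_points_def dest!: zdvd_imp_le)
    qed (use fg F in \<open>auto simp: nonvanishing_points_def\<close>)
    then show "f = g \<and> y = z" using yz by simp
  qed
  then have "card (?pt ` Sigma F ?Y) = (\<Sum>f\<in>F. card (?Y f))"
    using finF by (simp add: card_image finite_nonvanishing_points)
  moreover have "?pt ` Sigma F ?Y = (\<Union>f\<in>F. code_point q r f ` ?Y f)" by force
  moreover have "(\<Sum>f\<in>F. q - 1 - max_degree) \<le> (\<Sum>f\<in>F. card (?Y f))"
    using F by (intro sum_mono card_nonvanishing_points_ge) auto
  ultimately show ?thesis by simp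
qed

lemma card_code_points_split:
  assumes "finite F"
  shows "card (\<Union>f\<in>{f \<in> F. \<not> solves f c}. code_point q r f ` nonvanishing_points c f)
    + card (code_points q r {f \<in> F. solves f c}) \<le> card (code_points q r F)"
    (is "card ?own + card ?rest \<le> _")
proof -
  have "?own \<inter> ?rest = {}"
  proof (rule ccontr)
    assume "?own \<inter> ?rest \<noteq> {}"
    then obtain f y g z where fg: "y \<in> nonvanishing_points c f" "solves g c"
      "code_point q r f y = code_point q r g z"
      unfolding code_points_def by fastforce
    then have "int q dvd poly (subst_jet c g) z" using const_poly_dvd_imp_dvd_poly by blast
    then have "int q dvd poly (subst_jet c f) y" by (metis dvd_mv_eval_code_point_iff fg(3))
    then show False using fg(1) by (simp add: nonvanishing_points_def)
  qed
  then have "card ?own + card ?rest = card (?own \<union> ?rest)"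
    using assms by (intro card_Un_disjoint[symmetric])
      (auto simp: finite_nonvanishing_points finite_code_points)
  also have "\<dots> \<le> card (code_points q r F)"
    using assms by (intro card_mono finite_code_points)
      (auto simp: code_points_def nonvanishing_points_def)
  finally show ?thesis .
qed

lemma card_code_points_ge:
  assumes "F \<subseteq> P" "\<And>f. f \<in> F \<Longrightarrow> solves f c" "\<exists>e\<in>E. \<not> int q dvd c e"
    and "\<And>e. e \<in> E \<Longrightarrow> \<not> int q dvd c e \<Longrightarrow> (\<Sum>i=1..r. e i) \<le> N"
  shows "card F * (q - 1 - max_degree) \<le> card (code_points q r F)"
  using assms
proof (induction N arbitrary: c F rule: less_induct)
  case (less N c F)
  have finF: "finite F" using less.prems(1) finite_P by (rule finite_subset)
  show ?case
  proof (cases "occurring_vars c = {}")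
    case True
    then have "F = {}" using solves_without_vars_imp_dvd less.prems(2,3) by blast
    then show ?thesis by simp
  next
    case False
    define v where "v = Max (occurring_vars c)"
    have "finite (occurring_vars c)" by (simp add: occurring_vars_def)
    then have v: "v \<in> occurring_vars c" "\<And>i. i \<in> occurring_vars c \<Longrightarrow> i \<le> v"
      unfolding v_def using False by auto
    then have v1: "1 \<le> v" "v \<le> r" by (auto simp: occurring_vars_def)
    let ?c' = "mv_deriv E v c"
    let ?F1 = "{f \<in> F. \<not> solves f ?c'}" and ?F2 = "{f \<in> F. solves f ?c'}"
    have nonzero: "\<exists>e\<in>E. \<not> int q dvd ?c' e" using v(1) by (rule mv_deriv_nonzero)
    have degree_less: "(\<Sum>i=1..r. e i) < N" if "\<not> int q dvd ?c' e" for e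
      using less.prems(4) v1 that by (rule total_degree_mv_deriv_less)
    have "card ?F2 * (q - 1 - max_degree) \<le> card (code_points q r ?F2)"
      using less.prems(1) nonzero degree_less by (intro less.IH[of "N - 1" ?F2 ?c']) force+
    moreover have "card ?F1 * (q - 1 - max_degree)
        \<le> card (\<Union>f\<in>?F1. code_point q r f ` nonvanishing_points ?c' f)"
      using less.prems(1,2) v by (intro card_private_points_ge) auto
    moreover have "card F = card ?F1 + card ?F2"
      using finF by (subst card_Un_disjoint[symmetric]) (auto intro!: arg_cong[where f = card])
    ultimately show ?thesis
      using card_code_points_split[OF finF, of ?c'] by (simp add: add_mult_distrib)
  qed
qed

theorem multiplicity_code_expansion:
  assumes "max_degree < q - 1" "card (code_points q r P) < a * d ^ r"
  shows "card P * (q - 1 - max_degree) \<le> card (code_points q r P)"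
proof -
  have "card (code_points q r P) < card E" using assms(2) by (simp add: card_exp_box)
  then obtain c where c: "\<exists>e\<in>E. \<not> int q dvd c e"
    and vanishes: "\<And>p. p \<in> code_points q r P \<Longrightarrow> int q dvd mv_eval E {..r} c p"
    using exists_mv_poly_vanishing_mod[of E "code_points q r P" "int q" "{..r}"]
      finite_exp_box finite_code_points[OF finite_P] prime_gt_1_nat[OF prime_q] by force
  have "solves f c" if "f \<in> P" for f
  proof (rule ccontr)
    assume "\<not> solves f c"
    then have "q - 1 - max_degree \<le> card (nonvanishing_points c f)"
      using that by (intro card_nonvanishing_points_ge)
    moreover have "int q dvd poly (subst_jet c f) y" if "y \<in> {1..<int q}" for y
      using vanishes[of "code_point q r f y"] that \<open>f \<in> P\<close>
      unfolding code_points_def dvd_mv_eval_code_point_iff by blast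
    then have "nonvanishing_points c f = {}" unfolding nonvanishing_points_def by blast
    ultimately show False using assms(1) by simp
  qed
  moreover have "(\<Sum>i=1..r. e i) \<le> (\<Sum>e\<in>E. \<Sum>i=1..r. e i)" if "e \<in> E" for e
    by (rule member_le_sum[OF that]) (auto simp: finite_exp_box)
  ultimately show ?thesis using c by (intro card_code_points_ge) auto
qed

end

section \<open>Total correctness with running times\<close>

definition runs :: "nat \<Rightarrow> nat \<Rightarrow> com \<Rightarrow> state \<Rightarrow> nat \<Rightarrow> (state \<Rightarrow> bool) \<Rightarrow> bool" where
  "runs m B p s T Q \<longleftrightarrow> (\<exists>t s'. exec m B p s t s' \<and> t \<le> T \<and> Q s')"

lemma runsI: "exec m B p s t s' \<Longrightarrow> t \<le> T \<Longrightarrow> Q s' \<Longrightarrow> runs m B p s T Q"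
  unfolding runs_def by blast

lemma runsE:
  assumes "runs m B p s T Q" obtains t s' where "exec m B p s t s'" "t \<le> T" "Q s'"
  using assms unfolding runs_def by blast

lemma runs_weaken: "runs m B p s T Q \<Longrightarrow> T \<le> T' \<Longrightarrow> (\<And>s'. Q s' \<Longrightarrow> Q' s') \<Longrightarrow> runs m B p s T' Q'"
  unfolding runs_def using order_trans by blast

lemma runs_Skip: "Q s \<Longrightarrow> 1 \<le> T \<Longrightarrow> runs m B Skip s T Q"
  by (rule runsI[OF exec_Skip])

lemma runs_IAssign:
  assumes "iok m B s x" "ival s x < m" "iok m B s e"
    "Q (s\<lparr>imem := (imem s)(ival s x := ival s e)\<rparr>)" "1 \<le> T"
  shows "runs m B (IAssign x e) s T Q"
  using exec_IAssign[OF assms(1-3)] assms(5,4) by (rule runsI)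

lemma runs_RAssign:
  assumes "iok m B s x" "ival s x < m" "rok m B s e"
    "Q (s\<lparr>rmem := (rmem s)(ival s x := rval s e)\<rparr>)" "1 \<le> T"
  shows "runs m B (RAssign x e) s T Q"
  using exec_RAssign[OF assms(1-3)] assms(5,4) by (rule runsI)

lemma runs_Emit:
  assumes "iok m B s e" "Q (s\<lparr>out := out s @ [ival s e]\<rparr>)" "1 \<le> T"
  shows "runs m B (Emit e) s T Q"
  using exec_Emit[OF assms(1)] assms(3,2) by (rule runsI)

lemma runs_Seq:
  assumes "runs m B c1 s T1 R" "\<And>s'. R s' \<Longrightarrow> runs m B c2 s' T2 Q" "T1 + T2 \<le> T"
  shows "runs m B (Seq c1 c2) s T Q"
proof -
  obtain t1 s1 where s1: "exec m B c1 s t1 s1" "t1 \<le> T1" "R s1" using assms(1) by (rule runsE)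
  obtain t2 s2 where s2: "exec m B c2 s1 t2 s2" "t2 \<le> T2" "Q s2" using assms(2)[OF s1(3)] by (rule runsE)
  show ?thesis by (rule runsI[OF exec_Seq[OF s1(1) s2(1)]]) (use s1 s2 assms(3) in auto)
qed

lemma runs_Cond:
  assumes "bok m B s e" "bval s e \<Longrightarrow> runs m B c1 s (T - 1) Q" "\<not> bval s e \<Longrightarrow> runs m B c2 s (T - 1) Q"
    "1 \<le> T"
  shows "runs m B (Cond e c1 c2) s T Q"
proof (cases "bval s e")
  case True
  then obtain t s' where "exec m B c1 s t s'" "t \<le> T - 1" "Q s'" using assms(2) by (auto elim: runsE)
  then show ?thesis using exec_CondTrue[OF assms(1) True] assms(4) by (intro runsI[of _ _ _ _ "t + 1"]) auto
next
  case False
  then obtain t s' where "exec m B c2 s t s'" "t \<le> T - 1" "Q s'" using assms(3) by (auto elim: runsE)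
  then show ?thesis using exec_CondFalse[OF assms(1) False] assms(4) by (intro runsI[of _ _ _ _ "t + 1"]) auto
qed

lemma runs_IAssign_Seq:
  assumes "iok m B s x" "ival s x < m" "iok m B s e"
    "runs m B p (s\<lparr>imem := (imem s)(ival s x := ival s e)\<rparr>) (T - 1) Q" "1 \<le> T"
  shows "runs m B (Seq (IAssign x e) p) s T Q"
proof (rule runs_Seq[where ?T2.0 = "T - 1"])
  show "runs m B (IAssign x e) s 1 (\<lambda>s'. s' = s\<lparr>imem := (imem s)(ival s x := ival s e)\<rparr>)"
    using assms(1-3) by (intro runs_IAssign) auto
qed (use assms(4,5) in auto)

lemma runs_RAssign_Seq:
  assumes "iok m B s x" "ival s x < m" "rok m B s e"
    "runs m B p (s\<lparr>rmem := (rmem s)(ival s x := rval s e)\<rparr>) (T - 1) Q" "1 \<le> T"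
  shows "runs m B (Seq (RAssign x e) p) s T Q"
proof (rule runs_Seq[where ?T2.0 = "T - 1"])
  show "runs m B (RAssign x e) s 1 (\<lambda>s'. s' = s\<lparr>rmem := (rmem s)(ival s x := rval s e)\<rparr>)"
    using assms(1-3) by (intro runs_RAssign) auto
qed (use assms(4,5) in auto)

text \<open>The index of the invariant bounds the number of remaining iterations.\<close>

lemma runs_While:
  assumes "I x s"
    and bok: "\<And>x s. I x s \<Longrightarrow> bok m B s e"
    and body: "\<And>x s. I x s \<Longrightarrow> bval s e \<Longrightarrow> runs m B p s Tb (\<lambda>s'. \<exists>y<x. I y s')"
    and exit: "\<And>x s. I x s \<Longrightarrow> \<not> bval s e \<Longrightarrow> Q s"
    and "x * (Tb + 1) + 1 \<le> T"
  shows "runs m B (While e p) s T Q"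
proof -
  have "runs m B (While e p) s (x * (Tb + 1) + 1) Q" using assms(1)
  proof (induction x arbitrary: s rule: less_induct)
    case (less x)
    show ?case
    proof (cases "bval s e")
      case False
      then show ?thesis
        using exec_WhileFalse[OF bok[OF less.prems]] exit[OF less.prems] by (intro runsI[of _ _ _ _ 1]) auto
    next
      case True
      obtain t1 s1 y where s1: "exec m B p s t1 s1" "t1 \<le> Tb" "y < x" "I y s1"
        using body[OF less.prems True] by (auto elim: runsE)
      obtain t2 s2 where s2: "exec m B (While e p) s1 t2 s2" "t2 \<le> y * (Tb + 1) + 1" "Q s2"
        using less.IH[OF s1(3,4)] by (rule runsE)
      have "Suc y * (Tb + 1) \<le> x * (Tb + 1)" using s1(3) by (intro mult_le_mono1) simp
      then have "t1 + t2 + 1 \<le> x * (Tb + 1) + 1" using s1(2) s2(2) by simp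
      then show ?thesis using exec_WhileTrue[OF bok[OF less.prems] True s1(1) s2(1)] s2(3) by (intro runsI)
    qed
  qed
  then show ?thesis using assms(5) by (rule runs_weaken)
qed

definition same_except :: "nat set \<Rightarrow> state \<Rightarrow> state \<Rightarrow> bool" where
  "same_except A s s' \<longleftrightarrow> (\<forall>x. x \<notin> A \<longrightarrow> imem s' x = imem s x) \<and> rmem s' = rmem s \<and> out s' = out s"

lemma same_except_imem: "same_except A s s' \<Longrightarrow> x \<notin> A \<Longrightarrow> imem s' x = imem s x"
  by (auto simp: same_except_def)

lemma same_except_refl: "same_except A s s"
  by (simp add: same_except_def)

lemma same_except_upd:
  "x \<in> A \<Longrightarrow> same_except A s (s'\<lparr>imem := f\<rparr>) \<Longrightarrow> same_except A s (s'\<lparr>imem := f(x := v)\<rparr>)"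
  by (auto simp: same_except_def)

lemma same_except_imem_id: "same_except A s s' \<Longrightarrow> same_except A s (s'\<lparr>imem := imem s'\<rparr>)"
  by (auto simp: same_except_def)

lemmas same_except_intros = same_except_upd same_except_imem_id same_except_refl

lemma same_except_trans:
  "same_except A s s' \<Longrightarrow> same_except A' s' s'' \<Longrightarrow> A \<subseteq> C \<Longrightarrow> A' \<subseteq> C \<Longrightarrow> same_except C s s''"
  unfolding same_except_def by (metis subsetD)

notation Seq (infixr ";;" 60)
notation IAdd (infixl "\<oplus>" 65)
notation IMul (infixl "\<otimes>" 70)

abbreviation reg :: "nat \<Rightarrow> iexp" where
  "reg x \<equiv> ICell (INum x)"

abbreviation assign :: "nat \<Rightarrow> iexp \<Rightarrow> com" (infix "::=" 61) where
  "x ::= e \<equiv> IAssign (INum x) e"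

definition for_loop :: "nat \<Rightarrow> nat \<Rightarrow> nat \<Rightarrow> com \<Rightarrow> com" where
  "for_loop x k y p = x ::= INum k ;; While (ILess (reg x) (reg y)) (p ;; x ::= reg x \<oplus> INum 1)"

lemma runs_for_loop:
  assumes bounds: "x < m" "y < m" "x < B" "y < B" "N < B" "k \<le> N"
    and init: "I k (s\<lparr>imem := (imem s)(x := k)\<rparr>)"
    and cells: "\<And>j s'. I j s' \<Longrightarrow> imem s' x = j \<and> imem s' y = N"
    and body: "\<And>j s'. k \<le> j \<Longrightarrow> j < N \<Longrightarrow> I j s' \<Longrightarrow> runs m B p s' Tb
      (\<lambda>s''. imem s'' x = j \<and> I (Suc j) (s''\<lparr>imem := (imem s'')(x := Suc j)\<rparr>))"
    and exit: "\<And>s'. I N s' \<Longrightarrow> Q s'"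
    and time: "(N - k) * (Tb + 2) + 2 \<le> T"
  shows "runs m B (for_loop x k y p) s T Q"
proof -
  let ?e = "ILess (reg x) (reg y)" and ?p = "p ;; x ::= reg x \<oplus> INum 1"
  define J where "J z s' \<longleftrightarrow> z \<le> N - k \<and> I (N - z) s'" for z s'
  have loop: "runs m B (While ?e ?p) s' ((N - k) * (Tb + 2) + 1) Q" if "J (N - k) s'" for s'
  proof (rule runs_While[where I = J and Tb = "Tb + 1", OF that])
    fix z s' assume J: "J z s'"
    then have s': "imem s' x = N - z" "imem s' y = N" using cells by (auto simp: J_def)
    then show "bok m B s' ?e" using bounds by auto
    show "Q s'" if "\<not> bval s' ?e"
    proof -
      have "z = 0" using that s' J by (auto simp: J_def)
      then show ?thesis using J exit by (simp add: J_def)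
    qed
    show "runs m B ?p s' (Tb + 1) (\<lambda>s''. \<exists>y<z. J y s'')" if "bval s' ?e"
    proof (rule runs_Seq)
      have z: "z > 0" "Suc (N - z) = N - (z - 1)" using that s' J bounds by (auto simp: J_def)
      show "runs m B p s' Tb
        (\<lambda>s''. imem s'' x = N - z \<and> I (Suc (N - z)) (s''\<lparr>imem := (imem s'')(x := Suc (N - z))\<rparr>))"
        using J that s' by (intro body) (auto simp: J_def)
      fix s'' assume s'': "imem s'' x = N - z \<and> I (Suc (N - z)) (s''\<lparr>imem := (imem s'')(x := Suc (N - z))\<rparr>)"
      show "runs m B (x ::= reg x \<oplus> INum 1) s'' 1 (\<lambda>s''. \<exists>y<z. J y s'')"
        using s'' bounds z J by (intro runs_IAssign) (auto simp: J_def intro!: exI[of _ "z - 1"])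
    qed simp
  qed simp
  show ?thesis unfolding for_loop_def
    using bounds init time by (intro runs_IAssign_Seq runs_weaken[OF loop]) (auto simp: J_def)
qed

definition doubling_loop :: "nat \<Rightarrow> nat \<Rightarrow> iexp \<Rightarrow> bexp \<Rightarrow> com" where
  "doubling_loop x y step e = x ::= INum 1 ;; y ::= INum 0 ;;
     While e (x ::= INum 2 \<otimes> reg x ;; y ::= reg y \<oplus> step)"

lemma runs_doubling_loop:
  assumes bounds: "x \<noteq> y" "x < m" "y < m" "x < B" "y < B" "2 < B" "2 ^ N < B" "N * k < B"
    and e: "\<And>l s'. l \<le> N \<Longrightarrow> same_except {x, y} s s' \<Longrightarrow> imem s' x = 2 ^ l \<Longrightarrow> imem s' y = l * k \<Longrightarrow>
      bok m B s' e \<and> (bval s' e \<longleftrightarrow> l < N)"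
    and step: "\<And>s'. imem s' x < B \<Longrightarrow> imem s' y < B \<Longrightarrow> same_except {x, y} s s' \<Longrightarrow>
      iok m B s' step \<and> ival s' step = k"
  shows "runs m B (doubling_loop x y step e) s (3 * N + 3)
    (\<lambda>s'. same_except {x, y} s s' \<and> imem s' x = 2 ^ N \<and> imem s' y = N * k)"
proof -
  let ?p = "x ::= INum 2 \<otimes> reg x ;; y ::= reg y \<oplus> step"
  let ?Q = "\<lambda>s'. same_except {x, y} s s' \<and> imem s' x = 2 ^ N \<and> imem s' y = N * k"
  define I where "I z s' \<longleftrightarrow> z \<le> N \<and> same_except {x, y} s s' \<and>
    imem s' x = 2 ^ (N - z) \<and> imem s' y = (N - z) * k" for z s'
  have small: "2 ^ l < B" "l * k < B" if "l \<le> N" for l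
    using that bounds power_increasing[of l N "2::nat"] mult_le_mono1[of l N k] by linarith+
  have loop: "runs m B (While e ?p) s' (3 * N + 1) ?Q" if "I N s'" for s'
  proof (rule runs_While[where I = I and Tb = 2, OF that])
    fix z s' assume I: "I z s'"
    then show "bok m B s' e" using e[of "N - z" s'] by (simp add: I_def)
    show "?Q s'" if "\<not> bval s' e" using that I e[of "N - z" s'] by (auto simp: I_def)
    show "runs m B ?p s' 2 (\<lambda>s''. \<exists>y<z. I y s'')" if "bval s' e"
    proof -
      have z: "z > 0" "N - (z - 1) = Suc (N - z)" "z - 1 \<le> N"
        using that I e[of "N - z" s'] by (auto simp: I_def)
      then have "Suc (N - z) \<le> N" by simp
      from small[OF this] have less: "2 * 2 ^ (N - z) < B" "(N - z) * k + k < B" by simp_all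
      let ?s = "s'\<lparr>imem := (imem s')(x := 2 * 2 ^ (N - z))\<rparr>"
      have "iok m B ?s step \<and> ival ?s step = k"
        using I less bounds(1) by (intro step) (auto simp: I_def intro!: same_except_intros)
      then show ?thesis
        using I bounds less small[of "N - z"] z
        by (intro runs_IAssign_Seq runs_IAssign)
          (auto simp: I_def add.commute intro!: exI[of _ "z - 1"] same_except_intros)
    qed
  qed simp
  show ?thesis unfolding doubling_loop_def
    using bounds by (intro runs_IAssign_Seq runs_weaken[OF loop]) (auto simp: I_def intro!: same_except_intros)
qed

definition next_prime :: "nat \<Rightarrow> nat" where
  "next_prime N = (LEAST p. N \<le> p \<and> prime p)"

lemma prime_next_prime: "prime (next_prime N)"
  and next_prime_ge: "N \<le> next_prime N"
proof -
  obtain p where "prime p" "p > N" using bigger_prime by blast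
  then have "N \<le> p \<and> prime p" by simp
  from LeastI[of "\<lambda>p. N \<le> p \<and> prime p", OF this]
  show "prime (next_prime N)" "N \<le> next_prime N" unfolding next_prime_def by auto
qed

lemma next_prime_le: "prime p \<Longrightarrow> N \<le> p \<Longrightarrow> next_prime N \<le> p"
  unfolding next_prime_def by (rule Least_le) simp

definition prime_search_body :: "nat \<Rightarrow> nat \<Rightarrow> com" where
  "prime_search_body x t = Cond (ILess (IMod (reg x) (reg t)) (INum 1))
     (x ::= reg x \<oplus> INum 1 ;; t ::= INum 2)
     (t ::= reg t \<oplus> INum 1)"

definition prime_search :: "nat \<Rightarrow> nat \<Rightarrow> com" where
  "prime_search x t = t ::= INum 2 ;; While (ILess (reg t) (reg x)) (prime_search_body x t)"

definition prime_search_rank :: "nat \<Rightarrow> nat \<Rightarrow> nat \<Rightarrow> nat" where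
  "prime_search_rank q u v = (q - u) * (q + 1) + (q - v)"

definition prime_search_inv :: "nat \<Rightarrow> nat \<Rightarrow> nat \<Rightarrow> state \<Rightarrow> nat \<Rightarrow> state \<Rightarrow> bool" where
  "prime_search_inv x t N s z s' \<longleftrightarrow> same_except {x, t} s s' \<and>
     N \<le> imem s' x \<and> imem s' x \<le> next_prime N \<and> 2 \<le> imem s' t \<and> imem s' t \<le> imem s' x \<and>
     (\<forall>j. 2 \<le> j \<longrightarrow> j < imem s' t \<longrightarrow> \<not> j dvd imem s' x) \<and>
     z = prime_search_rank (next_prime N) (imem s' x) (imem s' t)"

definition prime_search_time :: "nat \<Rightarrow> nat" where
  "prime_search_time N = 4 * (next_prime N * (next_prime N + 1) + next_prime N) + 2"

lemma prime_search_rank_Suc_less: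
  assumes "u < q" shows "prime_search_rank q (Suc u) v < prime_search_rank q u v'"
proof -
  have "q - u = Suc (q - Suc u)" using assms by simp
  then have "(q - u) * (q + 1) = (q - Suc u) * (q + 1) + (q + 1)" by simp
  then show ?thesis unfolding prime_search_rank_def by linarith
qed

lemma runs_prime_search_body:
  assumes bounds: "x \<noteq> t" "x < m" "t < m" "x < B" "t < B" "2 \<le> N" "next_prime N + 1 < B"
    and I: "prime_search_inv x t N s z s'" and less: "imem s' t < imem s' x"
  shows "runs m B (prime_search_body x t) s' 3 (\<lambda>s''. \<exists>y<z. prime_search_inv x t N s y s'')"
  unfolding prime_search_body_def
proof (rule runs_Cond)
  let ?q = "next_prime N" and ?divides = "ILess (IMod (reg x) (reg t)) (INum 1)"
  have small: "imem s' x < B" "imem s' t < B" "2 < B" "Suc (imem s' t) < B"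
    using I less bounds by (auto simp: prime_search_inv_def)
  then show "bok m B s' ?divides" using bounds by simp
  show "runs m B (x ::= reg x \<oplus> INum 1 ;; t ::= INum 2) s' (3 - 1)
      (\<lambda>s''. \<exists>y<z. prime_search_inv x t N s y s'')" if "bval s' ?divides"
  proof -
    have "imem s' t dvd imem s' x" using that by (simp add: mod_eq_0_iff_dvd)
    then have "\<not> prime (imem s' x)" using less I by (auto simp: prime_search_inv_def prime_nat_iff)
    then have "imem s' x < ?q"
      using I prime_next_prime[of N] by (metis le_neq_implies_less prime_search_inv_def)
    then show ?thesis
      using I small bounds
      by (intro runs_IAssign_Seq runs_IAssign)
        (auto simp: prime_search_inv_def prime_search_rank_Suc_less intro!: same_except_intros)
  qed
  show "runs m B (t ::= reg t \<oplus> INum 1) s' (3 - 1) (\<lambda>s''. \<exists>y<z. prime_search_inv x t N s y s'')"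
    if nd: "\<not> bval s' ?divides"
  proof -
    have "\<not> j dvd imem s' x" if "2 \<le> j" "j < Suc (imem s' t)" for j
      using that nd I by (cases "j = imem s' t") (auto simp: prime_search_inv_def mod_eq_0_iff_dvd)
    moreover have "prime_search_rank ?q (imem s' x) (Suc (imem s' t)) < z"
      using I less by (auto simp: prime_search_inv_def prime_search_rank_def)
    ultimately show ?thesis
      using I less small bounds
      by (intro runs_IAssign) (auto simp: prime_search_inv_def intro!: same_except_intros)
  qed
qed simp

lemma runs_prime_search:
  assumes bounds: "x \<noteq> t" "x < m" "t < m" "x < B" "t < B" "2 \<le> N" "next_prime N + 1 < B"
    and s: "imem s x = N"
  shows "runs m B (prime_search x t) s (prime_search_time N)
    (\<lambda>s'. same_except {x, t} s s' \<and> imem s' x = next_prime N)"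
proof -
  let ?q = "next_prime N" and ?e = "ILess (reg t) (reg x)"
  let ?I = "prime_search_inv x t N s"
  have loop: "runs m B (While ?e (prime_search_body x t)) s' (4 * (?q * (?q + 1) + ?q) + 1)
      (\<lambda>s'. same_except {x, t} s s' \<and> imem s' x = ?q)" if I: "?I z s'" for z s'
  proof (rule runs_While[where I = ?I and Tb = 3, OF I])
    fix z s' assume I: "?I z s'"
    then show "bok m B s' ?e" using bounds by (auto simp: prime_search_inv_def)
    show "runs m B (prime_search_body x t) s' 3 (\<lambda>s''. \<exists>y<z. ?I y s'')" if "bval s' ?e"
      using that by (intro runs_prime_search_body[OF bounds I]) simp
    show "same_except {x, t} s s' \<and> imem s' x = ?q" if "\<not> bval s' ?e"
    proof -
      have "imem s' t = imem s' x" using that I by (simp add: prime_search_inv_def)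
      then have "prime (imem s' x)" using I by (auto simp: prime_search_inv_def prime_nat_iff')
      then show ?thesis using I next_prime_le[of "imem s' x" N] by (simp add: prime_search_inv_def)
    qed
  next
    have "(?q - imem s' x) * (?q + 1) \<le> ?q * (?q + 1)" by (intro mult_le_mono1) simp
    then show "z * (3 + 1) + 1 \<le> 4 * (?q * (?q + 1) + ?q) + 1"
      using I by (simp add: prime_search_inv_def prime_search_rank_def)
  qed
  show ?thesis unfolding prime_search_def prime_search_time_def
    using bounds next_prime_ge[of N] s
    by (intro runs_IAssign_Seq runs_weaken[OF loop])
      (auto simp: prime_search_inv_def intro!: same_except_intros)
qed

section \<open>The sketch\<close>

lemma stream_vec_snoc: "stream_vec (\<sigma> @ [(i, \<Delta>)]) j = stream_vec \<sigma> j + (if i = j then \<Delta> else 0)"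
  by (simp add: stream_vec_def)

lemma strict_turnstile_snocD:
  assumes "strict_turnstile n (\<sigma> @ [(i, \<Delta>)])"
  shows "strict_turnstile n \<sigma>" "i < n"
proof -
  have "stream_vec (take k \<sigma>) j \<ge> 0" if "k \<le> length \<sigma>" "j < n" for k j
  proof -
    have "stream_vec (take k (\<sigma> @ [(i, \<Delta>)])) j \<ge> 0"
      using assms that unfolding strict_turnstile_def by (metis le_SucI length_append_singleton)
    then show ?thesis using that by simp
  qed
  then show "strict_turnstile n \<sigma>" "i < n" using assms by (auto simp: strict_turnstile_def)
qed

lemma strict_turnstile_nonneg: "strict_turnstile n \<sigma> \<Longrightarrow> i < n \<Longrightarrow> 0 \<le> stream_vec \<sigma> i"
  unfolding strict_turnstile_def by (metis order_refl take_all)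

lemma l1_norm_eq_sum: "(\<And>i. i < n \<Longrightarrow> 0 \<le> x i) \<Longrightarrow> l1_norm n x = (\<Sum>i<n. x i)"
  unfolding l1_norm_def by (intro sum.cong) auto

definition bit_poly :: "nat \<Rightarrow> nat \<Rightarrow> int poly" where
  "bit_poly l i = (\<Sum>j<l. monom (int (i div 2 ^ j mod 2)) j)"

lemma coeff_bit_poly: "coeff (bit_poly l i) j = (if j < l then int (i div 2 ^ j mod 2) else 0)"
  unfolding bit_poly_def by (simp add: coeff_sum)

lemma degree_bit_poly_le: "degree (bit_poly l i) \<le> l - 1"
  by (rule degree_le) (auto simp: coeff_bit_poly)

lemma poly_euler_op_bit_poly:
  "poly ((euler_op ^^ v) (bit_poly l i)) y = (\<Sum>j<l. int (i div 2 ^ j mod 2) * int j ^ v * y ^ j)"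
proof -
  have "(euler_op ^^ v) (bit_poly l i) = (\<Sum>j<l. monom (int (i div 2 ^ j mod 2) * int j ^ v) j)"
    by (rule poly_eqI) (auto simp: coeff_euler_op_pow coeff_bit_poly coeff_sum)
  then show ?thesis by (simp add: poly_sum poly_monom)
qed

lemma bit_poly_incongruent:
  assumes "q > 1" "i < 2 ^ l" "j < 2 ^ l" "[:int q:] dvd bit_poly l i - bit_poly l j"
  shows "i = j"
proof -
  have bit_eq: "i div 2 ^ k mod 2 = of_bool (bit i k)" for i k :: nat
    by (simp add: bit_iff_odd of_bool_odd_eq_mod_2)
  have "bit i k = bit j k" if "k < l" for k
  proof -
    have "int q dvd coeff (bit_poly l i - bit_poly l j) k" using assms(4) const_poly_dvd_iff by blast
    then have "int q dvd int (of_bool (bit i k)) - int (of_bool (bit j k))"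
      using that by (simp only: coeff_diff coeff_bit_poly bit_eq if_True)
    then show ?thesis using assms(1) by (auto simp: of_bool_def split: if_splits)
  qed
  then have "take_bit l i = take_bit l j" by (intro bit_eqI) (auto simp: bit_take_bit_iff)
  then show ?thesis using assms(2,3) by (metis take_bit_nat_eq_self)
qed

text \<open>
  \<open>2 ^ \<kappa>\<close> is \<open>1/\<epsilon>\<close> up to a factor of two, capped at about \<open>n\<close>. Given \<open>r\<close>, expansion needs
  \<open>d ^ r \<ge> 4 * 2 ^ \<kappa>\<close> and \<open>q > 4 * r * d * L\<close>, which leads to \<open>M = q ^ (r + 1)\<close> of order
  \<open>S ^ (r + 1) * 2 ^ (\<kappa> * (1 + 1 / r))\<close>; the choice of \<open>r\<close> makes \<open>S ^ r\<close> about \<open>2 ^ (\<kappa> * a / b)\<close>.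
\<close>

locale sketch =
  fixes n a b C0 :: nat and \<epsilon> :: real
  assumes n_ge: "n \<ge> 2" and eps: "0 < \<epsilon>" "\<epsilon> \<le> 1 / 2" and ab: "a \<ge> 1" "b \<ge> 1" and C0_ge: "C0 \<ge> 1"
    and prime_gap: "\<And>x. x \<ge> 1 \<Longrightarrow> \<exists>p. prime p \<and> x < p \<and> p \<le> C0 * x"
begin

definition \<kappa> :: nat where "\<kappa> = (LEAST l. \<not> (2 ^ l < n \<and> 2 ^ l * \<epsilon> < 1))"
definition L :: nat where "L = ceillog2 n"
definition S :: nat where "S = 16 * a * C0 * L * \<kappa>"
definition \<mu> :: nat where "\<mu> = ceillog2 S"
definition r :: nat where "r = a * \<kappa> div (b * \<mu>) + 1"
definition g :: nat where "g = (LEAST g. \<kappa> + 2 \<le> g * r)"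
definition d :: nat where "d = 2 ^ g"
definition q :: nat where "q = next_prime (4 * r * d * L + 1)"
definition M :: nat where "M = q ^ (r + 1)"

lemma \<kappa>_stop: "\<not> (2 ^ \<kappa> < n \<and> 2 ^ \<kappa> * \<epsilon> < 1)"
  unfolding \<kappa>_def
  by (rule LeastI[of "\<lambda>l. \<not> (2 ^ l < n \<and> 2 ^ l * \<epsilon> < 1)" n]) (simp add: less_exp less_imp_le not_less)

lemma less_\<kappa>: "l < \<kappa> \<Longrightarrow> 2 ^ l < n \<and> 2 ^ l * \<epsilon> < 1"
  unfolding \<kappa>_def using not_less_Least by fastforce

lemma \<kappa>_pos: "\<kappa> \<ge> 1"
  using \<kappa>_stop n_ge eps by (cases \<kappa>) auto

lemma le_two_power_L: "n \<le> 2 ^ L"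
  unfolding L_def by (rule le_two_power_ceillog2)

lemma two_power_less_n: "l < L \<Longrightarrow> 2 ^ l < n"
  using n_ge ceillog2_le_iff[of n l] unfolding L_def by (auto simp: not_le[symmetric])

lemma L_pos: "L \<ge> 1"
  using le_two_power_L n_ge by (cases L) auto

lemma \<kappa>_le_L: "\<kappa> \<le> L"
proof -
  have "2 ^ (\<kappa> - 1) < n" using less_\<kappa>[of "\<kappa> - 1"] \<kappa>_pos by simp
  also note le_two_power_L
  finally have "\<kappa> - 1 < L" by simp
  then show ?thesis by simp
qed

lemma L_le_n: "L \<le> n"
proof -
  have "L - 1 < 2 ^ (L - 1)" by (rule less_exp)
  also have "\<dots> < n" using two_power_less_n[of "L - 1"] L_pos by simp
  finally show ?thesis by simp
qed

lemma S_ge: "S \<ge> 16"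
  using ab C0_ge L_pos \<kappa>_pos by (simp add: S_def Suc_le_eq)

lemma two_power_\<mu>: "S \<le> 2 ^ \<mu>" "2 ^ \<mu> \<le> 2 * S"
  using le_two_power_ceillog2[of S] two_power_ceillog2_gt[of S] S_ge by (simp_all add: \<mu>_def)

lemma \<mu>_pos: "\<mu> \<ge> 1"
  using two_power_\<mu>(1) S_ge by (cases \<mu>) auto

lemma r_pos: "r \<ge> 1"
  by (simp add: r_def)

lemma g_mult_r_ge: "\<kappa> + 2 \<le> g * r"
  unfolding g_def
  by (rule LeastI[of "\<lambda>g. \<kappa> + 2 \<le> g * r" "\<kappa> + 2"]) (use mult_le_mono2[OF r_pos, of "\<kappa> + 2"] in simp)

lemma less_g: "x < g \<Longrightarrow> x * r < \<kappa> + 2"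
  unfolding g_def using not_less_Least by fastforce

lemma g_pos: "g \<ge> 1"
  using g_mult_r_ge by (cases g) auto

lemma d_ge: "d \<ge> 2"
  unfolding d_def using g_pos power_increasing[of 1 g "2::nat"] by simp

lemma d_power_r_ge: "4 * 2 ^ \<kappa> \<le> d ^ r"
proof -
  have "(2::nat) ^ (\<kappa> + 2) \<le> 2 ^ (g * r)" using g_mult_r_ge by (intro power_increasing) auto
  then show ?thesis by (simp add: d_def power_mult)
qed

lemma prime_q: "prime q"
  unfolding q_def by (rule prime_next_prime)

lemma q_gt_1: "q > 1"
  using prime_q by (rule prime_gt_1_nat)

lemma q_greater: "4 * (r * d * L) < q"
  using next_prime_ge[of "4 * r * d * L + 1"] by (simp add: q_def mult.assoc)

lemma params_less_q: "r < q" "d < q" "L < q" "4 * (r * d) < q"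
proof -
  have "r \<le> r * d * L" "d \<le> r * d * L" "L \<le> r * d * L" "r * d \<le> r * d * L"
    using r_pos d_ge L_pos by auto
  then show "r < q" "d < q" "L < q" "4 * (r * d) < q" using q_greater by linarith+
qed

lemma q_le_M: "q \<le> M"
  unfolding M_def using q_gt_1 power_increasing[of 1 "r + 1" q] by simp

definition hash_partial :: "nat \<Rightarrow> nat \<Rightarrow> nat \<Rightarrow> nat \<Rightarrow> nat" where
  "hash_partial i y v k = (\<Sum>j<k. (i div 2 ^ j mod 2) * j ^ v * y ^ j) mod q"

definition hash :: "nat \<Rightarrow> nat \<Rightarrow> nat \<Rightarrow> nat" where
  "hash i y v = hash_partial i y v L"

primrec bucket_upto :: "nat \<Rightarrow> nat \<Rightarrow> nat \<Rightarrow> nat" where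
  "bucket_upto i y 0 = y"
| "bucket_upto i y (Suc v) = bucket_upto i y v * q + hash i y v"

definition bucket :: "nat \<Rightarrow> nat \<Rightarrow> nat" where
  "bucket i y = bucket_upto i y r"

lemma hash_partial_less: "hash_partial i y v k < q"
  unfolding hash_partial_def using q_gt_1 by simp

lemma hash_partial_0: "hash_partial i y v 0 = 0"
  by (simp add: hash_partial_def)

lemma hash_partial_Suc:
  "hash_partial i y v (Suc k) = (hash_partial i y v k + i div 2 ^ k mod 2 * k ^ v * (y ^ k mod q)) mod q"
proof -
  have "(x mod q + z * (y ^ k mod q)) mod q = (x + z * y ^ k) mod q" for x z
    unfolding mod_add_left_eq by (subst (1 2) mod_add_right_eq[symmetric]) (simp only: mod_mult_right_eq)
  then show ?thesis unfolding hash_partial_def by simp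
qed

lemma hash_less: "hash i y v < q"
  unfolding hash_def by (rule hash_partial_less)

lemma bucket_upto_less: "y < q \<Longrightarrow> bucket_upto i y v < q ^ (v + 1)"
proof (induction v)
  case (Suc v)
  then have "(bucket_upto i y v + 1) * q \<le> q ^ (v + 1) * q" by (intro mult_le_mono1) simp
  then show ?case using hash_less[of i y v] by (simp add: mult.commute mult.left_commute)
qed simp

lemma bucket_upto_less_M:
  assumes "y < q" "v \<le> r" shows "bucket_upto i y v < M"
proof -
  have "q ^ (v + 1) \<le> M" unfolding M_def using q_gt_1 assms by (intro power_increasing) auto
  then show ?thesis using bucket_upto_less[OF assms(1), of i v] by simp
qed

lemma bucket_less_M: "y < q \<Longrightarrow> bucket i y < M"
  unfolding bucket_def by (rule bucket_upto_less_M) auto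

lemma bucket_upto_eqD:
  assumes "bucket_upto i y v = bucket_upto i' y' v"
  shows "y = y' \<and> (\<forall>u<v. hash i y u = hash i' y' u)"
  using assms
proof (induction v)
  case (Suc v)
  have digits: "bucket_upto i y (Suc v) div q = bucket_upto i y v"
    "bucket_upto i y (Suc v) mod q = hash i y v" for i y
    using hash_less[of i y v] by simp_all
  have "bucket_upto i y v = bucket_upto i' y' v" "hash i y v = hash i' y' v"
    using Suc.prems digits by metis+
  then show ?case using Suc.IH by (auto simp: less_Suc_eq)
qed simp

lemma bucket_eq_imp_code_point_eq:
  assumes "bucket i y = bucket i' y'"
  shows "code_point q r (bit_poly L i) (int y) = code_point q r (bit_poly L i') (int y')"
proof -
  have yy': "y = y'" and hash_eq: "\<And>u. u < r \<Longrightarrow> hash i y u = hash i' y' u"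
    using bucket_upto_eqD assms unfolding bucket_def by blast+
  have jet: "poly (euler_jet (bit_poly L i) (Suc v)) (int y) mod int q = int (hash i y v)" for i y v
    by (simp add: euler_jet_def poly_euler_op_bit_poly hash_def hash_partial_def of_nat_mod)
  show ?thesis unfolding code_point_def
  proof (rule restrict_ext)
    fix j assume j: "j \<in> {..r}"
    show "poly (euler_jet (bit_poly L i) j) (int y) mod int q =
        poly (euler_jet (bit_poly L i') j) (int y') mod int q"
    proof (cases j)
      case 0
      then show ?thesis using yy' by (simp add: euler_jet_def)
    next
      case (Suc v)
      then show ?thesis using hash_eq j by (simp only: jet) simp
    qed
  qed
qed

definition buckets :: "nat set \<Rightarrow> nat set" where
  "buckets F = (\<Union>i\<in>F. bucket i ` {1..<q})"

lemma card_code_points_le_card_buckets: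
  assumes "finite F"
  shows "card (code_points q r (bit_poly L ` F)) \<le> card (buckets F)"
proof -
  let ?point = "\<lambda>(i, y). code_point q r (bit_poly L i) (int y)"
  have "case_prod bucket x = case_prod bucket x' \<longrightarrow> ?point x = ?point x'" for x x'
    by (cases x; cases x'; simp only: prod.case) (blast intro: bucket_eq_imp_code_point_eq)
  then obtain h where "?point = h \<circ> case_prod bucket" using function_factors_left by blast
  then have h: "code_point q r (bit_poly L i) (int y) = h (bucket i y)" for i y
    by (simp add: fun_eq_iff)
  have "{1..<int q} = int ` {1..<q}" by (simp add: image_int_atLeastLessThan)
  then have "code_points q r (bit_poly L ` F) = h ` buckets F"
    by (simp only: code_points_def buckets_def image_UN image_image h)
  then show ?thesis using assms by (simp add: buckets_def card_image_le)
qed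

lemma twice_max_degree_le: "2 * ((q - 1) div 4 + r * ((d - 1) * (L - 1))) \<le> q - 1"
proof -
  have "r * ((d - 1) * (L - 1)) \<le> r * (d * L)" by (intro mult_le_mono) auto
  then have "4 * (r * ((d - 1) * (L - 1))) \<le> q - 1" using q_greater unfolding mult.assoc by linarith
  moreover have "2 * ((q - 1) div 4 + x) \<le> q - 1" if "4 * x \<le> q - 1" for x using that by simp
  ultimately show ?thesis by blast
qed

lemma bucket_expansion:
  assumes F: "F \<subseteq> {..<n}" and few: "card (buckets F) \<le> (q - 1) * 2 ^ \<kappa>"
  shows "card F * (q - 1) \<le> 2 * card (buckets F)"
proof -
  define N where "N = card (code_points q r (bit_poly L ` F))"
  have finF: "finite F" using F finite_subset by blast
  have eq_if_congruent: "i = j" if "i \<in> F" "j \<in> F" "[:int q:] dvd bit_poly L i - bit_poly L j" for i j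
  proof (rule bit_poly_incongruent[OF q_gt_1 _ _ that(3)])
    show "i < 2 ^ L" "j < 2 ^ L" using that F le_two_power_L by auto
  qed
  interpret multiplicity_code q r "(q - 1) div 4 + 1" d "L - 1" "bit_poly L ` F"
    by unfold_locales
      (use prime_q params_less_q finF eq_if_congruent degree_bit_poly_le in \<open>auto dest: less_imp_le\<close>)
  have N_le: "N \<le> card (buckets F)" unfolding N_def using finF by (rule card_code_points_le_card_buckets)
  have max_degree: "2 * max_degree \<le> q - 1"
    unfolding max_degree_def using twice_max_degree_le by simp
  then have max_degree_less: "max_degree < q - 1" using q_gt_1 by linarith
  have "q - 1 < ((q - 1) div 4 + 1) * 4" using dividend_less_times_div[of 4 "q - 1"] by simp
  then have less: "(q - 1) * 2 ^ \<kappa> < ((q - 1) div 4 + 1) * (4 * 2 ^ \<kappa>)"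
    unfolding mult.assoc[symmetric] by (rule mult_strict_right_mono) simp
  have "N \<le> (q - 1) * 2 ^ \<kappa>" using N_le few by linarith
  also have "\<dots> < ((q - 1) div 4 + 1) * (4 * 2 ^ \<kappa>)" by (rule less)
  also have "\<dots> \<le> ((q - 1) div 4 + 1) * d ^ r" using d_power_r_ge by (rule mult_le_mono2)
  finally have "card (bit_poly L ` F) * (q - 1 - max_degree) \<le> N"
    using max_degree_less unfolding N_def by (intro multiplicity_code_expansion)
  moreover have "inj_on (bit_poly L) F" by (rule inj_onI) (use eq_if_congruent in auto)
  ultimately have "card F * (q - 1 - max_degree) \<le> card (buckets F)"
    using N_le by (simp add: card_image)
  moreover have "card F * (q - 1) \<le> card F * (2 * (q - 1 - max_degree))"
    using max_degree by (intro mult_le_mono2) linarith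
  ultimately show ?thesis by linarith
qed

definition deposit :: "nat \<Rightarrow> real \<Rightarrow> nat \<Rightarrow> nat \<Rightarrow> real" where
  "deposit i \<delta> k p = (\<Sum>y\<in>{1..<k}. if bucket i y = p then \<delta> else 0)"

definition load :: "(nat \<Rightarrow> real) \<Rightarrow> nat \<Rightarrow> real" where
  "load x p = (\<Sum>i<n. deposit i (x i) q p)"

definition candidates :: "(nat \<Rightarrow> real) \<Rightarrow> nat set" where
  "candidates x = {i. i < n \<and> (\<forall>y\<in>{1..<q}. \<epsilon> * (\<Sum>j<n. x j) \<le> load x (bucket i y))}"

lemma candidates_subset: "candidates x \<subseteq> {..<n}"
  by (auto simp: candidates_def)

lemma deposit_Suc_0: "deposit i \<delta> (Suc 0) p = 0"
  by (simp add: deposit_def)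

lemma deposit_Suc:
  "1 \<le> k \<Longrightarrow> deposit i \<delta> (Suc k) p = deposit i \<delta> k p + (if bucket i k = p then \<delta> else 0)"
  by (simp add: deposit_def)

lemma deposit_zero: "deposit i 0 k p = 0"
  by (simp add: deposit_def)

lemma deposit_add: "deposit i (\<delta> + \<delta>') k p = deposit i \<delta> k p + deposit i \<delta>' k p"
  by (auto simp: deposit_def sum.distrib[symmetric] intro!: sum.cong)

lemma deposit_nonneg: "0 \<le> \<delta> \<Longrightarrow> 0 \<le> deposit i \<delta> k p"
  by (simp add: deposit_def sum_nonneg)

lemma load_ge:
  assumes "\<And>i. i < n \<Longrightarrow> 0 \<le> x i" "i < n" "y \<in> {1..<q}"
  shows "x i \<le> load x (bucket i y)"
proof -
  have "x i \<le> deposit i (x i) q (bucket i y)"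
    unfolding deposit_def
    using member_le_sum[OF assms(3), of "\<lambda>y'. if bucket i y' = bucket i y then x i else 0"] assms(1,2) by simp
  also have "\<dots> \<le> load x (bucket i y)"
    unfolding load_def using assms(1,2)
    by (intro member_le_sum[where f = "\<lambda>i'. deposit i' (x i') q (bucket i y)"]) (auto intro: deposit_nonneg)
  finally show ?thesis .
qed

lemma heavy_hitters_subset_candidates:
  assumes "\<And>i. i < n \<Longrightarrow> 0 \<le> x i"
  shows "heavy_hitters n \<epsilon> x \<subseteq> candidates x"
proof
  fix i assume "i \<in> heavy_hitters n \<epsilon> x"
  then have "i < n" "\<epsilon> * (\<Sum>j<n. x j) \<le> x i"
    using assms l1_norm_eq_sum[OF assms] by (auto simp: heavy_hitters_def)
  then show "i \<in> candidates x"
    unfolding candidates_def using load_ge[of x i] assms order_trans by blast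
qed

lemma sum_load_le:
  assumes "\<And>i. i < n \<Longrightarrow> 0 \<le> x i" "finite G"
  shows "(\<Sum>p\<in>G. load x p) \<le> real (q - 1) * (\<Sum>i<n. x i)"
proof -
  have "(\<Sum>p\<in>G. load x p) = (\<Sum>i<n. \<Sum>y\<in>{1..<q}. \<Sum>p\<in>G. if bucket i y = p then x i else 0)"
    unfolding load_def deposit_def by (subst sum.swap, rule sum.cong[OF refl], subst sum.swap, rule refl)
  also have "\<dots> \<le> (\<Sum>i<n. \<Sum>y\<in>{1..<q}. x i)"
    using assms by (intro sum_mono) auto
  also have "\<dots> = real (q - 1) * (\<Sum>i<n. x i)" by (simp add: sum_distrib_left)
  finally show ?thesis .
qed

lemma card_buckets_candidates_le:
  assumes "\<And>i. i < n \<Longrightarrow> 0 \<le> x i" "0 < (\<Sum>j<n. x j)"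
  shows "\<epsilon> * card (buckets (candidates x)) \<le> real (q - 1)"
proof -
  let ?t = "\<Sum>j<n. x j" and ?G = "buckets (candidates x)"
  have "(\<epsilon> * card ?G) * ?t = (\<Sum>p\<in>?G. \<epsilon> * ?t)" by simp
  also have "\<dots> \<le> (\<Sum>p\<in>?G. load x p)"
    by (rule sum_mono) (auto simp: buckets_def candidates_def)
  also have "\<dots> \<le> real (q - 1) * ?t"
    using finite_subset[OF candidates_subset] by (intro sum_load_le assms(1)) (auto simp: buckets_def)
  finally show ?thesis using assms(2) by simp
qed

lemma card_candidates_le:
  assumes "\<And>i. i < n \<Longrightarrow> 0 \<le> x i" "0 < (\<Sum>j<n. x j)"
  shows "card (candidates x) \<le> 2 * 2 ^ \<kappa>"
proof (cases "2 ^ \<kappa> < n")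
  case False
  have "card (candidates x) \<le> card {..<n}" by (rule card_mono[OF _ candidates_subset]) simp
  then show ?thesis using False by simp
next
  case True
  let ?N = "card (buckets (candidates x))"
  have "1 \<le> 2 ^ \<kappa> * \<epsilon>" using True \<kappa>_stop by simp
  then have "real ?N \<le> 2 ^ \<kappa> * \<epsilon> * real ?N" using mult_right_mono[of 1 "2 ^ \<kappa> * \<epsilon>" "real ?N"] by simp
  also have "\<dots> \<le> 2 ^ \<kappa> * real (q - 1)"
    using card_buckets_candidates_le[OF assms] by (simp add: mult.assoc)
  finally have "real ?N \<le> real ((q - 1) * 2 ^ \<kappa>)" by (simp add: mult.commute)
  then have few: "?N \<le> (q - 1) * 2 ^ \<kappa>" by (simp only: of_nat_le_iff)
  then have "card (candidates x) * (q - 1) \<le> 2 * ?N" using candidates_subset by (intro bucket_expansion)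
  also have "\<dots> \<le> (2 * 2 ^ \<kappa>) * (q - 1)" using few by (simp add: mult_ac)
  finally show ?thesis using q_gt_1 by simp
qed

lemma load_stream_vec_snoc:
  assumes "i < n"
  shows "load (stream_vec (\<sigma> @ [(i, \<Delta>)])) p = load (stream_vec \<sigma>) p + deposit i \<Delta> q p"
proof -
  have "deposit j (stream_vec (\<sigma> @ [(i, \<Delta>)]) j) q p =
      deposit j (stream_vec \<sigma> j) q p + (if i = j then deposit i \<Delta> q p else 0)" for j
    by (simp add: stream_vec_snoc deposit_add deposit_zero)
  then show ?thesis unfolding load_def using assms by (simp add: sum.distrib)
qed

end

section \<open>The programs\<close>

abbreviation (input) n_cell :: nat where "n_cell \<equiv> 0"
abbreviation (input) i_cell :: nat where "i_cell \<equiv> 1"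
abbreviation (input) pow_cell :: nat where "pow_cell \<equiv> 2"
abbreviation (input) \<kappa>_cell :: nat where "\<kappa>_cell \<equiv> 3"
abbreviation (input) L_cell :: nat where "L_cell \<equiv> 4"
abbreviation (input) \<mu>_cell :: nat where "\<mu>_cell \<equiv> 5"
abbreviation (input) r_cell :: nat where "r_cell \<equiv> 6"
abbreviation (input) d_cell :: nat where "d_cell \<equiv> 7"
abbreviation (input) q_cell :: nat where "q_cell \<equiv> 8"
abbreviation (input) y_cell :: nat where "y_cell \<equiv> 9"
abbreviation (input) bucket_cell :: nat where "bucket_cell \<equiv> 10"
abbreviation (input) tmp_cell :: nat where "tmp_cell \<equiv> 11"
abbreviation (input) v_cell :: nat where "v_cell \<equiv> 12"
abbreviation (input) hash_cell :: nat where "hash_cell \<equiv> 13"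
abbreviation (input) bits_cell :: nat where "bits_cell \<equiv> 14"
abbreviation (input) ypow_cell :: nat where "ypow_cell \<equiv> 15"
abbreviation (input) j_cell :: nat where "j_cell \<equiv> 16"
abbreviation (input) jpow_cell :: nat where "jpow_cell \<equiv> 17"
abbreviation (input) u_cell :: nat where "u_cell \<equiv> 18"
abbreviation (input) pass_cell :: nat where "pass_cell \<equiv> 19"

abbreviation (input) \<epsilon>_rcell :: nat where "\<epsilon>_rcell \<equiv> 0"
abbreviation (input) \<Delta>_rcell :: nat where "\<Delta>_rcell \<equiv> 2"
abbreviation (input) total_rcell :: nat where "total_rcell \<equiv> 3"
abbreviation (input) load_rcell :: nat where "load_rcell \<equiv> 4"

definition scale_prog :: com where
  "scale_prog = doubling_loop pow_cell \<kappa>_cell (INum 1)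
     (BAnd (ILess (reg pow_cell) (reg n_cell))
       (RLess (RMul (ROfInt (reg pow_cell)) (RCell (INum \<epsilon>_rcell))) (ROfInt (INum 1))))"

definition log_prog :: "nat \<Rightarrow> iexp \<Rightarrow> com" where
  "log_prog x e = doubling_loop tmp_cell x (INum 1) (ILess (reg tmp_cell) e)"

definition side_prog :: com where
  "side_prog = doubling_loop d_cell tmp_cell (reg r_cell) (ILess (reg tmp_cell) (reg \<kappa>_cell \<oplus> INum 2))"

definition order_prog :: "nat \<Rightarrow> nat \<Rightarrow> nat \<Rightarrow> com" where
  "order_prog a b C0 = scale_prog ;; log_prog L_cell (reg n_cell) ;;
     log_prog \<mu>_cell (INum (16 * a * C0) \<otimes> reg L_cell \<otimes> reg \<kappa>_cell) ;;
     r_cell ::= IDiv (INum a \<otimes> reg \<kappa>_cell) (INum b \<otimes> reg \<mu>_cell) \<oplus> INum 1"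

definition field_prog :: com where
  "field_prog = side_prog ;;
     q_cell ::= INum 4 \<otimes> reg r_cell \<otimes> reg d_cell \<otimes> reg L_cell \<oplus> INum 1 ;;
     prime_search q_cell tmp_cell"

definition setup_prog :: "nat \<Rightarrow> nat \<Rightarrow> nat \<Rightarrow> com" where
  "setup_prog a b C0 = order_prog a b C0 ;; field_prog"

definition power_prog :: com where
  "power_prog = jpow_cell ::= INum 1 ;;
     for_loop u_cell 0 v_cell (jpow_cell ::= reg jpow_cell \<otimes> reg j_cell)"

definition hash_step_prog :: com where
  "hash_step_prog =
     hash_cell ::= IMod
       (reg hash_cell \<oplus> IMod (reg bits_cell) (INum 2) \<otimes> reg jpow_cell \<otimes> reg ypow_cell) (reg q_cell) ;;
     ypow_cell ::= IMod (reg ypow_cell \<otimes> reg y_cell) (reg q_cell) ;;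
     bits_cell ::= IDiv (reg bits_cell) (INum 2)"

definition hash_prog :: com where
  "hash_prog = hash_cell ::= INum 0 ;; bits_cell ::= reg i_cell ;; ypow_cell ::= INum 1 ;;
     for_loop j_cell 0 L_cell (power_prog ;; hash_step_prog)"

definition bucket_prog :: com where
  "bucket_prog = bucket_cell ::= reg y_cell ;;
     for_loop v_cell 0 r_cell
       (hash_prog ;; bucket_cell ::= reg bucket_cell \<otimes> reg q_cell \<oplus> reg hash_cell)"

definition deposit_prog :: com where
  "deposit_prog = RAssign (INum load_rcell \<oplus> reg bucket_cell)
     (RAdd (RCell (INum load_rcell \<oplus> reg bucket_cell)) (RCell (INum \<Delta>_rcell)))"

definition update_prog :: "nat \<Rightarrow> nat \<Rightarrow> nat \<Rightarrow> com" where
  "update_prog a b C0 = setup_prog a b C0 ;;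
     RAssign (INum total_rcell) (RAdd (RCell (INum total_rcell)) (RCell (INum \<Delta>_rcell))) ;;
     for_loop y_cell 1 q_cell (bucket_prog ;; deposit_prog)"

definition compare_prog :: com where
  "compare_prog = Cond (RLess (RCell (INum load_rcell \<oplus> reg bucket_cell))
       (RMul (RCell (INum \<epsilon>_rcell)) (RCell (INum total_rcell))))
     (pass_cell ::= INum 0) Skip"

definition test_prog :: com where
  "test_prog = pass_cell ::= INum 1 ;; for_loop y_cell 1 q_cell (bucket_prog ;; compare_prog)"

definition report_prog :: com where
  "report_prog = Cond (BAnd (ILess (INum 0) (reg pass_cell))
       (RLess (ROfInt (INum 0)) (RCell (INum total_rcell))))
     (Emit (reg i_cell)) Skip"

definition query_prog :: "nat \<Rightarrow> nat \<Rightarrow> nat \<Rightarrow> com" where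
  "query_prog a b C0 = setup_prog a b C0 ;; for_loop i_cell 0 n_cell (test_prog ;; report_prog)"

lemma runs_log_prog:
  assumes "x \<noteq> tmp_cell" "tmp_cell < m" "x < m" "tmp_cell < B" "x < B" "2 * N < B" "0 < N"
    and e: "\<And>s'. same_except {tmp_cell, x} s s' \<Longrightarrow> iok m B s' e \<and> ival s' e = N"
  shows "runs m B (log_prog x e) s (3 * ceillog2 N + 3)
     (\<lambda>s'. same_except {tmp_cell, x} s s' \<and> imem s' x = ceillog2 N)"
proof -
  have pow: "2 ^ ceillog2 N < B" using two_power_ceillog2_gt[of N] assms by simp
  have log: "ceillog2 N < B" using less_exp pow by (rule less_trans)
  show ?thesis unfolding log_prog_def
  proof (rule runs_weaken[OF runs_doubling_loop[where k = 1 and N = "ceillog2 N"]])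
    fix l s' assume l: "l \<le> ceillog2 N" and s': "same_except {tmp_cell, x} s s'" "imem s' tmp_cell = 2 ^ l"
    have "(2::nat) ^ l \<le> 2 ^ ceillog2 N" using l by (intro power_increasing) auto
    moreover have "2 ^ l < N \<longleftrightarrow> l < ceillog2 N" using ceillog2_le_iff[of N l] assms(7) by auto
    ultimately show "bok m B s' (ILess (reg tmp_cell) e) \<and> (bval s' (ILess (reg tmp_cell) e) \<longleftrightarrow> l < ceillog2 N)"
      using e[OF s'(1)] s'(2) pow assms by auto
  qed (use assms pow log in auto)
qed

lemma runs_hash_step_prog:
  assumes "19 < m" "19 < B" "imem s q_cell < B" "imem s y_cell < B"
    and cells: "imem s hash_cell = h" "imem s bits_cell = x" "imem s jpow_cell = p" "imem s ypow_cell = z"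
    and bounds: "x < B" "p < B" "z < B" "h + x mod 2 * p * z < B" "x mod 2 * p < B" "z * imem s y_cell < B"
  shows "runs m B hash_step_prog s 3 (\<lambda>s'. same_except {hash_cell, ypow_cell, bits_cell} s s' \<and>
    imem s' hash_cell = (h + x mod 2 * p * z) mod imem s q_cell \<and>
    imem s' ypow_cell = z * imem s y_cell mod imem s q_cell \<and> imem s' bits_cell = x div 2)"
  unfolding hash_step_prog_def using assms
  by (intro runs_IAssign_Seq runs_IAssign) (auto intro!: same_except_intros)

locale sketch_machine = sketch +
  fixes m B :: nat
  assumes m: "M + 20 \<le> m"
    and B: "2 * n + 2 * S + a * \<kappa> + b * \<mu> + 2 * (M * q) + 100 < B"
begin

lemma word_bounds:
  "19 < m" "99 < B" "2 * n < B" "2 * S < B" "a * \<kappa> + 1 < B" "b * \<mu> < B" "M * q + q < B" "M + 4 < B" "M + 3 < m"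
proof -
  have "M \<le> M * q" "q \<le> M * q" using q_gt_1 q_le_M by auto
  then show "19 < m" "99 < B" "2 * n < B" "2 * S < B" "a * \<kappa> + 1 < B" "b * \<mu> < B" "M * q + q < B" "M + 4 < B"
    "M + 3 < m" using m B by linarith+
qed

lemma param_bounds: "n < B" "a < B" "b < B" "\<kappa> < B" "L < B" "\<mu> < B" "r < B" "d < B" "q < B" "q + 1 < B" "M < B"
proof -
  have "a \<le> a * \<kappa>" "\<kappa> \<le> a * \<kappa>" "b \<le> b * \<mu>" "\<mu> \<le> b * \<mu>" using \<kappa>_pos \<mu>_pos ab by simp_all
  then show "n < B" "a < B" "b < B" "\<kappa> < B" "L < B" "\<mu> < B" "r < B" "d < B" "q < B" "q + 1 < B" "M < B"
    using word_bounds L_le_n params_less_q q_le_M by linarith+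
qed

lemma runs_scale_prog:
  assumes "imem s n_cell = n" "rmem s \<epsilon>_rcell = \<epsilon>"
  shows "runs m B scale_prog s (3 * \<kappa> + 3)
    (\<lambda>s'. same_except {pow_cell, \<kappa>_cell} s s' \<and> imem s' \<kappa>_cell = \<kappa>)"
  unfolding scale_prog_def
proof (rule runs_weaken[OF runs_doubling_loop[where k = 1 and N = \<kappa>]])
  have small: "2 ^ l < B" if "l \<le> \<kappa>" for l
  proof (cases l)
    case (Suc k)
    then have "2 ^ k < n" using that less_\<kappa>[of k] by simp
    then show ?thesis using Suc word_bounds by simp
  qed (use word_bounds in auto)
  then show "2 ^ \<kappa> < B" by simp
  fix l s' assume l: "l \<le> \<kappa>" and s': "same_except {pow_cell, \<kappa>_cell} s s'" "imem s' pow_cell = 2 ^ l"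
  have "imem s' n_cell = n" "rmem s' \<epsilon>_rcell = \<epsilon>" using s' assms by (auto simp: same_except_def)
  moreover have "(2 ^ l < n \<and> 2 ^ l * \<epsilon> < 1) \<longleftrightarrow> l < \<kappa>"
    using less_\<kappa>[of l] \<kappa>_stop l by (cases "l = \<kappa>") auto
  ultimately show "bok m B s' (BAnd (ILess (reg pow_cell) (reg n_cell))
      (RLess (RMul (ROfInt (reg pow_cell)) (RCell (INum \<epsilon>_rcell))) (ROfInt (INum 1)))) \<and>
    (bval s' (BAnd (ILess (reg pow_cell) (reg n_cell))
      (RLess (RMul (ROfInt (reg pow_cell)) (RCell (INum \<epsilon>_rcell))) (ROfInt (INum 1)))) \<longleftrightarrow> l < \<kappa>)"
    using s'(2) small[OF l] word_bounds param_bounds by simp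
qed (use word_bounds param_bounds in auto)

lemma order_bounds: "16 * a * C0 * L < B" "16 * a * C0 < B" "a * \<kappa> div (b * \<mu>) + 1 < B"
proof -
  have "16 * a * C0 \<le> 16 * a * C0 * L" "16 * a * C0 * L \<le> S"
    using L_pos \<kappa>_pos by (simp_all add: S_def)
  then show "16 * a * C0 * L < B" "16 * a * C0 < B" using word_bounds(4) by linarith+
  show "a * \<kappa> div (b * \<mu>) + 1 < B"
    using div_le_dividend[of "a * \<kappa>" "b * \<mu>"] word_bounds(5) by linarith
qed

lemma runs_order_prog:
  assumes s: "imem s n_cell = n" "rmem s \<epsilon>_rcell = \<epsilon>"
  shows "runs m B (order_prog a b C0) s (3 * \<kappa> + 3 * L + 3 * \<mu> + 10)
     (\<lambda>s'. same_except {pow_cell, \<kappa>_cell, L_cell, \<mu>_cell, r_cell, tmp_cell} s s' \<and>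
       imem s' \<kappa>_cell = \<kappa> \<and> imem s' L_cell = L \<and> imem s' r_cell = r)"
proof -
  let ?A = "{pow_cell, \<kappa>_cell, L_cell, \<mu>_cell, r_cell, tmp_cell}"
  let ?S = "INum (16 * a * C0) \<otimes> reg L_cell \<otimes> reg \<kappa>_cell"
  define P1 where "P1 s' \<longleftrightarrow> same_except ?A s s' \<and> imem s' \<kappa>_cell = \<kappa>" for s'
  define P2 where "P2 s' \<longleftrightarrow> P1 s' \<and> imem s' L_cell = L" for s'
  define P3 where "P3 s' \<longleftrightarrow> P2 s' \<and> imem s' \<mu>_cell = \<mu>" for s'
  have scale: "runs m B scale_prog s (3 * \<kappa> + 3) P1"
    by (rule runs_weaken[OF runs_scale_prog[OF s]])
      (auto simp: P1_def intro: same_except_trans[OF same_except_refl])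
  have log_n: "runs m B (log_prog L_cell (reg n_cell)) s' (3 * L + 3) P2" if "P1 s'" for s'
    unfolding L_def
  proof (rule runs_weaken[OF runs_log_prog])
    fix s'' assume "same_except {tmp_cell, L_cell} s' s''"
    then show "iok m B s'' (reg n_cell) \<and> ival s'' (reg n_cell) = n"
      using that word_bounds param_bounds s by (auto simp: P1_def same_except_def)
  qed (use word_bounds n_ge that in \<open>auto simp: P1_def P2_def L_def same_except_imem intro: same_except_trans\<close>)
  have log_S: "runs m B (log_prog \<mu>_cell ?S) s' (3 * \<mu> + 3) P3" if "P2 s'" for s'
    unfolding \<mu>_def
  proof (rule runs_weaken[OF runs_log_prog])
    fix s'' assume "same_except {tmp_cell, \<mu>_cell} s' s''"
    then have "imem s'' L_cell = L" "imem s'' \<kappa>_cell = \<kappa>" using that by (auto simp: P1_def P2_def same_except_def)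
    then show "iok m B s'' ?S \<and> ival s'' ?S = S"
      using word_bounds param_bounds order_bounds by (auto simp: S_def)
  qed (use word_bounds S_ge that in \<open>auto simp: P1_def P2_def P3_def \<mu>_def same_except_imem intro: same_except_trans\<close>)
  have quotient: "runs m B (r_cell ::= IDiv (INum a \<otimes> reg \<kappa>_cell) (INum b \<otimes> reg \<mu>_cell) \<oplus> INum 1) s' 1
      (\<lambda>s'. same_except ?A s s' \<and> imem s' \<kappa>_cell = \<kappa> \<and> imem s' L_cell = L \<and> imem s' r_cell = r)" if "P3 s'" for s'
    using that word_bounds param_bounds order_bounds(3)
    by (intro runs_IAssign) (auto simp: P1_def P2_def P3_def r_def intro!: same_except_intros)
  show ?thesis unfolding order_prog_def
    by (rule runs_Seq[OF scale runs_Seq[OF log_n runs_Seq[OF log_S quotient]]], (assumption | rule order_refl)+) simp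
qed

lemma runs_side_prog:
  assumes "imem s \<kappa>_cell = \<kappa>" "imem s r_cell = r"
  shows "runs m B side_prog s (3 * g + 3) (\<lambda>s'. same_except {d_cell, tmp_cell} s s' \<and> imem s' d_cell = d)"
  unfolding side_prog_def
proof (rule runs_weaken[OF runs_doubling_loop[where k = r and N = g]])
  show "2 ^ g < B" using param_bounds by (simp add: d_def)
  have "(g - 1) * r < \<kappa> + 2" using less_g[of "g - 1"] g_pos by simp
  then have "g * r < \<kappa> + 2 + r" using g_pos by (cases g) auto
  moreover have "r \<le> M" using params_less_q q_le_M by linarith
  moreover have "\<kappa> \<le> n" using \<kappa>_le_L L_le_n by linarith
  ultimately show gB: "g * r < B"
    using word_bounds(3) mult_le_mono2[of 1 q M] q_gt_1 B by linarith
  fix l s' assume l: "l \<le> g" and s': "same_except {d_cell, tmp_cell} s s'" "imem s' tmp_cell = l * r"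
  have "imem s' \<kappa>_cell = \<kappa>" using s' assms by (auto simp: same_except_def)
  moreover have "l * r < \<kappa> + 2 \<longleftrightarrow> l < g" using less_g[of l] g_mult_r_ge l by (cases "l = g") auto
  moreover have "l * r < B" using mult_le_mono1[OF l, of r] gB by linarith
  ultimately show "bok m B s' (ILess (reg tmp_cell) (reg \<kappa>_cell \<oplus> INum 2)) \<and>
    (bval s' (ILess (reg tmp_cell) (reg \<kappa>_cell \<oplus> INum 2)) \<longleftrightarrow> l < g)"
    using s'(2) word_bounds B \<open>\<kappa> \<le> n\<close> by auto
qed (use word_bounds param_bounds assms in \<open>auto simp: same_except_def d_def\<close>)

lemma runs_field_prog:
  assumes s: "imem s \<kappa>_cell = \<kappa>" "imem s L_cell = L" "imem s r_cell = r"
  shows "runs m B field_prog s (3 * g + 4 * (q * (q + 1) + q) + 6)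
     (\<lambda>s'. same_except {d_cell, q_cell, tmp_cell} s s' \<and> imem s' q_cell = q)"
proof -
  let ?A = "{d_cell, q_cell, tmp_cell}"
  define P where "P s' \<longleftrightarrow> same_except ?A s s' \<and> imem s' d_cell = d" for s'
  define P' where "P' s' \<longleftrightarrow> same_except ?A s s' \<and> imem s' q_cell = 4 * r * d * L + 1" for s'
  have side: "runs m B side_prog s (3 * g + 3) P"
    by (rule runs_weaken[OF runs_side_prog[OF s(1,3)]])
      (auto simp: P_def intro: same_except_trans[OF same_except_refl])
  have start: "runs m B (q_cell ::= INum 4 \<otimes> reg r_cell \<otimes> reg d_cell \<otimes> reg L_cell \<oplus> INum 1) s' 1 P'"
    if "P s'" for s'
  proof -
    have s': "imem s' L_cell = L" "imem s' r_cell = r" "imem s' d_cell = d"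
      using that s by (auto simp: P_def same_except_def)
    have "4 * r * d * L + 1 \<le> q" unfolding q_def by (rule next_prime_ge)
    moreover have "4 * r * d < q" "4 * r \<le> 4 * r * d"
      using params_less_q(4) d_ge by (simp_all add: mult.assoc)
    ultimately have "4 * r * d * L + 1 < B" "4 * r * d < B" "4 * r < B"
      using param_bounds(9) by linarith+
    then show ?thesis
      using that s' word_bounds param_bounds
      by (intro runs_IAssign) (auto simp: P_def P'_def intro!: same_except_intros)
  qed
  have search: "runs m B (prime_search q_cell tmp_cell) s' (4 * (q * (q + 1) + q) + 2)
      (\<lambda>s'. same_except ?A s s' \<and> imem s' q_cell = q)" if "P' s'" for s'
  proof (rule runs_weaken[OF runs_prime_search[where N = "4 * r * d * L + 1"]])
    show "2 \<le> 4 * r * d * L + 1" using r_pos d_ge L_pos by simp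
  qed (use that word_bounds param_bounds in
      \<open>auto simp: P'_def q_def prime_search_time_def intro: same_except_trans\<close>)
  show ?thesis unfolding field_prog_def
    by (rule runs_Seq[OF side runs_Seq[OF start search]], (assumption | rule order_refl)+) simp
qed

definition setup_time :: nat where
  "setup_time = 3 * \<kappa> + 3 * L + 3 * \<mu> + 3 * g + 4 * (q * (q + 1) + q) + 16"

definition params_loaded :: "state \<Rightarrow> bool" where
  "params_loaded s \<longleftrightarrow> imem s L_cell = L \<and> imem s r_cell = r \<and> imem s q_cell = q"

lemma runs_setup_prog:
  assumes "imem s n_cell = n" "rmem s \<epsilon>_rcell = \<epsilon>"
  shows "runs m B (setup_prog a b C0) s setup_time
    (\<lambda>s'. same_except {2..11} s s' \<and> params_loaded s')"
  unfolding setup_prog_def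
proof (rule runs_Seq[OF runs_order_prog[OF assms]])
  let ?A = "{pow_cell, \<kappa>_cell, L_cell, \<mu>_cell, r_cell, tmp_cell}"
  fix s' assume s': "same_except ?A s s' \<and>
    imem s' \<kappa>_cell = \<kappa> \<and> imem s' L_cell = L \<and> imem s' r_cell = r"
  show "runs m B field_prog s' (3 * g + 4 * (q * (q + 1) + q) + 6)
      (\<lambda>s''. same_except {2..11} s s'' \<and> params_loaded s'')"
  proof (rule runs_weaken[OF runs_field_prog])
    fix s'' assume "same_except {d_cell, q_cell, tmp_cell} s' s'' \<and> imem s'' q_cell = q"
    then show "same_except {2..11} s s'' \<and> params_loaded s''"
      using s' by (auto simp: params_loaded_def same_except_imem intro: same_except_trans[of ?A])
  qed (use s' in auto)
qed (simp add: setup_time_def)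


lemma power_mult_q_le_M:
  assumes "j \<le> q" "v \<le> r" shows "j ^ v * q \<le> M"
proof -
  have "j ^ v \<le> q ^ v" using assms by (intro power_mono) auto
  also have "\<dots> \<le> q ^ r" using q_gt_1 assms by (intro power_increasing) auto
  finally have "j ^ v * q \<le> q ^ r * q" by (rule mult_le_mono1)
  then show ?thesis by (simp add: M_def mult.commute)
qed

lemma power_less_B:
  assumes "j < L" "v \<le> r" shows "j ^ v < B"
proof -
  have "j \<le> q" using assms(1) params_less_q(3) by linarith
  then have "j ^ v * q \<le> M" using assms(2) by (rule power_mult_q_le_M)
  moreover have "j ^ v * 1 \<le> j ^ v * q" using q_gt_1 by (intro mult_le_mono2) simp
  ultimately show ?thesis using param_bounds by linarith
qed

lemma runs_power_prog:
  assumes s: "imem s v_cell = v" "imem s j_cell = j" and vj: "v \<le> r" "j < L"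
  shows "runs m B power_prog s (3 * v + 3)
    (\<lambda>s'. same_except {jpow_cell, u_cell} s s' \<and> imem s' jpow_cell = j ^ v)"
proof -
  define I where "I u s' \<longleftrightarrow> same_except {jpow_cell, u_cell} s s' \<and>
    imem s' jpow_cell = j ^ u \<and> imem s' u_cell = u" for u s'
  have bounds: "v < B" "j < B" using vj param_bounds by auto
  have small: "j ^ u < B" if "u \<le> v" for u using that vj by (intro power_less_B) auto
  show ?thesis unfolding power_prog_def
  proof (intro runs_IAssign_Seq runs_for_loop[where I = I and N = v and Tb = 1])
    fix u s' assume u: "u < v" and I: "I u s'"
    have s': "imem s' j_cell = j" using I s by (auto simp: I_def same_except_def)
    show "runs m B (jpow_cell ::= reg jpow_cell \<otimes> reg j_cell) s' 1
      (\<lambda>s''. imem s'' u_cell = u \<and> I (Suc u) (s''\<lparr>imem := (imem s'')(u_cell := Suc u)\<rparr>))"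
      using I u s' bounds small[of u] small[of "Suc u"] word_bounds
      by (intro runs_IAssign) (auto simp: I_def mult.commute intro!: same_except_intros)
  qed (use s bounds word_bounds in \<open>auto simp: I_def same_except_imem intro!: same_except_intros\<close>)
qed

lemma hash_step_bounds:
  assumes "i < n" "y < q" "v < r" "j < L"
  shows "i div 2 ^ j < B" "i div 2 ^ j mod 2 * j ^ v < B" "y ^ j mod q * y < B"
    "i div 2 ^ j mod 2 * j ^ v * (y ^ j mod q) < B"
    "hash_partial i y v j + i div 2 ^ j mod 2 * j ^ v * (y ^ j mod q) < B"
proof -
  show "i div 2 ^ j < B"
    using assms(1) param_bounds(1) div_le_dividend[of i "2 ^ j"] by linarith
  have yq: "y ^ j mod q < q" using q_gt_1 by simp
  have jv: "j ^ v * q \<le> M"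
    using assms params_less_q(3) by (intro power_mult_q_le_M) linarith+
  have bit: "i div 2 ^ j mod 2 \<le> 1" by simp
  have bit_jv: "i div 2 ^ j mod 2 * j ^ v \<le> j ^ v" using mult_le_mono1[OF bit, of "j ^ v"] by simp
  moreover have "j ^ v < B" using assms by (intro power_less_B) auto
  ultimately show "i div 2 ^ j mod 2 * j ^ v < B" by (rule le_less_trans)
  have "i div 2 ^ j mod 2 * j ^ v * (y ^ j mod q) \<le> j ^ v * q"
    using mult_le_mono[OF bit_jv, of "y ^ j mod q" q] yq by simp
  then show "i div 2 ^ j mod 2 * j ^ v * (y ^ j mod q) < B"
    "hash_partial i y v j + i div 2 ^ j mod 2 * j ^ v * (y ^ j mod q) < B"
    using jv hash_partial_less[of i y v j] q_le_M word_bounds(7) mult_le_mono2[of 1 q M] q_gt_1 by linarith+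
  have "y ^ j mod q * y \<le> q * q" using yq assms(2) by (intro mult_le_mono) auto
  also have "\<dots> \<le> M * q" using q_le_M by (rule mult_le_mono1)
  finally show "y ^ j mod q * y < B" using word_bounds(7) by linarith
qed

definition hash_inv :: "state \<Rightarrow> nat \<Rightarrow> nat \<Rightarrow> nat \<Rightarrow> nat \<Rightarrow> state \<Rightarrow> bool" where
  "hash_inv s i y v j s' \<longleftrightarrow> same_except {hash_cell..u_cell} s s' \<and>
     imem s' hash_cell = hash_partial i y v j \<and> imem s' bits_cell = i div 2 ^ j \<and>
     imem s' ypow_cell = y ^ j mod q \<and> imem s' j_cell = j"

lemma runs_hash_iteration:
  assumes s: "imem s q_cell = q" "imem s y_cell = y" "imem s v_cell = v"
    and iyv: "i < n" "y < q" "v < r" and j: "j < L" and I: "hash_inv s i y v j s'"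
  shows "runs m B (power_prog ;; hash_step_prog) s' (3 * r + 6)
    (\<lambda>s''. imem s'' j_cell = j \<and> hash_inv s i y v (Suc j) (s''\<lparr>imem := (imem s'')(j_cell := Suc j)\<rparr>))"
proof -
  have s': "imem s' v_cell = v" "imem s' j_cell = j" using I s by (auto simp: hash_inv_def same_except_def)
  show ?thesis
  proof (rule runs_Seq[OF runs_power_prog[OF s']])
    fix s2 assume pow: "same_except {jpow_cell, u_cell} s' s2 \<and> imem s2 jpow_cell = j ^ v"
    then have s2: "imem s2 hash_cell = hash_partial i y v j" "imem s2 bits_cell = i div 2 ^ j"
      "imem s2 jpow_cell = j ^ v" "imem s2 ypow_cell = y ^ j mod q"
      and s2': "imem s2 j_cell = j" "imem s2 q_cell = q" "imem s2 y_cell = y" "same_except {hash_cell..u_cell} s s2"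
      using I s by (auto simp: hash_inv_def same_except_def)
    have "y ^ j mod q < B" using q_gt_1 param_bounds(9) mod_less_divisor[of q "y ^ j"] by linarith
    then have step: "runs m B hash_step_prog s2 3
        (\<lambda>s'. same_except {hash_cell, ypow_cell, bits_cell} s2 s' \<and>
          imem s' hash_cell = hash_partial i y v (Suc j) \<and>
          imem s' ypow_cell = y ^ j mod q * y mod q \<and> imem s' bits_cell = i div 2 ^ j div 2)"
      using runs_hash_step_prog[OF _ _ _ _ s2, of m B] hash_step_bounds[OF iyv j] power_less_B[OF j, of v]
        word_bounds(1,2) param_bounds(9) s2'(2,3) iyv(2,3)
      by (simp add: hash_partial_Suc)
    show "runs m B hash_step_prog s2 3
        (\<lambda>s''. imem s'' j_cell = j \<and> hash_inv s i y v (Suc j) (s''\<lparr>imem := (imem s'')(j_cell := Suc j)\<rparr>))"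
    proof (rule runs_weaken[OF step order_refl])
      fix s3 assume s3: "same_except {hash_cell, ypow_cell, bits_cell} s2 s3 \<and>
        imem s3 hash_cell = hash_partial i y v (Suc j) \<and>
        imem s3 ypow_cell = y ^ j mod q * y mod q \<and> imem s3 bits_cell = i div 2 ^ j div 2"
      then have "same_except {hash_cell..u_cell} s s3" using s2'(4) by (auto elim: same_except_trans)
      moreover have "imem s3 j_cell = j" using s3 s2'(1) by (simp add: same_except_def)
      moreover have "imem s3 ypow_cell = y ^ Suc j mod q" using s3 by (simp add: mod_mult_right_eq mult.commute)
      moreover have "imem s3 bits_cell = i div 2 ^ Suc j" using s3 by (simp add: mult.commute[of 2] div_mult2_eq)
      ultimately show "imem s3 j_cell = j \<and> hash_inv s i y v (Suc j) (s3\<lparr>imem := (imem s3)(j_cell := Suc j)\<rparr>)"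
        using s3 unfolding hash_inv_def by (simp add: same_except_def del: power_Suc)
    qed
  qed (use iyv j in auto)
qed

lemma runs_hash_prog:
  assumes s: "imem s i_cell = i" "imem s L_cell = L" "imem s q_cell = q" "imem s y_cell = y" "imem s v_cell = v"
    and iyv: "i < n" "y < q" "v < r"
  shows "runs m B hash_prog s (L * (3 * r + 8) + 5)
    (\<lambda>s'. same_except {hash_cell..u_cell} s s' \<and> imem s' hash_cell = hash i y v)"
proof -
  have iB: "i < B" using iyv param_bounds by auto
  show ?thesis unfolding hash_prog_def
  proof (intro runs_IAssign_Seq
      runs_for_loop[where I = "hash_inv s i y v", OF _ _ _ _ _ _ _ _ runs_hash_iteration[OF s(3-5) iyv]])
    show "imem s' j_cell = j \<and> imem s' L_cell = L" if "hash_inv s i y v j s'" for j s'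
      using that s by (simp add: hash_inv_def same_except_def)
  qed (use s iB q_gt_1 word_bounds(1,2) param_bounds in
    \<open>auto simp: hash_inv_def hash_partial_0 hash_def intro!: same_except_intros\<close>)
qed

definition bucket_time :: nat where
  "bucket_time = r * (L * (3 * r + 8) + 8) + 3"

lemma runs_bucket_prog:
  assumes s: "params_loaded s" "imem s i_cell = i" "imem s y_cell = y" and iy: "i < n" "y < q"
  shows "runs m B bucket_prog s bucket_time
    (\<lambda>s'. same_except ({bucket_cell..u_cell} - {tmp_cell}) s s' \<and> imem s' bucket_cell = bucket i y)"
proof -
  let ?A = "{bucket_cell..u_cell} - {tmp_cell}"
  define I where "I v s' \<longleftrightarrow> same_except ?A s s' \<and>
    imem s' bucket_cell = bucket_upto i y v \<and> imem s' v_cell = v" for v s'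
  have yB: "y < B" using iy param_bounds by simp
  show ?thesis unfolding bucket_prog_def
  proof (intro runs_IAssign_Seq runs_for_loop[where I = I and N = r and Tb = "L * (3 * r + 8) + 6"])
    fix v s' assume v: "v < r" and I: "I v s'"
    have s': "imem s' i_cell = i" "imem s' L_cell = L" "imem s' q_cell = q" "imem s' y_cell = y" "imem s' v_cell = v"
      using I s by (auto simp: I_def same_except_def params_loaded_def)
    have "bucket_upto i y (Suc v) < M" "bucket_upto i y v < M" "hash i y v < q"
      using iy v by (auto intro!: bucket_upto_less_M hash_less simp del: bucket_upto.simps)
    then have small: "bucket_upto i y v * q + hash i y v < B" "bucket_upto i y v < B" "hash i y v < B"
      using param_bounds by auto
    let ?Q = "\<lambda>s''. imem s'' v_cell = v \<and> I (Suc v) (s''\<lparr>imem := (imem s'')(v_cell := Suc v)\<rparr>)"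
    show "runs m B (hash_prog ;; bucket_cell ::= reg bucket_cell \<otimes> reg q_cell \<oplus> reg hash_cell) s'
      (L * (3 * r + 8) + 6) ?Q"
    proof (rule runs_Seq[OF runs_hash_prog[OF s' iy v]])
      fix s2 assume hash: "same_except {hash_cell..u_cell} s' s2 \<and> imem s2 hash_cell = hash i y v"
      then have s2: "imem s2 q_cell = q" "imem s2 bucket_cell = bucket_upto i y v" "imem s2 v_cell = v"
        "same_except ?A s s2"
        using I s by (auto simp: I_def same_except_def params_loaded_def)
      show "runs m B (bucket_cell ::= reg bucket_cell \<otimes> reg q_cell \<oplus> reg hash_cell) s2 1 ?Q"
        using s2 hash small word_bounds param_bounds
        by (intro runs_IAssign) (auto simp: I_def intro!: same_except_intros)
    qed simp
  next
    show "imem s' v_cell = j \<and> imem s' r_cell = r" if "I j s'" for j s'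
      using that s by (simp add: I_def params_loaded_def same_except_def)
    show "(r - 0) * (L * (3 * r + 8) + 6 + 2) + 2 \<le> bucket_time - 1" by (simp add: bucket_time_def)
  qed (use s yB word_bounds(1,2) param_bounds in
    \<open>auto simp: I_def bucket_def bucket_time_def intro!: same_except_intros\<close>)
qed

definition update_time :: nat where
  "update_time = setup_time + q * (bucket_time + 3) + 3"

definition update_inv :: "state \<Rightarrow> nat \<Rightarrow> nat \<Rightarrow> state \<Rightarrow> bool" where
  "update_inv s i k s' \<longleftrightarrow> params_loaded s' \<and> imem s' n_cell = n \<and> imem s' i_cell = i \<and> imem s' y_cell = k \<and>
     rmem s' \<epsilon>_rcell = \<epsilon> \<and> rmem s' \<Delta>_rcell = rmem s \<Delta>_rcell \<and>
     rmem s' total_rcell = rmem s total_rcell + rmem s \<Delta>_rcell \<and>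
     (\<forall>p. rmem s' (load_rcell + p) = rmem s (load_rcell + p) + deposit i (rmem s \<Delta>_rcell) k p)"

lemma runs_update_iteration:
  assumes i: "i < n" and k: "1 \<le> k" "k < q" and I: "update_inv s i k s'"
  shows "runs m B (bucket_prog ;; deposit_prog) s' (bucket_time + 1)
    (\<lambda>s''. imem s'' y_cell = k \<and> update_inv s i (Suc k) (s''\<lparr>imem := (imem s'')(y_cell := Suc k)\<rparr>))"
proof (rule runs_Seq[OF runs_bucket_prog[OF _ _ _ i k(2)]])
  fix s2 assume bucket: "same_except ({bucket_cell..u_cell} - {tmp_cell}) s' s2 \<and> imem s2 bucket_cell = bucket i k"
  then have s2: "imem s2 bucket_cell = bucket i k" "imem s2 y_cell = k" "rmem s2 \<Delta>_rcell = rmem s \<Delta>_rcell"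
    using I by (simp_all add: update_inv_def same_except_def)
  have "bucket i k < M" using k(2) by (rule bucket_less_M)
  then have small: "load_rcell + bucket i k < B" "load_rcell + bucket i k < m" "bucket i k < B"
    using word_bounds by auto
  have "update_inv s i (Suc k)
      (s2\<lparr>rmem := (rmem s2)(load_rcell + bucket i k := rmem s2 (load_rcell + bucket i k) + rmem s \<Delta>_rcell),
        imem := (imem s2)(y_cell := Suc k)\<rparr>)"
    using I bucket deposit_Suc[OF k(1)] by (simp add: update_inv_def same_except_def params_loaded_def)
  then show "runs m B deposit_prog s2 1
      (\<lambda>s''. imem s'' y_cell = k \<and> update_inv s i (Suc k) (s''\<lparr>imem := (imem s'')(y_cell := Suc k)\<rparr>))"
    unfolding deposit_prog_def using s2 small word_bounds(1,2) by (intro runs_RAssign) simp_all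
qed (use I in \<open>auto simp: update_inv_def\<close>)

lemma runs_update_prog:
  assumes s: "imem s n_cell = n" "rmem s \<epsilon>_rcell = \<epsilon>" "imem s i_cell = i" and i: "i < n"
  shows "runs m B (update_prog a b C0) s update_time
     (\<lambda>s'. imem s' n_cell = n \<and> rmem s' \<epsilon>_rcell = \<epsilon> \<and>
       rmem s' total_rcell = rmem s total_rcell + rmem s \<Delta>_rcell \<and>
       (\<forall>p. rmem s' (load_rcell + p) = rmem s (load_rcell + p) + deposit i (rmem s \<Delta>_rcell) q p))"
    (is "runs m B _ s _ ?Q")
proof -
  have loop: "runs m B (for_loop y_cell 1 q_cell (bucket_prog ;; deposit_prog)) s' (q * (bucket_time + 3) + 2) ?Q"
    if init: "update_inv s i 1 (s'\<lparr>imem := (imem s')(y_cell := 1)\<rparr>)" for s'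
  proof (rule runs_for_loop[where N = q, OF _ _ _ _ _ _ init _ runs_update_iteration[OF i]])
    have "(q - 1) * (bucket_time + 1 + 2) \<le> q * (bucket_time + 3)" by (intro mult_le_mono) auto
    then show "(q - 1) * (bucket_time + 1 + 2) + 2 \<le> q * (bucket_time + 3) + 2" by linarith
  qed (use q_gt_1 word_bounds(1,2) param_bounds(9) in \<open>auto simp: update_inv_def params_loaded_def\<close>)
  show ?thesis unfolding update_prog_def
  proof (rule runs_Seq[OF runs_setup_prog[OF s(1,2)]])
    fix s' assume s': "same_except {2..11} s s' \<and> params_loaded s'"
    show "runs m B (RAssign (INum total_rcell) (RAdd (RCell (INum total_rcell)) (RCell (INum \<Delta>_rcell))) ;;
        for_loop y_cell 1 q_cell (bucket_prog ;; deposit_prog)) s' (q * (bucket_time + 3) + 3) ?Q"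
      using s s' word_bounds(1,2)
      by (intro runs_RAssign_Seq runs_weaken[OF loop])
        (auto simp: update_inv_def same_except_def params_loaded_def deposit_Suc_0)
  qed (simp add: update_time_def)
qed

definition passes :: "state \<Rightarrow> nat \<Rightarrow> nat \<Rightarrow> bool" where
  "passes s k i \<longleftrightarrow> (\<forall>y\<in>{1..<k}. \<epsilon> * rmem s total_rcell \<le> rmem s (load_rcell + bucket i y))"

lemma passes_Suc:
  "1 \<le> k \<Longrightarrow> passes s (Suc k) i \<longleftrightarrow>
    passes s k i \<and> \<epsilon> * rmem s total_rcell \<le> rmem s (load_rcell + bucket i k)"
  unfolding passes_def by (auto simp: less_Suc_eq)

definition test_time :: nat where
  "test_time = q * (bucket_time + 4) + 3"

lemma runs_test_prog:
  assumes s: "params_loaded s" "imem s i_cell = i" "rmem s \<epsilon>_rcell = \<epsilon>" and i: "i < n"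
  shows "runs m B test_prog s test_time
     (\<lambda>s'. same_except ({y_cell..pass_cell} - {tmp_cell}) s s' \<and>
       imem s' pass_cell = (if passes s q i then 1 else 0))"
proof -
  let ?A = "{y_cell..pass_cell} - {tmp_cell}"
  define I where "I k s' \<longleftrightarrow> same_except ?A s s' \<and> imem s' y_cell = k \<and>
    imem s' pass_cell = (if passes s k i then 1 else 0)" for k s'
  have body: "runs m B (bucket_prog ;; compare_prog) s' (bucket_time + 2)
      (\<lambda>s''. imem s'' y_cell = k \<and> I (Suc k) (s''\<lparr>imem := (imem s'')(y_cell := Suc k)\<rparr>))"
    if k: "1 \<le> k" "k < q" and I: "I k s'" for k s'
  proof (rule runs_Seq[OF runs_bucket_prog[OF _ _ _ i k(2)]])
    fix s2 assume bucket: "same_except ({bucket_cell..u_cell} - {tmp_cell}) s' s2 \<and> imem s2 bucket_cell = bucket i k"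
    have "bucket i k < M" using k(2) by (rule bucket_less_M)
    then have small: "load_rcell + bucket i k < B" "load_rcell + bucket i k < m" "bucket i k < B"
      using word_bounds by auto
    have s2: "rmem s2 = rmem s" "same_except ?A s s2" "imem s2 y_cell = k"
      "imem s2 pass_cell = (if passes s k i then 1 else 0)"
      using bucket I by (auto simp: I_def same_except_def)
    show "runs m B compare_prog s2 2
        (\<lambda>s''. imem s'' y_cell = k \<and> I (Suc k) (s''\<lparr>imem := (imem s'')(y_cell := Suc k)\<rparr>))"
      unfolding compare_prog_def using s2 bucket small word_bounds(1,2) s(3) passes_Suc[OF k(1), of s i]
      by (intro runs_Cond runs_IAssign runs_Skip) (auto simp: I_def intro!: same_except_intros)
  qed (use I s in \<open>auto simp: I_def same_except_def params_loaded_def\<close>)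
  show ?thesis unfolding test_prog_def test_time_def
  proof (intro runs_IAssign_Seq runs_for_loop[where I = I and N = q, OF _ _ _ _ _ _ _ _ body])
    show "imem s' y_cell = k \<and> imem s' q_cell = q" if "I k s'" for k s'
      using that s by (simp add: I_def same_except_def params_loaded_def)
    have "(q - 1) * (bucket_time + 2 + 2) \<le> q * (bucket_time + 4)" by (intro mult_le_mono) auto
    then show "(q - 1) * (bucket_time + 2 + 2) + 2 \<le> q * (bucket_time + 4) + 3 - 1" by linarith
  qed (use q_gt_1 word_bounds(1,2) param_bounds in \<open>auto simp: I_def passes_def intro!: same_except_intros\<close>)
qed

definition query_time :: nat where
  "query_time = setup_time + n * (test_time + 4) + 2"

lemma runs_query_prog:
  assumes s: "imem s n_cell = n" "rmem s \<epsilon>_rcell = \<epsilon>" "out s = []"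
  shows "runs m B (query_prog a b C0) s query_time
     (\<lambda>s'. out s' = filter (\<lambda>i. 0 < rmem s total_rcell \<and> passes s q i) [0..<n])"
proof -
  define P where "P i \<longleftrightarrow> 0 < rmem s total_rcell \<and> passes s q i" for i
  define I where "I k s' \<longleftrightarrow> params_loaded s' \<and> imem s' n_cell = n \<and> imem s' i_cell = k \<and>
     rmem s' = rmem s \<and> out s' = filter P [0..<k]" for k s'
  have body: "runs m B (test_prog ;; report_prog) s' (test_time + 2)
      (\<lambda>s''. imem s'' i_cell = k \<and> I (Suc k) (s''\<lparr>imem := (imem s'')(i_cell := Suc k)\<rparr>))"
    if k: "k < n" and I: "I k s'" for k s'
  proof (rule runs_Seq[OF runs_test_prog[OF _ _ _ k]])
    fix s2 assume test: "same_except ({y_cell..pass_cell} - {tmp_cell}) s' s2 \<and>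
      imem s2 pass_cell = (if passes s' q k then 1 else 0)"
    have "passes s' q k = passes s q k" using I by (simp add: passes_def I_def)
    then have s2: "imem s2 n_cell = n" "imem s2 i_cell = k" "params_loaded s2" "rmem s2 = rmem s"
      "out s2 = filter P [0..<k]" "imem s2 pass_cell = (if passes s q k then 1 else 0)"
      using I test by (auto simp: I_def same_except_def params_loaded_def)
    show "runs m B report_prog s2 2
        (\<lambda>s''. imem s'' i_cell = k \<and> I (Suc k) (s''\<lparr>imem := (imem s'')(i_cell := Suc k)\<rparr>))"
      unfolding report_prog_def using s2 k word_bounds(1,2) param_bounds(1)
      by (intro runs_Cond runs_Emit runs_Skip)
        (auto simp: I_def P_def params_loaded_def split: if_splits)
  qed (use I s in \<open>auto simp: I_def\<close>)
  have "runs m B (query_prog a b C0) s query_time (\<lambda>s'. out s' = filter P [0..<n])"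
    unfolding query_prog_def
  proof (rule runs_Seq[OF runs_setup_prog[OF s(1,2)]])
    fix s' assume s': "same_except {2..11} s s' \<and> params_loaded s'"
    show "runs m B (for_loop i_cell 0 n_cell (test_prog ;; report_prog)) s' (n * (test_time + 4) + 2)
        (\<lambda>s'. out s' = filter P [0..<n])"
    proof (rule runs_for_loop[where I = I and N = n, OF _ _ _ _ _ _ _ _ body])
      show "(n - 0) * (test_time + 2 + 2) + 2 \<le> n * (test_time + 4) + 2" by (simp add: algebra_simps)
    qed (use s s' word_bounds(1,2) param_bounds(1) in \<open>auto simp: I_def same_except_def params_loaded_def\<close>)
  qed (simp add: query_time_def)
  then show ?thesis unfolding P_def .
qed

definition represents :: "state \<Rightarrow> (nat \<Rightarrow> real) \<Rightarrow> bool" where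
  "represents s x \<longleftrightarrow> imem s n_cell = n \<and> rmem s \<epsilon>_rcell = \<epsilon> \<and>
     rmem s total_rcell = (\<Sum>j<n. x j) \<and> (\<forall>p. rmem s (load_rcell + p) = load x p)"

lemma represents_initial_state: "represents (initial_state n \<epsilon> \<alpha>) (stream_vec [])"
  by (auto simp: represents_def initial_state_def load_def deposit_zero stream_vec_def)

lemma update_represents:
  assumes "represents s (stream_vec \<sigma>)" "i < n"
  shows "runs m B (update_prog a b C0) (load_update i \<Delta> s) update_time
    (\<lambda>s'. represents s' (stream_vec (\<sigma> @ [(i, \<Delta>)])))"
proof (rule runs_weaken[OF runs_update_prog[OF _ _ _ assms(2)] order_refl])
  let ?s = "load_update i \<Delta> s"
  have loaded: "rmem ?s \<Delta>_rcell = \<Delta>" "rmem ?s total_rcell = rmem s total_rcell"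
    "rmem ?s (load_rcell + p) = rmem s (load_rcell + p)" for p
    by (simp_all add: load_update_def)
  fix s' :: state
  assume "imem s' n_cell = n \<and> rmem s' \<epsilon>_rcell = \<epsilon> \<and>
    rmem s' total_rcell = rmem ?s total_rcell + rmem ?s \<Delta>_rcell \<and>
    (\<forall>p. rmem s' (load_rcell + p) = rmem ?s (load_rcell + p) + deposit i (rmem ?s \<Delta>_rcell) q p)"
  then show "represents s' (stream_vec (\<sigma> @ [(i, \<Delta>)]))"
    using assms unfolding loaded
    by (simp add: represents_def load_stream_vec_snoc stream_vec_snoc sum.distrib)
qed (use assms in \<open>auto simp: load_update_def represents_def\<close>)

lemma processed_update_prog:
  assumes "strict_turnstile n \<sigma>" "real update_time \<le> T"
  shows "\<exists>s. processed m B T (update_prog a b C0) (initial_state n \<epsilon> \<alpha>) \<sigma> s \<and> represents s (stream_vec \<sigma>)"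
  using assms(1)
proof (induction \<sigma> rule: rev_induct)
  case Nil
  show ?case using represents_initial_state processed_Nil by blast
next
  case (snoc u \<sigma>)
  obtain i \<Delta> where u: "u = (i, \<Delta>)" by (cases u)
  note turnstile = strict_turnstile_snocD[OF snoc.prems[unfolded u]]
  obtain s where s: "processed m B T (update_prog a b C0) (initial_state n \<epsilon> \<alpha>) \<sigma> s" "represents s (stream_vec \<sigma>)"
    using snoc.IH turnstile(1) by blast
  obtain t s' where s': "exec m B (update_prog a b C0) (load_update i \<Delta> s) t s'" "t \<le> update_time"
    "represents s' (stream_vec (\<sigma> @ [(i, \<Delta>)]))"
    using update_represents[OF s(2) turnstile(2)] by (rule runsE)
  have "real t \<le> T" using s'(2) assms(2) by simp
  then show ?case unfolding u using processed_snoc[OF s(1) s'(1)] s'(3) by blast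
qed

lemma query_result_query_prog:
  assumes "represents s x" "real query_time \<le> T"
  shows "query_result m B T (query_prog a b C0) s (filter (\<lambda>i. 0 < (\<Sum>j<n. x j) \<and> i \<in> candidates x) [0..<n])"
proof -
  let ?s = "s\<lparr>out := []\<rparr>"
  have s: "imem ?s n_cell = n" "rmem ?s \<epsilon>_rcell = \<epsilon>" "out ?s = []"
    using assms(1) by (auto simp: represents_def)
  have "0 < rmem ?s total_rcell \<and> passes ?s q i \<longleftrightarrow> 0 < (\<Sum>j<n. x j) \<and> i \<in> candidates x" if "i < n" for i
    using that assms(1) by (simp add: passes_def candidates_def represents_def)
  then have "filter (\<lambda>i. 0 < rmem ?s total_rcell \<and> passes ?s q i) [0..<n] =
      filter (\<lambda>i. 0 < (\<Sum>j<n. x j) \<and> i \<in> candidates x) [0..<n]"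
    by (intro filter_cong) auto
  moreover obtain t s' where "exec m B (query_prog a b C0) ?s t s'" "t \<le> query_time"
    "out s' = filter (\<lambda>i. 0 < rmem ?s total_rcell \<and> passes ?s q i) [0..<n]"
    using runs_query_prog[OF s] by (rule runsE)
  ultimately show ?thesis unfolding query_result_def using assms(2)
    by (metis of_nat_mono order_trans)
qed

end

section \<open>Space, time and word size\<close>

lemma exponent_le_ln:
  assumes "2 ^ (l - 1) < y" "2 \<le> y" shows "real l \<le> 3 * ln y"
proof -
  have ln2: "ln 2 \<ge> (2 / 3 :: real)" by (rule ln2_ge_two_thirds)
  have "ln (2 ^ (l - 1)) < ln y" using assms by (subst ln_less_cancel_iff) auto
  then have "real (l - 1) * ln 2 < ln y" by (simp add: ln_realpow)
  moreover have "real (l - 1) * (2 / 3) \<le> real (l - 1) * ln 2" using ln2 by (intro mult_left_mono) auto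
  moreover have "ln 2 \<le> ln y" using assms(2) by simp
  moreover have "real l \<le> real (l - 1) + 1" by simp
  ultimately show ?thesis using ln2 by linarith
qed

definition space_const :: "nat \<Rightarrow> nat \<Rightarrow> real \<Rightarrow> real" where
  "space_const a C0 \<alpha> = 8 * 2 powr (1 + \<alpha>) * (288 * real a * real C0) powr (2 + 2 / \<alpha>) +
     40 / (ln 2 * ln 2) powr (2 + 2 / \<alpha>)"

definition time_const :: "nat \<Rightarrow> nat \<Rightarrow> nat \<Rightarrow> real" where
  "time_const a b C0 = 100 * (2 * (288 * real a * real C0) ^ (b + 1)) ^ 4"

definition bucket_exponent :: "nat \<Rightarrow> nat \<Rightarrow> nat \<Rightarrow> nat" where
  "bucket_exponent a b C0 = 2 * (a + 1) + (16 * a * C0 + 3) * (b + 2) + 2"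

definition word_exponent :: "nat \<Rightarrow> nat \<Rightarrow> nat \<Rightarrow> nat" where
  "word_exponent a b C0 = 2 * bucket_exponent a b C0 + a + b + 16 * a * C0 + 11"

context sketch
begin

lemma r_le: "r \<le> 2 * a * \<kappa>"
proof -
  have "r \<le> a * \<kappa> + 1" unfolding r_def by simp
  moreover have "1 \<le> a * \<kappa>" using mult_le_mono[OF ab(1) \<kappa>_pos] by simp
  moreover have "2 * a * \<kappa> = a * \<kappa> + a * \<kappa>" by simp
  ultimately show ?thesis by linarith
qed

lemma q_le: "q \<le> 2 ^ (\<mu> + (g - 1))"
proof -
  have "4 * r * d * L \<ge> 1" using r_pos d_ge L_pos by (simp add: Suc_le_eq)
  then obtain p where p: "prime p" "4 * r * d * L < p" "p \<le> C0 * (4 * r * d * L)" using prime_gap by blast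
  have "q \<le> p" unfolding q_def using p by (intro next_prime_le) auto
  also note p(3)
  also have "C0 * (4 * r * d * L) \<le> C0 * (4 * (2 * a * \<kappa>) * d * L)"
    using r_le by (intro mult_le_mono) auto
  also have "d = 2 * 2 ^ (g - 1)" unfolding d_def using g_pos by (simp add: power_eq_if)
  also have "C0 * (4 * (2 * a * \<kappa>) * (2 * 2 ^ (g - 1)) * L) = S * 2 ^ (g - 1)"
    unfolding S_def by simp
  also have "\<dots> \<le> 2 ^ \<mu> * 2 ^ (g - 1)" by (intro mult_le_mono1 two_power_\<mu>)
  finally show ?thesis by (simp add: power_add)
qed

lemma g_r_le: "(g - 1) * r \<le> \<kappa> + 1"
  using less_g[of "g - 1"] g_pos by simp

lemma g_le: "a * (g - 1) \<le> b * \<mu> + a"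
proof -
  have "a * ((g - 1) * r) \<le> a * (\<kappa> + 1)" using g_r_le by (rule mult_le_mono2)
  moreover have "a * \<kappa> < r * (b * \<mu>)"
    unfolding r_def using ab \<mu>_pos dividend_less_div_times[of "b * \<mu>" "a * \<kappa>"] by simp
  moreover have "a \<le> r * a" using r_pos by simp
  moreover have "a * ((g - 1) * r) = r * (a * (g - 1))" by (simp only: mult_ac)
  ultimately have "r * (a * (g - 1)) \<le> r * (b * \<mu> + a)"
    unfolding add_mult_distrib2 by linarith
  then show ?thesis using r_pos by simp
qed

lemma r_\<mu>_le: "b * ((r - 1) * \<mu>) \<le> a * \<kappa>"
proof -
  have "(r - 1) * (b * \<mu>) \<le> a * \<kappa>" unfolding r_def by simp
  then show ?thesis by (simp only: mult_ac)
qed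

lemma M_le: "M \<le> 2 ^ ((r - 1) * \<mu> + 2 * \<mu> + (g - 1) * r + (g - 1))"
proof -
  obtain r' where "r = Suc r'" using r_pos by (cases r) auto
  then have "(\<mu> + x) * (r + 1) = (r - 1) * \<mu> + 2 * \<mu> + x * r + x" for x
    by (simp add: algebra_simps)
  moreover have "M \<le> 2 ^ ((\<mu> + (g - 1)) * (r + 1))"
    unfolding M_def power_mult by (rule power_mono[OF q_le]) simp
  ultimately show ?thesis by (simp only:)
qed

lemma two_power_\<kappa>_le: "2 ^ \<kappa> \<le> 2 * n" "2 ^ \<kappa> * \<epsilon> \<le> 2"
proof -
  have "2 ^ (\<kappa> - 1) < n" "2 ^ (\<kappa> - 1) * \<epsilon> < 1" using less_\<kappa>[of "\<kappa> - 1"] \<kappa>_pos by auto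
  then show "2 ^ \<kappa> \<le> 2 * n" "2 ^ \<kappa> * \<epsilon> \<le> 2" using \<kappa>_pos by (cases \<kappa>; auto)+
qed

lemma M_le_powr:
  "real M \<le> 4 * (2 ^ \<kappa>) powr (1 + a / b) * (2 ^ \<mu>) powr (2 + b / a)"
proof -
  have pos: "real a > 0" "real b > 0" using ab by auto
  have "real (b * ((r - 1) * \<mu>)) \<le> real (a * \<kappa>)" using r_\<mu>_le by (simp only: of_nat_le_iff)
  then have "real ((r - 1) * \<mu>) \<le> a / b * \<kappa>" using pos by (simp add: field_simps)
  moreover have "real (a * (g - 1)) \<le> real (b * \<mu> + a)" using g_le by (simp only: of_nat_le_iff)
  then have "real (g - 1) \<le> b / a * \<mu> + 1" using pos by (simp add: field_simps)
  moreover have "real ((g - 1) * r) \<le> \<kappa> + 1" using g_r_le by (metis of_nat_1 of_nat_add of_nat_le_iff)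
  ultimately have "real ((r - 1) * \<mu> + 2 * \<mu> + (g - 1) * r + (g - 1))
      \<le> a / b * \<kappa> + 2 * \<mu> + (\<kappa> + 1) + (b / a * \<mu> + 1)"
    unfolding of_nat_add by linarith
  also have "\<dots> = real \<kappa> * (1 + a / b) + real \<mu> * (2 + b / a) + 2" by (simp add: algebra_simps)
  finally have exponent: "real ((r - 1) * \<mu> + 2 * \<mu> + (g - 1) * r + (g - 1))
      \<le> real \<kappa> * (1 + a / b) + real \<mu> * (2 + b / a) + 2" .
  have "real M \<le> real (2 ^ ((r - 1) * \<mu> + 2 * \<mu> + (g - 1) * r + (g - 1)))"
    using M_le by (simp only: of_nat_le_iff)
  also have "\<dots> = 2 powr real ((r - 1) * \<mu> + 2 * \<mu> + (g - 1) * r + (g - 1))"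
    by (subst powr_realpow) simp_all
  also have "\<dots> \<le> 2 powr (real \<kappa> * (1 + a / b) + real \<mu> * (2 + b / a) + 2)"
    using exponent by (intro powr_mono) auto
  also have "\<dots> = 4 * (2 ^ \<kappa>) powr (1 + a / b) * (2 ^ \<mu>) powr (2 + b / a)"
    by (simp add: powr_add powr_powr[symmetric] powr_realpow)
  finally show ?thesis .
qed

lemma L_le_ln: "real L \<le> 3 * ln (real n)"
proof (rule exponent_le_ln)
  have "2 ^ (L - 1) < n" using two_power_less_n[of "L - 1"] L_pos by simp
  then show "2 ^ (L - 1) < real n" by (metis of_nat_less_iff of_nat_numeral of_nat_power)
qed (use n_ge in simp)

lemma \<kappa>_le_ln: "real \<kappa> \<le> 3 * ln (1 / \<epsilon>)"
proof (rule exponent_le_ln)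
  show "2 ^ (\<kappa> - 1) < 1 / \<epsilon>" using less_\<kappa>[of "\<kappa> - 1"] \<kappa>_pos eps by (simp add: pos_less_divide_eq)
qed (use eps in \<open>simp add: field_simps\<close>)

lemma two_power_\<mu>_le_ln: "(2::real) ^ \<mu> \<le> 288 * a * C0 * (ln (1 / \<epsilon>) * ln (real n))"
proof -
  have "real (2 ^ \<mu>) \<le> real (2 * S)" using two_power_\<mu>(2) by (rule of_nat_mono)
  also have "\<dots> = 32 * a * C0 * (real \<kappa> * real L)" by (simp add: S_def)
  also have "\<dots> \<le> 32 * a * C0 * ((3 * ln (1 / \<epsilon>)) * (3 * ln (real n)))"
    using L_le_ln \<kappa>_le_ln order_trans[OF of_nat_0_le_iff \<kappa>_le_ln]
    by (intro mult_left_mono mult_mono) auto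
  finally show ?thesis by simp
qed

lemma M_le_space:
  assumes \<alpha>: "\<alpha> / 2 \<le> a / b" "a / b \<le> \<alpha>"
  shows "real M \<le> (4 * 2 powr (1 + \<alpha>) * (288 * real a * real C0) powr (2 + 2 / \<alpha>)) *
     ((1 / \<epsilon>) powr (1 + \<alpha>) * (ln (1 / \<epsilon>) * ln (real n)) powr (2 + 2 / \<alpha>))"
proof -
  define X where "X = ln (1 / \<epsilon>) * ln (real n)"
  have pos: "real a > 0" "real b > 0" using ab by auto
  then have "real a / real b > 0" by simp
  then have \<alpha>_pos: "\<alpha> > 0" using \<alpha>(2) by linarith
  have ba: "b / a \<le> 2 / \<alpha>" using \<alpha>(1) pos \<alpha>_pos by (simp add: field_simps)
  have "(2::real) ^ \<kappa> \<le> 2 * (1 / \<epsilon>)" using two_power_\<kappa>_le(2) eps by (simp add: field_simps)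
  then have "(2 ^ \<kappa> :: real) powr (1 + \<alpha>) \<le> (2 * (1 / \<epsilon>)) powr (1 + \<alpha>)"
    using \<alpha>_pos by (intro powr_mono2) auto
  moreover have "(2 ^ \<kappa>) powr (1 + a / b) \<le> (2 ^ \<kappa> :: real) powr (1 + \<alpha>)"
    using \<alpha>(2) by (intro powr_mono) auto
  ultimately have \<kappa>_factor: "(2 ^ \<kappa>) powr (1 + a / b) \<le> 2 powr (1 + \<alpha>) * (1 / \<epsilon>) powr (1 + \<alpha>)"
    unfolding powr_mult by linarith
  have "(2 ^ \<mu> :: real) powr (2 + 2 / \<alpha>) \<le> (288 * real a * real C0 * X) powr (2 + 2 / \<alpha>)"
    using two_power_\<mu>_le_ln \<alpha>_pos by (intro powr_mono2) (auto simp: X_def)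
  moreover have "(2 ^ \<mu>) powr (2 + b / a) \<le> (2 ^ \<mu> :: real) powr (2 + 2 / \<alpha>)"
    using ba by (intro powr_mono) auto
  ultimately have \<mu>_factor:
    "(2 ^ \<mu>) powr (2 + b / a) \<le> (288 * real a * real C0) powr (2 + 2 / \<alpha>) * X powr (2 + 2 / \<alpha>)"
    unfolding powr_mult by linarith
  have "real M \<le> 4 * (2 ^ \<kappa>) powr (1 + a / b) * (2 ^ \<mu>) powr (2 + b / a)" by (rule M_le_powr)
  also have "\<dots> \<le> 4 * (2 powr (1 + \<alpha>) * (1 / \<epsilon>) powr (1 + \<alpha>)) *
      ((288 * real a * real C0) powr (2 + 2 / \<alpha>) * X powr (2 + 2 / \<alpha>))"
    using \<kappa>_factor \<mu>_factor by (intro mult_mono mult_left_mono) auto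
  finally show ?thesis unfolding X_def by (simp only: mult_ac)
qed

lemma space_le:
  assumes \<alpha>: "\<alpha> / 2 \<le> a / b" "a / b \<le> \<alpha>"
  shows "real (2 * (M + 20)) \<le> space_const a C0 \<alpha> *
    ((1 / \<epsilon>) powr (1 + \<alpha>) * (ln (1 / \<epsilon>) * ln (real n)) powr (2 + 2 / \<alpha>))"
proof -
  define R where "R = (1 / \<epsilon>) powr (1 + \<alpha>) * (ln (1 / \<epsilon>) * ln (real n)) powr (2 + 2 / \<alpha>)"
  define \<rho> where "\<rho> = (ln 2 * ln 2) powr (2 + 2 / \<alpha>)"
  have "real a / real b > 0" using ab by simp
  then have \<alpha>_pos: "\<alpha> > 0" using \<alpha>(2) by linarith
  have "ln 2 \<le> ln (1 / \<epsilon>)" using eps by (simp add: field_simps)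
  moreover have "0 \<le> ln (1 / \<epsilon>)" using eps by (intro ln_ge_zero) (simp add: field_simps)
  ultimately have "\<rho> \<le> (ln (1 / \<epsilon>) * ln (real n)) powr (2 + 2 / \<alpha>)"
    unfolding \<rho>_def using \<alpha>_pos n_ge by (intro powr_mono2 mult_mono) auto
  moreover have "1 \<le> (1 / \<epsilon>) powr (1 + \<alpha>)"
    using \<alpha>_pos eps by (intro ge_one_powr_ge_zero) (auto simp: field_simps)
  ultimately have "1 * \<rho> \<le> R" unfolding R_def by (intro mult_mono) (auto simp: \<rho>_def)
  then have "40 \<le> 40 / \<rho> * R" by (simp add: \<rho>_def field_simps)
  moreover have "real M \<le> (4 * 2 powr (1 + \<alpha>) * (288 * real a * real C0) powr (2 + 2 / \<alpha>)) * R"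
    unfolding R_def using \<alpha> by (rule M_le_space)
  ultimately show ?thesis
    unfolding space_const_def R_def[symmetric] \<rho>_def[symmetric] by (simp add: algebra_simps)
qed

definition param_max :: nat where
  "param_max = 2 * (32 * a * C0 * L ^ 2) ^ (b + 1)"

lemma two_S_le: "2 * S \<le> 32 * a * C0 * L ^ 2"
  unfolding S_def using \<kappa>_le_L by (simp add: power2_eq_square)

lemma g_le_\<mu>: "g - 1 \<le> b * \<mu> + 1"
proof -
  have "b * \<mu> + a \<le> a * (b * \<mu> + 1)" using ab by simp
  then have "a * (g - 1) \<le> a * (b * \<mu> + 1)" using g_le by linarith
  then show ?thesis using ab(1) by (simp only: mult_le_cancel1)
qed

lemma params_le_param_max:
  "q \<le> param_max" "r \<le> param_max" "L \<le> param_max" "\<kappa> \<le> param_max" "g \<le> param_max"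
  "\<mu> \<le> param_max" "1 \<le> param_max"
proof -
  have pow: "2 ^ \<mu> \<le> 32 * a * C0 * L ^ 2" using two_power_\<mu>(2) two_S_le by linarith
  have "q \<le> 2 ^ (\<mu> + (b * \<mu> + 1))"
    by (rule order_trans[OF q_le], rule power_increasing) (use g_le_\<mu> in auto)
  also have "\<dots> = 2 * (2 ^ \<mu>) ^ (b + 1)" by (simp add: power_add power_mult[symmetric] mult.commute)
  also have "\<dots> \<le> param_max" unfolding param_max_def using pow by (intro mult_le_mono2 power_mono) auto
  finally show q: "q \<le> param_max" .
  have "g < d" unfolding d_def by (rule less_exp)
  then show "r \<le> param_max" "L \<le> param_max" "\<kappa> \<le> param_max" "g \<le> param_max" "1 \<le> param_max"
    using params_less_q q \<kappa>_le_L q_gt_1 by linarith+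
  have "\<mu> < 2 ^ \<mu>" by (rule less_exp)
  also note pow
  also have "32 * a * C0 * L ^ 2 \<le> (32 * a * C0 * L ^ 2) ^ (b + 1)"
    using ab C0_ge L_pos by (intro self_le_power) (auto simp: Suc_le_eq)
  finally show "\<mu> \<le> param_max" unfolding param_max_def by simp
qed

lemma param_max_le_ln:
  "100 * real param_max ^ 4 \<le> time_const a b C0 * ln (real n) ^ (8 * (b + 1))"
proof -
  let ?c = "288 * real a * real C0"
  have "(real L) ^ 2 \<le> (3 * ln (real n)) ^ 2" using L_le_ln by (intro power_mono) auto
  then have "32 * a * C0 * (real L) ^ 2 \<le> 32 * a * C0 * (3 * ln (real n)) ^ 2" by (intro mult_left_mono) auto
  also have "\<dots> = ?c * ln (real n) ^ 2" by (simp add: power2_eq_square)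
  finally have "(32 * a * C0 * (real L) ^ 2) ^ (b + 1) \<le> (?c * ln (real n) ^ 2) ^ (b + 1)"
    by (rule power_mono) simp
  then have "real param_max \<le> 2 * (?c * ln (real n) ^ 2) ^ (b + 1)"
    unfolding param_max_def by simp
  also have "\<dots> = 2 * ?c ^ (b + 1) * ln (real n) ^ (2 * (b + 1))"
    unfolding power_mult by (subst power_mult_distrib) simp
  finally have "real param_max ^ 4 \<le> (2 * ?c ^ (b + 1) * ln (real n) ^ (2 * (b + 1))) ^ 4"
    by (rule power_mono) simp
  moreover have "(x * y ^ (2 * j)) ^ 4 = x ^ 4 * y ^ (8 * j)" for x y :: real and j
    by (simp add: power_mult_distrib flip: power_mult)
  ultimately have "real param_max ^ 4 \<le> (2 * ?c ^ (b + 1)) ^ 4 * ln (real n) ^ (8 * (b + 1))"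
    by (simp only:)
  then show ?thesis unfolding time_const_def by linarith
qed

lemma le_n_power: "x \<le> 2 ^ k \<Longrightarrow> x \<le> n ^ k"
  using power_mono[of 2 n k] n_ge by simp

lemma self_le_n_power: "x \<le> n ^ x"
  by (rule le_n_power) (simp add: less_imp_le less_exp)

lemma two_power_params_le_n_power: "2 ^ \<kappa> \<le> n ^ 2" "2 ^ \<mu> \<le> n ^ (16 * a * C0 + 3)"
proof -
  show "2 ^ \<kappa> \<le> n ^ 2"
    using order_trans[OF two_power_\<kappa>_le(1) mult_le_mono1[OF n_ge, of n]] by (simp only: power2_eq_square)
  have "2 ^ \<mu> \<le> 2 * (16 * a * C0 * L * \<kappa>)" using two_power_\<mu>(2) by (simp add: S_def)
  also have "\<dots> \<le> n * (n ^ (16 * a * C0) * n * n)"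
    using n_ge self_le_n_power L_le_n \<kappa>_le_L by (intro mult_le_mono) auto
  finally show "2 ^ \<mu> \<le> n ^ (16 * a * C0 + 3)" by (simp add: power_add power3_eq_cube mult_ac)
qed

lemma M_le_n_power: "M \<le> n ^ bucket_exponent a b C0"
proof -
  have "(r - 1) * \<mu> \<le> b * ((r - 1) * \<mu>)" using ab by simp
  then have "(r - 1) * \<mu> + 2 * \<mu> + (g - 1) * r + (g - 1) \<le> a * \<kappa> + 2 * \<mu> + (\<kappa> + 1) + (b * \<mu> + 1)"
    using r_\<mu>_le g_r_le g_le_\<mu> by linarith
  also have "\<dots> = \<kappa> * (a + 1) + \<mu> * (b + 2) + 2" by (simp add: algebra_simps)
  finally have "M \<le> 2 ^ (\<kappa> * (a + 1) + \<mu> * (b + 2) + 2)"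
    by (intro order_trans[OF M_le] power_increasing) auto
  also have "\<dots> = (2 ^ \<kappa>) ^ (a + 1) * (2 ^ \<mu>) ^ (b + 2) * 2 ^ 2" by (simp only: power_add power_mult)
  also have "\<dots> \<le> (n ^ 2) ^ (a + 1) * (n ^ (16 * a * C0 + 3)) ^ (b + 2) * n ^ 2"
    using two_power_params_le_n_power n_ge by (intro mult_le_mono power_mono) auto
  also have "\<dots> = n ^ bucket_exponent a b C0"
    by (simp only: bucket_exponent_def flip: power_mult power_add)
  finally show ?thesis .
qed

lemma word_bound:
  "2 * n + 2 * S + a * \<kappa> + b * \<mu> + 2 * (M * q) + 100 < n ^ word_exponent a b C0"
proof -
  let ?w = "bucket_exponent a b C0"
  define W where "W = 2 * ?w + a + b + 16 * a * C0 + 7"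
  have le_W: "x \<le> n ^ W" if "x \<le> n ^ i" "i \<le> W" for x i
    using that power_increasing[of i W n] n_ge by linarith
  have "2 * n \<le> n ^ 2" using n_ge by (simp add: power2_eq_square)
  then have "2 * n \<le> n ^ W" by (rule le_W) (simp add: W_def)
  moreover have "S \<le> n ^ (16 * a * C0 + 3)"
    using two_power_\<mu>(1) two_power_params_le_n_power(2) by linarith
  then have "S \<le> n ^ W" by (rule le_W) (simp add: W_def)
  moreover have "a * \<kappa> \<le> n ^ a * n ^ 1"
    using self_le_n_power \<kappa>_le_L L_le_n by (intro mult_le_mono) auto
  then have "a * \<kappa> \<le> n ^ W"
    unfolding power_add[symmetric] by (rule le_W) (simp add: W_def bucket_exponent_def)
  moreover have "\<mu> \<le> n ^ (16 * a * C0 + 3)"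
    using two_power_params_le_n_power(2) less_exp[of \<mu>] by linarith
  then have "b * \<mu> \<le> n ^ b * n ^ (16 * a * C0 + 3)"
    using self_le_n_power by (intro mult_le_mono) auto
  then have "b * \<mu> \<le> n ^ W" unfolding power_add[symmetric] by (rule le_W) (simp add: W_def)
  moreover have "M * q \<le> n ^ ?w * n ^ ?w"
    using M_le_n_power q_le_M by (intro mult_le_mono) auto
  then have "M * q \<le> n ^ W" unfolding power_add[symmetric] by (rule le_W) (simp add: W_def)
  moreover have "100 \<le> n ^ 7" by (rule le_n_power) simp
  then have "100 \<le> n ^ W" by (rule le_W) (simp add: W_def)
  ultimately have "2 * n + 2 * S + a * \<kappa> + b * \<mu> + 2 * (M * q) + 100 < n ^ W * 2 ^ 4" by simp
  also have "\<dots> \<le> n ^ W * n ^ 4" using power_mono[OF n_ge, of 4] by (intro mult_le_mono2) simp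
  also have "\<dots> = n ^ (W + 4)" by (simp only: power_add)
  also have "W + 4 = word_exponent a b C0" by (simp add: W_def word_exponent_def)
  finally show ?thesis .
qed

end

context sketch_machine
begin

lemma param_max_powers_le:
  "param_max \<le> param_max ^ 4" "param_max ^ 2 \<le> param_max ^ 4" "param_max ^ 3 \<le> param_max ^ 4" "1 \<le> param_max ^ 4"
  using power_increasing[of _ 4 param_max] params_le_param_max(7) by (auto intro: self_le_power)

lemma setup_time_le: "setup_time \<le> 40 * param_max ^ 4"
proof -
  have "q * (q + 1) + q \<le> param_max * (param_max + 1) + param_max"
    using params_le_param_max by (intro add_mono mult_mono) auto
  then have "setup_time \<le> 4 * param_max ^ 2 + 20 * param_max + 16"
    unfolding setup_time_def using params_le_param_max by (simp add: power2_eq_square algebra_simps)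
  then show ?thesis using param_max_powers_le by linarith
qed

lemma q_mult_bucket_time_le:
  assumes "c \<le> 4"
  shows "q * (bucket_time + c) \<le> 26 * param_max ^ 4"
proof -
  have "r * (L * (3 * r + 8) + 8) + (3 + c) \<le> param_max * (param_max * (3 * param_max + 8) + 8) + 7"
    using params_le_param_max assms by (intro add_mono mult_mono) auto
  then have "q * (bucket_time + c) \<le> param_max * (param_max * (param_max * (3 * param_max + 8) + 8) + 7)"
    unfolding bucket_time_def using params_le_param_max(1) by (intro mult_le_mono) simp_all
  also have "\<dots> = 3 * param_max ^ 4 + 8 * param_max ^ 3 + 8 * param_max ^ 2 + 7 * param_max"
    by (simp add: power2_eq_square power3_eq_cube power4_eq_xxxx algebra_simps)
  finally show ?thesis using param_max_powers_le by linarith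
qed

lemma update_time_le: "real update_time \<le> time_const a b C0 * ln (real n) ^ (8 * (b + 1))"
proof -
  have "update_time \<le> 100 * param_max ^ 4"
    unfolding update_time_def
    using setup_time_le q_mult_bucket_time_le[of 3] param_max_powers_le(4) by linarith
  then have "real update_time \<le> real (100 * param_max ^ 4)" by (rule of_nat_mono)
  then show ?thesis using param_max_le_ln by simp
qed

lemma query_time_le: "real query_time \<le> time_const a b C0 * (real n * ln (real n) ^ (8 * (b + 1)))"
proof -
  have "test_time + 4 \<le> 33 * param_max ^ 4"
    unfolding test_time_def using q_mult_bucket_time_le[of 4] param_max_powers_le(4) by linarith
  then have "n * (test_time + 4) \<le> n * (33 * param_max ^ 4)" by (rule mult_le_mono2)
  moreover have "1 * (42 * param_max ^ 4) \<le> n * (42 * param_max ^ 4)"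
    using n_ge by (intro mult_le_mono1) simp
  ultimately have "query_time \<le> n * (100 * param_max ^ 4)"
    unfolding query_time_def using setup_time_le param_max_powers_le(4) by linarith
  then have "real query_time \<le> real (n * (100 * param_max ^ 4))" by (rule of_nat_mono)
  also have "\<dots> = real n * (100 * real param_max ^ 4)" by simp
  also have "\<dots> \<le> real n * (time_const a b C0 * ln (real n) ^ (8 * (b + 1)))"
    using param_max_le_ln by (rule mult_left_mono) simp
  finally show ?thesis by (simp only: mult_ac)
qed

end

section \<open>Heavy hitters\<close>

definition finds_heavy_hitters ::
  "com \<Rightarrow> com \<Rightarrow> nat \<Rightarrow> real \<Rightarrow> real \<Rightarrow> nat \<Rightarrow> nat \<Rightarrow> real \<Rightarrow> real \<Rightarrow> real \<Rightarrow> bool" where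
  "finds_heavy_hitters upd qry n \<epsilon> \<alpha> m B T U K \<longleftrightarrow>
     (\<forall>\<sigma>. strict_turnstile n \<sigma> \<longrightarrow>
       (\<exists>s xs. processed m B T upd (initial_state n \<epsilon> \<alpha>) \<sigma> s \<and> query_result m B U qry s xs \<and>
         set xs \<subseteq> {..<n} \<and> real (length xs) \<le> K * (1 / \<epsilon>) \<and>
         (l1_norm n (stream_vec \<sigma>) > 0 \<longrightarrow> heavy_hitters n \<epsilon> (stream_vec \<sigma>) \<subseteq> set xs)))"

context sketch_machine
begin

lemma length_reported_le:
  assumes "\<And>i. i < n \<Longrightarrow> 0 \<le> x i"
  shows "real (length (filter (\<lambda>i. 0 < (\<Sum>j<n. x j) \<and> i \<in> candidates x) [0..<n])) \<le> 4 * (1 / \<epsilon>)"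
    (is "real (length ?xs) \<le> _")
proof (cases "0 < (\<Sum>j<n. x j)")
  case True
  have "length ?xs = card (set ?xs)" by (rule distinct_card[symmetric]) simp
  also have "set ?xs = candidates x" using True by (auto simp: candidates_def)
  finally have "length ?xs \<le> 2 * 2 ^ \<kappa>" using card_candidates_le[OF assms True] by simp
  then have "real (length ?xs) \<le> real (2 * 2 ^ \<kappa>)" by (simp only: of_nat_le_iff)
  also have "\<dots> \<le> 4 * (1 / \<epsilon>)" using two_power_\<kappa>_le(2) eps by (simp add: field_simps)
  finally show ?thesis .
qed (use eps in simp)

lemma sketch_finds_heavy_hitters:
  assumes "real update_time \<le> T" "real query_time \<le> U" "4 \<le> K"
  shows "finds_heavy_hitters (update_prog a b C0) (query_prog a b C0) n \<epsilon> \<alpha> m B T U K"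
  unfolding finds_heavy_hitters_def
proof (intro allI impI)
  fix \<sigma> assume turnstile: "strict_turnstile n \<sigma>"
  let ?x = "stream_vec \<sigma>"
  let ?xs = "filter (\<lambda>i. 0 < (\<Sum>j<n. ?x j) \<and> i \<in> candidates ?x) [0..<n]"
  have nonneg: "\<And>i. i < n \<Longrightarrow> 0 \<le> ?x i" using strict_turnstile_nonneg[OF turnstile] .
  obtain s where s: "processed m B T (update_prog a b C0) (initial_state n \<epsilon> \<alpha>) \<sigma> s" "represents s ?x"
    using processed_update_prog[OF turnstile assms(1)] by blast
  have "query_result m B U (query_prog a b C0) s ?xs"
    using s(2) assms(2) by (rule query_result_query_prog)
  moreover have "real (length ?xs) \<le> K * (1 / \<epsilon>)"
    using length_reported_le[of ?x, OF nonneg] mult_right_mono[OF assms(3), of "1 / \<epsilon>"] eps by linarith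
  moreover have "heavy_hitters n \<epsilon> ?x \<subseteq> set ?xs" if "l1_norm n ?x > 0"
    using that heavy_hitters_subset_candidates[OF nonneg] l1_norm_eq_sum[OF nonneg]
    by (auto simp: candidates_def)
  moreover have "set ?xs \<subseteq> {..<n}" by auto
  ultimately show "\<exists>s xs. processed m B T (update_prog a b C0) (initial_state n \<epsilon> \<alpha>) \<sigma> s \<and>
      query_result m B U (query_prog a b C0) s xs \<and> set xs \<subseteq> {..<n} \<and> real (length xs) \<le> K * (1 / \<epsilon>) \<and>
      (l1_norm n ?x > 0 \<longrightarrow> heavy_hitters n \<epsilon> ?x \<subseteq> set xs)"
    using s(1) by blast
qed

end

lemma exists_ratio_between:
  fixes x y :: real
  assumes "0 \<le> x" "x < y"
  obtains a b :: nat where "a \<ge> 1" "b \<ge> 1" "x \<le> a / b" "a / b \<le> y"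
proof -
  obtain z where z: "z \<in> \<rat>" "x < z" "z < y" using Rats_dense_in_real[OF assms(2)] by blast
  then obtain a b :: nat where "b \<noteq> 0" "\<bar>z\<bar> = a / b" by (blast elim: Rats_abs_nat_div_natE)
  then have "a / b = z" "b \<ge> 1" using z assms(1) by auto
  moreover have "a \<ge> 1" using z assms(1) \<open>a / b = z\<close> by (cases a) auto
  ultimately show ?thesis using z that by auto
qed

theorem theorem3:
  fixes \<alpha> :: real
  assumes "\<alpha> > 0"
  shows "\<exists>(upd :: com) (qry :: com) (C :: real) (k :: nat) (w :: nat).
    \<forall>(n :: nat) (\<epsilon> :: real). n \<ge> 2 \<and> 0 < \<epsilon> \<and> \<epsilon> \<le> 1 / 2 \<longrightarrow>
      (\<exists>m :: nat.
        real (2 * m) \<le> C * ((1 / \<epsilon>) powr (1 + \<alpha>) * (ln (1 / \<epsilon>) * ln (real n)) powr (2 + 2 / \<alpha>)) \<and>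
        (\<forall>\<sigma> :: stream. strict_turnstile n \<sigma> \<longrightarrow>
          (\<exists>s xs.
            processed m (n ^ w) (C * ln (real n) ^ k) upd (initial_state n \<epsilon> \<alpha>) \<sigma> s \<and>
            query_result m (n ^ w) (C * (real n * ln (real n) ^ k)) qry s xs \<and>
            set xs \<subseteq> {..<n} \<and>
            real (length xs) \<le> C * (1 / \<epsilon>) \<and>
            (l1_norm n (stream_vec \<sigma>) > 0 \<longrightarrow>
              heavy_hitters n \<epsilon> (stream_vec \<sigma>) \<subseteq> set xs))))"
proof -
  obtain C0 :: nat where C0: "C0 \<ge> 1" "\<And>x. x \<ge> 1 \<Longrightarrow> \<exists>p. prime p \<and> x < p \<and> p \<le> C0 * x"
    using exists_prime_linear_gap by blast
  obtain a b :: nat where ab: "a \<ge> 1" "b \<ge> 1" and ratio: "\<alpha> / 2 \<le> a / b" "a / b \<le> \<alpha>"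
    using exists_ratio_between[of "\<alpha> / 2" \<alpha>] assms by auto
  define C where "C = max (max (space_const a C0 \<alpha>) (time_const a b C0)) 4"
  define k where "k = 8 * (b + 1)"
  define w where "w = word_exponent a b C0"
  have C_ge: "space_const a C0 \<alpha> \<le> C" "time_const a b C0 \<le> C" "4 \<le> C" unfolding C_def by auto
  have "\<exists>m. real (2 * m) \<le> C * ((1 / \<epsilon>) powr (1 + \<alpha>) * (ln (1 / \<epsilon>) * ln (real n)) powr (2 + 2 / \<alpha>)) \<and>
      finds_heavy_hitters (update_prog a b C0) (query_prog a b C0) n \<epsilon> \<alpha> m (n ^ w)
        (C * ln (real n) ^ k) (C * (real n * ln (real n) ^ k)) C"
    if "n \<ge> 2 \<and> 0 < \<epsilon> \<and> \<epsilon> \<le> 1 / 2" for n :: nat and \<epsilon> :: real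
  proof -
    interpret sketch n a b C0 \<epsilon> by unfold_locales (use that ab C0 in auto)
    interpret sketch_machine n a b C0 \<epsilon> "M + 20" "n ^ w" by unfold_locales (use word_bound w_def in auto)
    have "real update_time \<le> C * ln (real n) ^ k" "real query_time \<le> C * (real n * ln (real n) ^ k)"
      using order_trans[OF update_time_le mult_right_mono[OF C_ge(2)]]
        order_trans[OF query_time_le mult_right_mono[OF C_ge(2)]] n_ge unfolding k_def by auto
    then show ?thesis
      using sketch_finds_heavy_hitters C_ge(3) order_trans[OF space_le[OF ratio] mult_right_mono[OF C_ge(1)]]
      by (intro exI[of _ "M + 20"]) simp
  qed
  then show ?thesis unfolding finds_heavy_hitters_def by blast
qed

end
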